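(* The Maximum Reachability Trip Temporalisation problem (mrtt) is NP-hard, even when restricted to inputs $(D,\mathbb{T})$ that are symmetric trip networks with $D$ strongly connected.
   Context: A weighted multidigraph $D=(V,E)$ has a finite node set $V$ and a finite multiset $E$ of edges $(u,v,w)$ with weight $w>0$. A trip network is a pair $(D,\mathbb{T})$ where $\mathbb{T}$ is a finite multiset of walks in $D$ (trips); every node and edge of $D$ appears in some trip. A temporalisation $\tau$ assigns a real starting time $\tau(T)$ to each trip. For a trip $T=e_1,\dots,e_k$ with $e_i=(u_i,v_i,w_i)$, it induces temporal edges $(u_i,v_i,\tau(T)+\sum_{j<i}w_j,w_i)$ (tail, head, starting time, travel time). The induced temporal graph $G[D,\mathbb{T},\tau]$ has node set $V$ and all temporal edges induced by all trips. A temporal path from $u$ to $v$ is a sequence of consecutive temporal edges from $u$ to $v$ in which each edge's starting time is at least the arrival time (starting time plus travel time) of the previous one; $v$ is $\tau$-reachable from $u$ if such a path exists (every node reaches itself). The $\tau$-reachability is the number of ordered pairs $(u,v)$ with $v$ $\tau$-reachable from $u$; mrtt asks for a temporalisation maximising it. A trip network is symmetric if its trips can be grouped into disjoint pairs $(T,\overline{T})$ of two distinct members of $\mathbb{T}$ where $\overline{T}$ is the reverse of $T$, visiting the same nodes as $T$ in reverse order. *)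

theory Defs
  imports
    "HOL-Computational_Algebra.Polynomial"
    "Graph_Theory.Arc_Walk"
    "Graph_Theory.Digraph_Component"
begin

section \<open>Trip networks and temporalisations\<close>

text \<open>
  Multisets whose members have to be told apart (parallel edges of equal weight, repeated
  trips with different starting times) are represented as indexed families: edges are the
  arcs of a multidigraph, trips are the entries of a list of nonempty arc walks.
\<close>

definition trip_nodes :: "('v, 'e) pre_digraph \<Rightarrow> 'e list \<Rightarrow> 'v list" where
  "trip_nodes D T = pre_digraph.awalk_verts D (tail D (hd T)) T"

locale trip_network = fin_digraph D
  for D :: "('v, 'e) pre_digraph" +
  fixes weight :: "'e \<Rightarrow> real" and trips :: "'e list list"
  assumes weight_pos: "e \<in> arcs D \<Longrightarrow> weight e > 0"
    and trip_nonempty: "T \<in> set trips \<Longrightarrow> T \<noteq> []"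
    and trip_walk: "T \<in> set trips \<Longrightarrow> \<exists>u v. awalk u T v"
    and arc_in_trip: "e \<in> arcs D \<Longrightarrow> \<exists>T \<in> set trips. e \<in> set T"
    and node_in_trip: "v \<in> verts D \<Longrightarrow> \<exists>T \<in> set trips. v \<in> set (trip_nodes D T)"

text \<open>The grouping into pairs is a fixed-point-free involution \<open>\<pi>\<close> on the trip indices.\<close>

definition symmetric_trips :: "('v, 'e) pre_digraph \<Rightarrow> 'e list list \<Rightarrow> bool" where
  "symmetric_trips D trips \<longleftrightarrow>
    (\<exists>\<pi>. \<forall>i < length trips.
       \<pi> i < length trips \<and> \<pi> i \<noteq> i \<and> \<pi> (\<pi> i) = i \<and>
       trip_nodes D (trips ! \<pi> i) = rev (trip_nodes D (trips ! i)))"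

type_synonym 'v temporal_edge = "'v \<times> 'v \<times> real \<times> real"

text \<open>
  Temporal edges are (tail, head, starting time, travel time). A temporalisation assigns
  \<open>\<tau> j\<close> to the \<open>j\<close>-th trip. Multiplicities of temporal edges do not matter for reachability.
\<close>

definition temporal_edges ::
  "('v, 'e) pre_digraph \<Rightarrow> ('e \<Rightarrow> real) \<Rightarrow> 'e list list \<Rightarrow> (nat \<Rightarrow> real) \<Rightarrow> 'v temporal_edge set"
where
  "temporal_edges D weight trips \<tau> =
    {(tail D (trips ! j ! i), head D (trips ! j ! i),
      \<tau> j + (\<Sum>l<i. weight (trips ! j ! l)), weight (trips ! j ! i)) |
     j i. j < length trips \<and> i < length (trips ! j)}"

fun temporal_path :: "'v temporal_edge set \<Rightarrow> 'v \<Rightarrow> 'v temporal_edge list \<Rightarrow> 'v \<Rightarrow> bool" where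
  "temporal_path E u [] v \<longleftrightarrow> u = v"
| "temporal_path E u ((a, b, t, d) # es) v \<longleftrightarrow>
     (a, b, t, d) \<in> E \<and> a = u \<and>
     (case es of [] \<Rightarrow> True | (a', b', t', d') # _ \<Rightarrow> t + d \<le> t') \<and>
     temporal_path E b es v"

definition reachability ::
  "('v, 'e) pre_digraph \<Rightarrow> ('e \<Rightarrow> real) \<Rightarrow> 'e list list \<Rightarrow> (nat \<Rightarrow> real) \<Rightarrow> nat"
where
  "reachability D weight trips \<tau> =
    card {(u, v). u \<in> verts D \<and> v \<in> verts D \<and>
                  (\<exists>p. temporal_path (temporal_edges D weight trips \<tau>) u p v)}"


section \<open>Polynomial time and NP-hardness\<close>

text \<open>
  Deterministic multi-tape Turing machines with two-way infinite tapes. States are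
  \<open>0, \<dots>, states\<close>, where \<open>0\<close> is initial and \<open>states\<close> is the halting state; symbols are
  the numbers below \<open>symbols\<close>, where \<open>0\<close> is the blank and \<open>1\<close>, \<open>2\<close> represent the two bits.
  The input is on tape 0 and the output on tape 1.
\<close>

datatype move = Left | Stay | Right

record tm =
  tapes :: nat
  symbols :: nat
  states :: nat
  delta :: "nat \<Rightarrow> nat list \<Rightarrow> nat \<times> (nat \<times> move) list"

definition wf_tm :: "tm \<Rightarrow> bool" where
  "wf_tm M \<longleftrightarrow> tapes M \<ge> 2 \<and> symbols M \<ge> 3 \<and>
    (\<forall>q < states M. \<forall>rs. length rs = tapes M \<and> set rs \<subseteq> {..<symbols M} \<longrightarrow>
       (case delta M q rs of (q', acts) \<Rightarrow>
          q' \<le> states M \<and> length acts = tapes M \<and> fst ` set acts \<subseteq> {..<symbols M}))"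

text \<open>A tape is its contents together with the head position.\<close>

type_synonym tape = "(int \<Rightarrow> nat) \<times> int"
type_synonym config = "nat \<times> tape list"

fun move_head :: "move \<Rightarrow> int \<Rightarrow> int" where
  "move_head Left h = h - 1"
| "move_head Stay h = h"
| "move_head Right h = h + 1"

fun act_tape :: "nat \<times> move \<Rightarrow> tape \<Rightarrow> tape" where
  "act_tape (s, m) (c, h) = (c(h := s), move_head m h)"

definition tm_step :: "tm \<Rightarrow> config \<Rightarrow> config" where
  "tm_step M cfg = (case cfg of (q, ts) \<Rightarrow>
    if q < states M
    then (case delta M q (map (\<lambda>(c, h). c h) ts) of (q', acts) \<Rightarrow> (q', map2 act_tape acts ts))
    else (q, ts))"

definition string_contents :: "bool list \<Rightarrow> int \<Rightarrow> nat" where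
  "string_contents x i =
    (if 0 \<le> i \<and> i < int (length x) then (if x ! nat i then 2 else 1) else 0)"

definition initial_config :: "tm \<Rightarrow> bool list \<Rightarrow> config" where
  "initial_config M x = (0, (string_contents x, 0) # replicate (tapes M - 1) (\<lambda>_. 0, 0))"

definition halts_with_output :: "tm \<Rightarrow> config \<Rightarrow> bool list \<Rightarrow> bool" where
  "halts_with_output M cfg y \<longleftrightarrow>
    fst cfg = states M \<and> fst (snd cfg ! 1) = string_contents y"

definition polytime :: "(bool list \<Rightarrow> bool list) \<Rightarrow> bool" where
  "polytime f \<longleftrightarrow>
    (\<exists>M (p :: nat poly). wf_tm M \<and>
      (\<forall>x. \<exists>n \<le> poly p (length x).
         halts_with_output M ((tm_step M ^^ n) (initial_config M x)) (f x)))"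

text \<open>A prefix-free list encoding: every entry is announced by a \<open>True\<close>, the end by a \<open>False\<close>.\<close>

definition encode_list :: "('a \<Rightarrow> bool list) \<Rightarrow> 'a list \<Rightarrow> bool list" where
  "encode_list f xs = concat (map (\<lambda>x. True # f x) xs) @ [False]"

definition encode_pair :: "bool list \<Rightarrow> bool list \<Rightarrow> bool list" where
  "encode_pair x y = encode_list (\<lambda>b. [b]) x @ y"

definition in_NP :: "bool list set \<Rightarrow> bool" where
  "in_NP L \<longleftrightarrow>
    (\<exists>R (p :: nat poly). polytime (\<lambda>z. [R z]) \<and>
      (\<forall>x. x \<in> L \<longleftrightarrow> (\<exists>y. length y \<le> poly p (length x) \<and> R (encode_pair x y))))"

text \<open>
  NP-hardness, under polynomial-time many-one reductions, of the problem of deciding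
  membership in \<open>A\<close> for inputs that are guaranteed to belong to \<open>I\<close>.
\<close>

definition NP_hard_on :: "bool list set \<Rightarrow> bool list set \<Rightarrow> bool" where
  "NP_hard_on I A \<longleftrightarrow>
    (\<forall>L. in_NP L \<longrightarrow>
      (\<exists>f. polytime f \<and> (\<forall>x. f x \<in> I \<and> (x \<in> L \<longleftrightarrow> f x \<in> A))))"


section \<open>Maximum Reachability Trip Temporalisation as a computational problem\<close>

text \<open>
  An instance consists of the number of nodes, the list of edges (tail, head, weight) and the
  list of trips, each given by the sequence of its edge indices. All numbers are in binary.
\<close>

type_synonym mrtt_input = "nat \<times> (nat \<times> nat \<times> rat) list \<times> nat list list"

fun input_digraph :: "mrtt_input \<Rightarrow> (nat, nat) pre_digraph" where
  "input_digraph (n, es, Ts) =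
    \<lparr>verts = {..<n}, arcs = {..<length es},
     tail = (\<lambda>i. fst (es ! i)), head = (\<lambda>i. fst (snd (es ! i)))\<rparr>"

fun input_weight :: "mrtt_input \<Rightarrow> nat \<Rightarrow> real" where
  "input_weight (n, es, Ts) i = of_rat (snd (snd (es ! i)))"

fun input_trips :: "mrtt_input \<Rightarrow> nat list list" where
  "input_trips (n, es, Ts) = Ts"

definition valid_input :: "mrtt_input \<Rightarrow> bool" where
  "valid_input N \<longleftrightarrow> trip_network (input_digraph N) (input_weight N) (input_trips N)"

fun binary :: "nat \<Rightarrow> bool list" where
  "binary n = (if n = 0 then [] else odd n # binary (n div 2))"

declare binary.simps [simp del]

definition encode_nat :: "nat \<Rightarrow> bool list" where
  "encode_nat n = encode_list (\<lambda>b. [b]) (binary n)"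

text \<open>Only used for positive rationals, represented by their reduced fraction.\<close>

definition encode_rat :: "rat \<Rightarrow> bool list" where
  "encode_rat r = (case quotient_of r of (a, b) \<Rightarrow> encode_nat (nat a) @ encode_nat (nat b))"

fun encode_mrtt :: "mrtt_input \<Rightarrow> nat \<Rightarrow> bool list" where
  "encode_mrtt (n, es, Ts) k =
    encode_nat n @
    encode_list (\<lambda>(u, v, w). encode_nat u @ encode_nat v @ encode_rat w) es @
    encode_list (encode_list encode_nat) Ts @
    encode_nat k"

text \<open>The decision version: can reachability at least \<open>k\<close> be achieved?\<close>

definition MRTT :: "bool list set" where
  "MRTT = {encode_mrtt N k | N k. valid_input N \<and>
    (\<exists>\<tau>. reachability (input_digraph N) (input_weight N) (input_trips N) \<tau> \<ge> k)}"

definition symmetric_strongly_connected_inputs :: "bool list set" where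
  "symmetric_strongly_connected_inputs =
    {encode_mrtt N k | N k. valid_input N \<and>
      symmetric_trips (input_digraph N) (input_trips N) \<and>
      strongly_connected (input_digraph N)}"


subsection \<open>The encoding is injective\<close>

definition prefix_code :: "('a \<Rightarrow> bool list) \<Rightarrow> 'a set \<Rightarrow> bool" where
  "prefix_code f A \<longleftrightarrow>
    (\<forall>a \<in> A. \<forall>b \<in> A. \<forall>xs ys. f a @ xs = f b @ ys \<longrightarrow> a = b \<and> xs = ys)"

lemma prefix_codeD:
  "\<lbrakk>prefix_code f A; f a @ xs = f b @ ys; a \<in> A; b \<in> A\<rbrakk> \<Longrightarrow> a = b \<and> xs = ys"
  unfolding prefix_code_def by blast

lemma prefix_code_list:
  assumes "prefix_code f A"
  shows "prefix_code (encode_list f) (lists A)"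
proof -
  have "as = bs \<and> xs = ys"
    if "encode_list f as @ xs = encode_list f bs @ ys" "set as \<subseteq> A" "set bs \<subseteq> A" for as bs xs ys
    using that
  proof (induction as arbitrary: bs)
    case Nil
    then show ?case by (cases bs) (auto simp: encode_list_def)
  next
    case (Cons a as)
    then obtain b bs' where bs: "bs = b # bs'"
      by (cases bs) (auto simp: encode_list_def)
    have "f a @ (encode_list f as @ xs) = f b @ (encode_list f bs' @ ys)"
      using Cons.prems(1) by (simp add: bs encode_list_def)
    from prefix_codeD[OF assms this] Cons.prems(2,3)
    have "a = b \<and> encode_list f as @ xs = encode_list f bs' @ ys"
      by (simp add: bs)
    with Cons.IH[of bs'] Cons.prems(2,3) show ?case by (simp add: bs)
  qed
  then show ?thesis unfolding prefix_code_def lists_eq_set by blast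
qed

lemma binary_inj: "binary m = binary n \<Longrightarrow> m = n"
proof (induction m arbitrary: n rule: less_induct)
  case (less m)
  show ?case
  proof (cases "m = 0 \<or> n = 0")
    case True
    with less.prems show ?thesis
      by (auto simp: binary.simps[of m] binary.simps[of n] split: if_splits)
  next
    case False
    with less.prems have eq: "odd m = odd n" "binary (m div 2) = binary (n div 2)"
      by (auto simp: binary.simps[of m] binary.simps[of n])
    from less.IH[OF _ eq(2)] False have "m div 2 = n div 2" by simp
    with eq(1) show ?thesis by presburger
  qed
qed

lemma prefix_code_nat: "prefix_code encode_nat UNIV"
proof -
  have *: "prefix_code (encode_list (\<lambda>b. [b])) (lists UNIV)"
    by (rule prefix_code_list) (simp add: prefix_code_def)
  have "m = n \<and> xs = ys" if eq: "encode_nat m @ xs = encode_nat n @ ys" for m n xs ys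
    using prefix_codeD[OF * eq[unfolded encode_nat_def]] binary_inj[of m n] by simp
  then show ?thesis unfolding prefix_code_def by blast
qed

lemma prefix_code_rat: "prefix_code encode_rat {0<..}"
  unfolding prefix_code_def
proof (intro ballI allI impI)
  fix r s :: rat and xs ys
  assume pos: "r \<in> {0<..}" "s \<in> {0<..}" and eq: "encode_rat r @ xs = encode_rat s @ ys"
  obtain a b c d where q: "quotient_of r = (a, b)" "quotient_of s = (c, d)"
    by (metis surj_pair)
  have "b > 0" "d > 0" using q by (auto dest: quotient_of_denom_pos)
  moreover from this pos have "a > 0" "c > 0"
    using quotient_of_div[OF q(1)] quotient_of_div[OF q(2)] by (auto simp: zero_less_divide_iff)
  moreover have "nat a = nat c \<and> nat b = nat d \<and> xs = ys"
    using eq by (auto simp: encode_rat_def q dest!: prefix_codeD[OF prefix_code_nat])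
  ultimately have "quotient_of r = quotient_of s" "xs = ys" by (auto simp: q)
  then show "r = s \<and> xs = ys" by (auto dest: quotient_of_inject)
qed

lemma valid_input_weight_pos:
  assumes "valid_input (n, es, Ts)" "(u, v, w) \<in> set es"
  shows "w > 0"
proof -
  interpret trip_network "input_digraph (n, es, Ts)" "input_weight (n, es, Ts)"
    "input_trips (n, es, Ts)"
    using assms(1) by (simp only: valid_input_def)
  obtain i where "i < length es" "es ! i = (u, v, w)"
    using assms(2) by (auto simp: in_set_conv_nth)
  with weight_pos[of i] show ?thesis by simp
qed

lemma encode_mrtt_inj:
  assumes "valid_input N" "valid_input N'" "encode_mrtt N k = encode_mrtt N' k'"
  shows "N = N' \<and> k = k'"
proof -
  obtain n es Ts n' es' Ts' where N: "N = (n, es, Ts)" "N' = (n', es', Ts')"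
    by (metis surj_pair)
  let ?e = "\<lambda>(u, v, w). encode_nat u @ encode_nat v @ encode_rat w"
  have "prefix_code ?e (UNIV \<times> UNIV \<times> {0<..})"
    unfolding prefix_code_def
    by (auto dest!: prefix_codeD[OF prefix_code_nat] prefix_codeD[OF prefix_code_rat])
  from prefix_code_list[OF this]
  have E: "prefix_code (encode_list ?e) (lists (UNIV \<times> UNIV \<times> {0<..}))" .
  have T: "prefix_code (encode_list (encode_list encode_nat)) (lists (lists UNIV))"
    by (intro prefix_code_list prefix_code_nat)
  have pos: "es \<in> lists (UNIV \<times> UNIV \<times> {0<..})" "es' \<in> lists (UNIV \<times> UNIV \<times> {0<..})"
    using assms(1,2) by (auto simp: N lists_eq_set dest: valid_input_weight_pos)
  note eq = assms(3)[unfolded N encode_mrtt.simps]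
  from prefix_codeD[OF prefix_code_nat eq]
  have 1: "n = n'" and eq1: "encode_list ?e es @ encode_list (encode_list encode_nat) Ts @ encode_nat k
      = encode_list ?e es' @ encode_list (encode_list encode_nat) Ts' @ encode_nat k'" by auto
  from prefix_codeD[OF E eq1 pos]
  have 2: "es = es'" and eq2: "encode_list (encode_list encode_nat) Ts @ encode_nat k
      = encode_list (encode_list encode_nat) Ts' @ encode_nat k'" by auto
  from prefix_codeD[OF T eq2] have 3: "Ts = Ts'" and eq3: "encode_nat k @ [] = encode_nat k' @ []"
    by auto
  from prefix_codeD[OF prefix_code_nat eq3] have "k = k'" by auto
  with 1 2 3 show ?thesis by (simp add: N)
qed

end

theory Submission
  imports Defs
begin

text \<open>
  The reduction passes through CNF-SAT. The run of a verifier is described by Horn clauses about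
  the tape contents relative to the heads, where only the certificate is a real choice. The clauses
  form finitely many families indexed by loop counters, so that the network of the formula is
  written down by nested loops; a multi-tape machine executes them in polynomial time with its head
  positions as counters.

  In the network every clause has a line, a trip that runs from a block of \<open>L\<close> nodes over a hub to
  a second such block, and one last line runs likewise over a second hub. Missing a single pair of
  blocks costs more than all pairs with a node outside the blocks, so the bound is met iff all
  blocks are connected. The distances between the blocks leave no time to wait between them: all
  lines have to pass their hubs at the same time, and the first block of a clause reaches the second
  block of the last line only over the gadget of one of its literals. The single trip through the
  gadget of a variable can serve the entrance of the positive or that of the negative occurrences
  at the required time, but not both. Conversely, a satisfying assignment yields a schedule in which
  all lines and their reverses meet at the hubs at time 0.
\<close>

section \<open>Counter machines\<close>

datatype test = NonZero nat | InputNot nat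
datatype prim = Inc nat | Dec nat | Out bool | InputLeft | InputRight
datatype com = Done | Prim prim | Then com com (infixr ";;" 60)
  | Choose test com com | Loop test com

text \<open>The position of the input head, the register contents and the output so far.\<close>

type_synonym cstate = "int \<times> (nat \<Rightarrow> nat) \<times> bool list"

fun holds :: "bool list \<Rightarrow> cstate \<Rightarrow> test \<Rightarrow> bool" where
  "holds x (h, \<rho>, out) (NonZero r) \<longleftrightarrow> \<rho> r \<noteq> 0"
| "holds x (h, \<rho>, out) (InputNot s) \<longleftrightarrow> string_contents x h \<noteq> s"

fun perform :: "prim \<Rightarrow> cstate \<Rightarrow> cstate" where
  "perform (Inc r) (h, \<rho>, out) = (h, \<rho>(r := \<rho> r + 1), out)"
| "perform (Dec r) (h, \<rho>, out) = (h, \<rho>(r := \<rho> r - 1), out)"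
| "perform (Out b) (h, \<rho>, out) = (h, \<rho>, out @ [b])"
| "perform InputLeft (h, \<rho>, out) = (h - 1, \<rho>, out)"
| "perform InputRight (h, \<rho>, out) = (h + 1, \<rho>, out)"

fun advance :: "(test \<Rightarrow> bool) \<Rightarrow> com \<Rightarrow> com \<times> prim option" where
  "advance v Done = (Done, None)"
| "advance v (Prim a) = (Done, Some a)"
| "advance v (c1 ;; c2) =
    (if c1 = Done then (c2, None) else case advance v c1 of (c1', a) \<Rightarrow> (c1' ;; c2, a))"
| "advance v (Choose b c1 c2) = (if v b then c1 else c2, None)"
| "advance v (Loop b c) = (if v b then c ;; Loop b c else Done, None)"

definition cstep :: "bool list \<Rightarrow> com \<times> cstate \<Rightarrow> com \<times> cstate" where
  "cstep x cs = (case cs of (c, s) \<Rightarrow> case advance (holds x s) c of (c', a) \<Rightarrow>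
     (c', case a of None \<Rightarrow> s | Some p \<Rightarrow> perform p s))"

definition runs :: "bool list \<Rightarrow> com \<Rightarrow> cstate \<Rightarrow> nat \<Rightarrow> cstate \<Rightarrow> bool" where
  "runs x c s n s' \<longleftrightarrow> (cstep x ^^ n) (c, s) = (Done, s')"

lemma cstep_Done [simp]: "cstep x (Done, s) = (Done, s)"
  by (simp add: cstep_def)

lemma cstep_pow_Done [simp]: "(cstep x ^^ n) (Done, s) = (Done, s)"
  by (induction n) auto

lemma runs_mono: "runs x c s n s' \<Longrightarrow> n \<le> n' \<Longrightarrow> runs x c s n' s'"
  using funpow_add[of "n' - n" n "cstep x"] by (auto simp: runs_def)

lemma runs_Suc: "cstep x (c, s) = (c', s'') \<Longrightarrow> runs x c' s'' n s' \<Longrightarrow> runs x c s (Suc n) s'"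
  unfolding runs_def by (simp add: funpow_Suc_right del: funpow.simps)

lemma runs_Done: "runs x Done s n s"
  by (simp add: runs_def)

lemma runs_Prim: "runs x (Prim a) s 1 (perform a s)"
  by (simp add: runs_def cstep_def)

lemma runs_Then:
  assumes "runs x c1 s n1 s1" "runs x c2 s1 n2 s2"
  shows "runs x (c1 ;; c2) s (n1 + n2 + 1) s2"
  using assms(1)
proof (induction n1 arbitrary: c1 s)
  case 0
  then have "c1 = Done" "s = s1" by (auto simp: runs_def)
  then show ?case using assms(2)
    by (auto intro!: runs_Suc[of _ _ _ c2 s1] simp: cstep_def)
next
  case (Suc n1)
  show ?case
  proof (cases "c1 = Done")
    case True
    then have "s = s1" using Suc.prems by (auto simp: runs_def)
    then have "runs x (c1 ;; c2) s (Suc n2) s2" using assms(2) True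
      by (auto intro!: runs_Suc[of _ _ _ c2 s1] simp: cstep_def)
    then show ?thesis by (rule runs_mono) simp
  next
    case False
    obtain c1' s' where first_step: "cstep x (c1, s) = (c1', s')" by (metis surj_pair)
    then have "runs x c1' s' n1 s1"
      using Suc.prems by (simp add: runs_def funpow_Suc_right del: funpow.simps)
    from Suc.IH[OF this] have "runs x (c1' ;; c2) s' (n1 + n2 + 1) s2" .
    moreover have "cstep x (c1 ;; c2, s) = (c1' ;; c2, s')"
      using False first_step by (auto simp: cstep_def split: prod.splits)
    ultimately show ?thesis using runs_Suc by fastforce
  qed
qed

lemma runs_Choose:
  assumes "runs x (if holds x s b then c1 else c2) s n s'"
  shows "runs x (Choose b c1 c2) s (n + 1) s'"
  using runs_Suc[OF _ assms, of "Choose b c1 c2" s] by (simp add: cstep_def)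

lemma runs_Loop_false: "\<not> holds x s b \<Longrightarrow> runs x (Loop b c) s 1 s"
  by (simp add: runs_def cstep_def)

lemma runs_Loop_true:
  assumes "holds x s b" "runs x c s n1 s1" "runs x (Loop b c) s1 n2 s2"
  shows "runs x (Loop b c) s (n1 + n2 + 2) s2"
  using runs_Suc[OF _ runs_Then[OF assms(2,3)], of "Loop b c" s] assms(1) by (simp add: cstep_def)

lemma runs_Loop:
  assumes "\<And>i. i < n \<Longrightarrow> holds x (S i) b" "\<not> holds x (S n) b"
    and "\<And>i. i < n \<Longrightarrow> runs x c (S i) T (S (Suc i))"
  shows "runs x (Loop b c) (S 0) (n * (T + 2) + 1) (S n)"
  using assms
proof (induction n arbitrary: S)
  case 0
  then show ?case using runs_Loop_false[of x "S 0" b c] by simp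
next
  case (Suc n)
  have "runs x (Loop b c) (S (Suc 0)) (n * (T + 2) + 1) (S (Suc n))"
    using Suc.IH[of "\<lambda>i. S (Suc i)"] Suc.prems by simp
  from runs_Loop_true[OF _ _ this] Suc.prems
  have "runs x (Loop b c) (S 0) (T + (n * (T + 2) + 1) + 2) (S (Suc n))" by blast
  then show ?case by (rule runs_mono) simp
qed

section \<open>Commands as Turing machines\<close>

text \<open>The commands still to be executed serve as the states of the Turing machine.\<close>

fun residuals :: "com \<Rightarrow> com set" where
  "residuals Done = {Done}"
| "residuals (Prim a) = {Prim a, Done}"
| "residuals (c1 ;; c2) = (\<lambda>c. c ;; c2) ` residuals c1 \<union> residuals c2"
| "residuals (Choose b c1 c2) = {Choose b c1 c2} \<union> residuals c1 \<union> residuals c2"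
| "residuals (Loop b c) = {Loop b c, Done} \<union> (\<lambda>c'. c' ;; Loop b c) ` residuals c"

lemma finite_residuals: "finite (residuals c)"
  by (induction c) auto

lemma residuals_refl: "c \<in> residuals c"
  by (induction c) auto

lemma Done_in_residuals: "Done \<in> residuals c"
  by (induction c) auto

lemma advance_in_residuals: "c' \<in> residuals c \<Longrightarrow> fst (advance v c') \<in> residuals c"
proof (induction c arbitrary: c')
  case (Then c1 c2)
  then show ?case
    by (fastforce simp: residuals_refl split: prod.splits)
next
  case (Loop b c)
  then show ?case
    by (fastforce simp: residuals_refl split: prod.splits if_splits)
qed (auto simp: residuals_refl)

primrec test_regs :: "test \<Rightarrow> nat set" where
  "test_regs (NonZero r) = {r}"
| "test_regs (InputNot s) = {}"

primrec prim_regs :: "prim \<Rightarrow> nat set" where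
  "prim_regs (Inc r) = {r}"
| "prim_regs (Dec r) = {r}"
| "prim_regs (Out b) = {}"
| "prim_regs InputLeft = {}"
| "prim_regs InputRight = {}"

primrec com_regs :: "com \<Rightarrow> nat set" where
  "com_regs Done = {}"
| "com_regs (Prim a) = prim_regs a"
| "com_regs (c1 ;; c2) = com_regs c1 \<union> com_regs c2"
| "com_regs (Choose b c1 c2) = test_regs b \<union> com_regs c1 \<union> com_regs c2"
| "com_regs (Loop b c) = test_regs b \<union> com_regs c"

lemma finite_com_regs: "finite (com_regs c)"
proof -
  have "finite (test_regs b)" "finite (prim_regs a)" for a b
    by (cases b; simp) (cases a; simp)
  then show ?thesis by (induction c) simp_all
qed

lemma com_regs_residuals: "c' \<in> residuals c \<Longrightarrow> com_regs c' \<subseteq> com_regs c"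
  by (induction c arbitrary: c') fastforce+

lemma advance_cong:
  "(\<And>b. test_regs b \<subseteq> R \<Longrightarrow> v b = v' b) \<Longrightarrow> com_regs c \<subseteq> R \<Longrightarrow> advance v c = advance v' c"
  by (induction c) (auto split: prod.splits)

lemma advance_prim_regs: "snd (advance v c) = Some a \<Longrightarrow> prim_regs a \<subseteq> com_regs c"
proof (induction c)
  case (Then c1 c2)
  then have "prim_regs a \<subseteq> com_regs c1" by (simp split: prod.splits if_splits)
  then show ?case by auto
qed (auto split: if_splits)

text \<open>A register is the head position on a tape whose only nonblank cell is a mark at position 0.\<close>

definition reg_tape :: "nat \<Rightarrow> tape" where
  "reg_tape v = (\<lambda>i. if i = 0 then 1 else 0, int v)"

fun state_tapes :: "nat \<Rightarrow> bool list \<Rightarrow> cstate \<Rightarrow> tape list" where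
  "state_tapes K x (h, \<rho>, out) =
    (string_contents x, h) # (string_contents out, int (length out)) #
    map (\<lambda>r. reg_tape (\<rho> r)) [0..<K]"

fun read_test :: "nat list \<Rightarrow> test \<Rightarrow> bool" where
  "read_test rs (NonZero r) \<longleftrightarrow> rs ! (r + 2) \<noteq> 1"
| "read_test rs (InputNot s) \<longleftrightarrow> rs ! 0 \<noteq> s"

fun prim_tape :: "prim \<Rightarrow> nat" where
  "prim_tape (Inc r) = r + 2"
| "prim_tape (Dec r) = r + 2"
| "prim_tape (Out b) = 1"
| "prim_tape InputLeft = 0"
| "prim_tape InputRight = 0"

fun prim_act :: "prim \<Rightarrow> nat \<Rightarrow> nat \<times> move" where
  "prim_act (Inc r) s = (s, Right)"
| "prim_act (Dec r) s = (s, if s = 1 then Stay else Left)"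
| "prim_act (Out b) s = (if b then 2 else 1, Right)"
| "prim_act InputLeft s = (s, Left)"
| "prim_act InputRight s = (s, Right)"

definition stay :: "nat list \<Rightarrow> (nat \<times> move) list" where
  "stay rs = map (\<lambda>s. (s, Stay)) rs"

fun prim_acts :: "prim option \<Rightarrow> nat list \<Rightarrow> (nat \<times> move) list" where
  "prim_acts None rs = stay rs"
| "prim_acts (Some p) rs = (stay rs)[prim_tape p := prim_act p (rs ! prim_tape p)]"

definition readings :: "tape list \<Rightarrow> nat list" where
  "readings ts = map (\<lambda>(c, h). c h) ts"

lemma string_contents_snoc:
  "(string_contents out)(int (length out) := if b then 2 else 1) = string_contents (out @ [b])"
  by (rule ext) (auto simp: string_contents_def nth_append)

lemma map2_act_stay: "map2 act_tape (stay (readings ts)) ts = ts"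
  by (induction ts) (auto simp: stay_def readings_def)

lemma map2_act_update:
  assumes "n < length ts"
  shows "map2 act_tape ((stay (readings ts))[n := a]) ts = ts[n := act_tape a (ts ! n)]"
proof -
  have "map2 act_tape ((stay (readings ts))[n := a]) ts
     = (map2 act_tape (stay (readings ts)) ts)[n := act_tape a (ts ! n)]"
    using assms by (intro nth_equalityI) (auto simp: stay_def readings_def nth_list_update)
  then show ?thesis by (simp only: map2_act_stay)
qed

lemma registers_update:
  "(map (\<lambda>k. reg_tape (\<rho> k)) [0..<K])[r := reg_tape v] = map (\<lambda>k. reg_tape ((\<rho>(r := v)) k)) [0..<K]"
  by (rule nth_equalityI) (auto simp: nth_list_update)

lemma act_tape_prim:
  assumes "prim_regs p \<subseteq> {..<K}"
  shows "(state_tapes K x s)[prim_tape p :=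
      act_tape (prim_act p (readings (state_tapes K x s) ! prim_tape p))
        (state_tapes K x s ! prim_tape p)] =
    state_tapes K x (perform p s)"
proof -
  obtain h \<rho> out where s: "s = (h, \<rho>, out)" by (metis surj_pair)
  have inc: "act_tape (prim_act (Inc r) (case reg_tape v of (c, h) \<Rightarrow> c h)) (reg_tape v) =
      reg_tape (v + 1)" for r v
    by (auto simp: reg_tape_def)
  have dec: "act_tape (prim_act (Dec r) (case reg_tape v of (c, h) \<Rightarrow> c h)) (reg_tape v) =
      reg_tape (v - 1)" for r v
    by (auto simp: reg_tape_def)
  show ?thesis
  proof (cases p)
    case (Inc r)
    then show ?thesis
      using assms inc[of r "\<rho> r"] registers_update[of \<rho> K r "\<rho> r + 1"]
      by (simp add: s readings_def del: prim_act.simps fun_upd_apply)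
  next
    case (Dec r)
    then show ?thesis
      using assms dec[of r "\<rho> r"] registers_update[of \<rho> K r "\<rho> r - 1"]
      by (simp add: s readings_def del: prim_act.simps fun_upd_apply)
  next
    case (Out b)
    then show ?thesis by (simp add: s string_contents_snoc del: if_split)
  qed (simp_all add: s readings_def)
qed

lemma prim_acts_correct:
  assumes "\<And>p. a = Some p \<Longrightarrow> prim_regs p \<subseteq> {..<K}"
  shows "map2 act_tape (prim_acts a (readings (state_tapes K x s))) (state_tapes K x s) =
    state_tapes K x (case a of None \<Rightarrow> s | Some p \<Rightarrow> perform p s)"
proof (cases a)
  case (Some p)
  then have "prim_regs p \<subseteq> {..<K}" by (rule assms)
  moreover from this have "prim_tape p < length (state_tapes K x s)" by (cases s; cases p) auto
  ultimately show ?thesis using Some by (simp add: map2_act_update act_tape_prim)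
qed (simp add: map2_act_stay)

lemma prim_acts_wf:
  assumes "set rs \<subseteq> {..<3}"
  shows "length (prim_acts a rs) = length rs" "fst ` set (prim_acts a rs) \<subseteq> {..<3}"
proof -
  have stay: "fst ` set (stay rs) \<subseteq> {..<3}" using assms by (auto simp: stay_def)
  show "length (prim_acts a rs) = length rs" by (cases a) (simp_all add: stay_def)
  show "fst ` set (prim_acts a rs) \<subseteq> {..<3}"
  proof (cases a)
    case (Some p)
    show ?thesis
    proof (cases "prim_tape p < length rs")
      case True
      then have "rs ! prim_tape p < 3" using assms nth_mem by blast
      then have "fst (prim_act p (rs ! prim_tape p)) < 3" by (cases p) auto
      then show ?thesis
        using stay set_update_subset_insert[of "stay rs" "prim_tape p"] by (fastforce simp: Some)
    next
      case False
      then show ?thesis using stay by (simp add: Some list_update_beyond stay_def)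
    qed
  qed (simp add: stay)
qed

locale com_machine =
  fixes c :: com and K n :: nat and code :: "com \<Rightarrow> nat"
  assumes com_regs_less: "com_regs c \<subseteq> {..<K}"
    and bij_code: "bij_betw code (residuals c) {1..n}"
    and code_Done: "code Done = n"
begin

definition machine :: tm where
  "machine = \<lparr>tapes = K + 2, symbols = 3, states = n,
    delta = (\<lambda>q rs. if q = 0
      then (code c, (rs ! 0, Stay) # (rs ! 1, Stay) # replicate K (1, Stay))
      else (case advance (read_test rs) (inv_into (residuals c) code q) of
        (c', a) \<Rightarrow> (code c', prim_acts a rs)))\<rparr>"

lemma code_bounds: "c' \<in> residuals c \<Longrightarrow> code c' \<in> {1..n}"
  using bij_code by (auto simp: bij_betw_def)

lemma code_less: "c' \<in> residuals c \<Longrightarrow> c' \<noteq> Done \<Longrightarrow> code c' < n"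
  using code_bounds[of c'] bij_code Done_in_residuals[of c] code_Done
  by (force simp: bij_betw_def inj_on_def)

lemma wf_machine: "wf_tm machine"
  unfolding wf_tm_def
proof (intro conjI allI impI)
  fix q rs assume q: "q < states machine"
    and rs: "length rs = tapes machine \<and> set rs \<subseteq> {..<symbols machine}"
  show "case delta machine q rs of (q', acts) \<Rightarrow>
     q' \<le> states machine \<and> length acts = tapes machine \<and> fst ` set acts \<subseteq> {..<symbols machine}"
  proof (cases "q = 0")
    case True
    have "rs ! i < 3" if "i < 2" for i
      using rs that nth_mem[of i rs] by (auto simp: machine_def subset_iff)
    then have "rs ! 0 < 3" "rs ! 1 < 3" by simp_all
    then show ?thesis using True code_bounds[OF residuals_refl] by (auto simp: machine_def)
  next
    case False
    then have "q \<in> code ` residuals c"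
      using q bij_code by (auto simp: machine_def bij_betw_def)
    from inv_into_into[OF this]
    have "inv_into (residuals c) code q \<in> residuals c" .
    from code_bounds[OF advance_in_residuals[OF this, of "read_test rs"]]
    show ?thesis using False prim_acts_wf[of rs] rs
      by (auto simp: machine_def split: prod.splits)
  qed
qed (auto simp: machine_def)

lemma machine_init:
  "tm_step machine (initial_config machine x) = (code c, state_tapes K x (0, \<lambda>_. 0, []))"
proof -
  have "0 < n" using code_bounds[OF residuals_refl] by simp
  moreover have "string_contents [] = (\<lambda>_. 0)" by (auto simp: string_contents_def)
  moreover have "map2 act_tape (replicate K (1, Stay)) (replicate K (\<lambda>_. 0, 0)) =
     map (\<lambda>r. reg_tape 0) [0..<K]"
    by (rule nth_equalityI) (auto simp: reg_tape_def)
  ultimately show ?thesis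
    by (auto simp: tm_step_def initial_config_def machine_def)
qed

lemma read_test_readings:
  "test_regs b \<subseteq> {..<K} \<Longrightarrow> read_test (readings (state_tapes K x s)) b = holds x s b"
  by (cases s; cases b) (auto simp: readings_def reg_tape_def)

lemma machine_step:
  assumes c': "c' \<in> residuals c"
  shows "tm_step machine (code c', state_tapes K x s) =
    (case cstep x (c', s) of (c'', s') \<Rightarrow> (code c'', state_tapes K x s'))"
proof (cases "c' = Done")
  case True
  then show ?thesis by (simp add: tm_step_def machine_def code_Done)
next
  case False
  let ?rs = "readings (state_tapes K x s)"
  obtain c'' a where step: "advance (holds x s) c' = (c'', a)" by (metis surj_pair)
  have regs: "com_regs c' \<subseteq> {..<K}" using com_regs_residuals[OF c'] com_regs_less by blast
  have "advance (read_test ?rs) c' = (c'', a)"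
    unfolding step[symmetric] by (rule advance_cong[OF read_test_readings regs])
  moreover have "inv_into (residuals c) code (code c') = c'"
    using bij_code c' by (simp add: bij_betw_def)
  moreover have q: "0 < code c'" "code c' < n"
    using code_bounds[OF c'] code_less[OF c' False] by auto
  ultimately have "delta machine (code c') ?rs = (code c'', prim_acts a ?rs)"
    by (simp add: machine_def)
  then have "tm_step machine (code c', state_tapes K x s) =
      (code c'', map2 act_tape (prim_acts a ?rs) (state_tapes K x s))"
    using q by (simp add: tm_step_def readings_def machine_def)
  also have "\<dots> = (code c'', state_tapes K x (case a of None \<Rightarrow> s | Some p \<Rightarrow> perform p s))"
    using advance_prim_regs[of "holds x s" c'] step regs by (subst prim_acts_correct) fastforce+
  finally show ?thesis by (simp add: step cstep_def)
qed

lemma machine_steps: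
  "fst ((cstep x ^^ k) (c, s)) \<in> residuals c \<and>
    (tm_step machine ^^ k) (code c, state_tapes K x s) =
      (case (cstep x ^^ k) (c, s) of (c', s') \<Rightarrow> (code c', state_tapes K x s'))"
proof (induction k)
  case 0
  then show ?case by (simp add: residuals_refl)
next
  case (Suc k)
  obtain c' s' where cs: "(cstep x ^^ k) (c, s) = (c', s')" by (metis surj_pair)
  with Suc have c': "c' \<in> residuals c" by simp
  then have "fst (cstep x (c', s')) \<in> residuals c"
    using advance_in_residuals[OF c', of "holds x s'"] by (auto simp: cstep_def split: prod.splits)
  with machine_step[OF c', of x s'] Suc cs show ?case by simp
qed

lemma machine_output:
  assumes "runs x c (0, \<lambda>_. 0, []) k (h, \<rho>, out)"
  shows "halts_with_output machine ((tm_step machine ^^ Suc k) (initial_config machine x)) out"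
proof -
  have "(tm_step machine ^^ Suc k) (initial_config machine x) =
      (tm_step machine ^^ k) (code c, state_tapes K x (0, \<lambda>_. 0, []))"
    by (simp add: funpow_Suc_right machine_init del: funpow.simps state_tapes.simps)
  also have "\<dots> = (n, state_tapes K x (h, \<rho>, out))"
    using machine_steps[of k x "(0, \<lambda>_. 0, [])"] assms
    by (simp add: runs_def code_Done del: state_tapes.simps)
  finally show ?thesis by (simp add: halts_with_output_def machine_def)
qed

end

lemma ex_com_machine: "\<exists>K n code. com_machine c K n code"
proof -
  obtain K where K: "com_regs c \<subseteq> {..<K}" using finite_nat_bounded[OF finite_com_regs] by blast
  let ?R = "residuals c - {Done}"
  have "finite ?R" by (simp add: finite_residuals)
  then obtain g where g: "bij_betw g ?R {1..card ?R}"
    using finite_same_card_bij[of ?R "{1..card ?R}"] by auto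
  define code where "code = g(Done := Suc (card ?R))"
  have "bij_betw code ?R {1..card ?R}"
    using g by (rule bij_betw_cong[THEN iffD1, rotated]) (simp add: code_def)
  then have "bij_betw code (?R \<union> {Done}) ({1..card ?R} \<union> {code Done})"
    by (subst notIn_Un_bij_betw3[symmetric]) (auto simp: code_def)
  moreover have "?R \<union> {Done} = residuals c" using Done_in_residuals by auto
  moreover have "{1..card ?R} \<union> {code Done} = {1..code Done}" by (auto simp: code_def)
  ultimately have "com_machine c K (code Done) code"
    by unfold_locales (simp_all add: K)
  then show ?thesis by blast
qed

theorem polytime_com:
  assumes "\<And>x. \<exists>h \<rho>. runs x c (0, \<lambda>_. 0, []) (poly p (length x)) (h, \<rho>, f x)"
  shows "polytime f"
proof -
  obtain K n code where "com_machine c K n code" using ex_com_machine by blast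
  then interpret com_machine c K n code .
  have "\<exists>k \<le> poly (p + 1) (length x).
      halts_with_output machine ((tm_step machine ^^ k) (initial_config machine x)) (f x)" for x
    using assms[of x] machine_output by (intro exI[of _ "Suc (poly p (length x))"]) auto
  then show ?thesis unfolding polytime_def using wf_machine by blast
qed

section \<open>A loop language with polynomial running time\<close>

datatype exp = Const nat | Var nat | Len | Bit exp | Add exp exp | Sub exp exp | Mul exp exp

primrec eval :: "bool list \<Rightarrow> (nat \<Rightarrow> nat) \<Rightarrow> exp \<Rightarrow> nat" where
  "eval x \<rho> (Const n) = n"
| "eval x \<rho> (Var k) = \<rho> k"
| "eval x \<rho> Len = length x"
| "eval x \<rho> (Bit e) = string_contents x (int (eval x \<rho> e))"
| "eval x \<rho> (Add e1 e2) = eval x \<rho> e1 + eval x \<rho> e2"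
| "eval x \<rho> (Sub e1 e2) = eval x \<rho> e1 - eval x \<rho> e2"
| "eval x \<rho> (Mul e1 e2) = eval x \<rho> e1 * eval x \<rho> e2"

primrec exp_vars :: "exp \<Rightarrow> nat set" where
  "exp_vars (Const n) = {}"
| "exp_vars (Var k) = {k}"
| "exp_vars Len = {}"
| "exp_vars (Bit e) = exp_vars e"
| "exp_vars (Add e1 e2) = exp_vars e1 \<union> exp_vars e2"
| "exp_vars (Sub e1 e2) = exp_vars e1 \<union> exp_vars e2"
| "exp_vars (Mul e1 e2) = exp_vars e1 \<union> exp_vars e2"

lemma eval_cong: "(\<And>k. k \<in> exp_vars e \<Longrightarrow> \<rho> k = \<rho>' k) \<Longrightarrow> eval x \<rho> e = eval x \<rho>' e"
  by (induction e) auto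

subsection \<open>Arithmetic on registers\<close>

primrec prims :: "prim list \<Rightarrow> com" where
  "prims [] = Done"
| "prims (a # as) = Prim a ;; prims as"

lemma runs_prims: "fold perform as s = s' \<Longrightarrow> runs x (prims as) s (2 * length as) s'"
proof (induction as arbitrary: s)
  case (Cons a as)
  then have "runs x (prims as) (perform a s) (2 * length as) s'" by simp
  from runs_Then[OF runs_Prim this] show ?case by simp
qed (simp add: runs_Done)

definition drain :: "nat \<Rightarrow> com \<Rightarrow> com" where
  "drain r c = Loop (NonZero r) (Prim (Dec r) ;; c)"

lemma runs_drain:
  assumes "\<And>i. i < n \<Longrightarrow>
      runs x c (h i, (\<rho> i)(r := n - Suc i), out i) T (h (Suc i), \<rho> (Suc i), out (Suc i))"
    and "\<And>i. i \<le> n \<Longrightarrow> \<rho> i r = n - i"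
  shows "runs x (drain r c) (h 0, \<rho> 0, out 0) (n * (T + 4) + 1) (h n, \<rho> n, out n)"
proof -
  let ?S = "\<lambda>i. (h i, \<rho> i, out i)"
  have "runs x (Prim (Dec r) ;; c) (?S i) (T + 2) (?S (Suc i))" if "i < n" for i
  proof -
    have "perform (Dec r) (?S i) = (h i, (\<rho> i)(r := n - Suc i), out i)"
      using assms(2)[of i] that by simp
    from runs_Then[OF runs_Prim assms(1)[OF that, folded this]] show ?thesis
      by (rule runs_mono) simp
  qed
  moreover have "holds x (?S i) (NonZero r)" if "i < n" for i using assms(2)[of i] that by simp
  moreover have "\<not> holds x (?S n) (NonZero r)" using assms(2)[of n] by simp
  ultimately have "runs x (drain r c) (?S 0) (n * (T + 2 + 2) + 1) (?S n)"
    unfolding drain_def by (rule runs_Loop[of n x ?S, rotated 2])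
  then show ?thesis by (rule runs_mono) (simp add: algebra_simps)
qed

lemma runs_drain_prims:
  assumes "\<And>i. i < n \<Longrightarrow>
      fold perform as (h i, (\<rho> i)(r := n - Suc i), out) = (h (Suc i), \<rho> (Suc i), out)"
    and "\<And>i. i \<le> n \<Longrightarrow> \<rho> i r = n - i"
  shows "runs x (drain r (prims as)) (h 0, \<rho> 0, out) (n * (2 * length as + 4) + 1) (h n, \<rho> n, out)"
  using assms by (intro runs_drain[where out = "\<lambda>_. out"] runs_prims)

definition clear :: "nat \<Rightarrow> com" where
  "clear r = drain r (prims [])"

lemma runs_clear: "runs x (clear r) (h, \<rho>, out) (\<rho> r * 4 + 1) (h, \<rho>(r := 0), out)"
  using runs_drain_prims[of "\<rho> r" "[]" "\<lambda>_. h" "\<lambda>i. \<rho>(r := \<rho> r - i)" r out x]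
  by (simp add: clear_def)

definition transfer :: "nat \<Rightarrow> nat \<Rightarrow> com" where
  "transfer r t = drain r (prims [Inc t])"

lemma runs_transfer:
  assumes "r \<noteq> t"
  shows "runs x (transfer r t) (h, \<rho>, out) (\<rho> r * 6 + 1) (h, \<rho>(r := 0, t := \<rho> t + \<rho> r), out)"
  using runs_drain_prims[of "\<rho> r" "[Inc t]" "\<lambda>_. h" "\<lambda>i. \<rho>(r := \<rho> r - i, t := \<rho> t + i)" r out x]
    assms
  by (simp add: transfer_def fun_upd_twist)

definition trunc_sub :: "nat \<Rightarrow> nat \<Rightarrow> com" where
  "trunc_sub r t = drain r (prims [Dec t])"

lemma runs_trunc_sub:
  assumes "r \<noteq> t"
  shows "runs x (trunc_sub r t) (h, \<rho>, out) (\<rho> r * 6 + 1) (h, \<rho>(r := 0, t := \<rho> t - \<rho> r), out)"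
  using runs_drain_prims[of "\<rho> r" "[Dec t]" "\<lambda>_. h" "\<lambda>i. \<rho>(r := \<rho> r - i, t := \<rho> t - i)" r out x]
    assms
  by (simp add: trunc_sub_def fun_upd_twist)

definition copy :: "nat \<Rightarrow> nat \<Rightarrow> nat \<Rightarrow> com" where
  "copy r t u = drain r (prims [Inc t, Inc u]) ;; transfer u r"

lemma runs_copy:
  assumes "r \<noteq> t" "r \<noteq> u" "t \<noteq> u" "\<rho> u = 0"
  shows "runs x (copy r t u) (h, \<rho>, out) (\<rho> r * 14 + 3) (h, \<rho>(t := \<rho> t + \<rho> r), out)"
proof -
  let ?\<rho> = "\<lambda>i. \<rho>(r := \<rho> r - i, t := \<rho> t + i, u := i)"
  have "?\<rho> 0 = \<rho>" using assms by (auto simp: fun_eq_iff)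
  then have doubled:
    "runs x (drain r (prims [Inc t, Inc u])) (h, \<rho>, out) (\<rho> r * 8 + 1) (h, ?\<rho> (\<rho> r), out)"
    using runs_drain_prims[of "\<rho> r" "[Inc t, Inc u]" "\<lambda>_. h" ?\<rho> r out x] assms
    by (simp add: fun_upd_twist)
  have "(?\<rho> (\<rho> r))(u := 0, r := \<rho> r) = \<rho>(t := \<rho> t + \<rho> r)"
    using assms by (auto simp: fun_eq_iff)
  then have restored:
    "runs x (transfer u r) (h, ?\<rho> (\<rho> r), out) (\<rho> r * 6 + 1) (h, \<rho>(t := \<rho> t + \<rho> r), out)"
    using runs_transfer[of u r x h "?\<rho> (\<rho> r)" out] assms by simp
  show ?thesis unfolding copy_def
    by (rule runs_mono[OF runs_Then[OF doubled restored]]) simp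
qed

definition add_const :: "nat \<Rightarrow> nat \<Rightarrow> com" where
  "add_const r n = prims (replicate n (Inc r))"

lemma runs_add_const: "runs x (add_const r n) (h, \<rho>, out) (2 * n) (h, \<rho>(r := \<rho> r + n), out)"
proof -
  have "fold perform (replicate n (Inc r)) (h, \<rho>, out) = (h, \<rho>(r := \<rho> r + n), out)"
    by (induction n arbitrary: \<rho>) simp_all
  from runs_prims[OF this] show ?thesis by (simp add: add_const_def)
qed

definition multiply :: "nat \<Rightarrow> com" where
  "multiply d = drain d (copy (d + 1) (d + 2) (d + 3)) ;; clear (d + 1) ;; transfer (d + 2) d"

lemma runs_multiply:
  assumes "\<rho> (d + 2) = 0" "\<rho> (d + 3) = 0"
  shows "runs x (multiply d) (h, \<rho>, out) (\<rho> d * (\<rho> (d + 1) * 20 + 7) + \<rho> (d + 1) * 4 + 5)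
     (h, \<rho>(d := \<rho> d * \<rho> (d + 1), d + 1 := 0), out)"
proof -
  let ?a = "\<rho> d" and ?b = "\<rho> (d + 1)"
  let ?\<rho> = "\<lambda>i. \<rho>(d := ?a - i, d + 2 := i * ?b)"
  have "runs x (copy (d + 1) (d + 2) (d + 3)) (h, (?\<rho> i)(d := ?a - Suc i), out) (?b * 14 + 3)
      (h, ?\<rho> (Suc i), out)" for i
  proof -
    have "(?\<rho> i)(d := ?a - Suc i, d + 2 := i * ?b + ?b) = ?\<rho> (Suc i)"
      by (auto simp: fun_eq_iff)
    then show ?thesis
      using runs_copy[of "d + 1" "d + 2" "d + 3" "(?\<rho> i)(d := ?a - Suc i)" x h out] assms by simp
  qed
  from runs_drain[of ?a x _ "\<lambda>_. h" ?\<rho> d "\<lambda>_. out", OF this]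
  have product: "runs x (drain d (copy (d + 1) (d + 2) (d + 3))) (h, \<rho>, out)
      (?a * (?b * 14 + 7) + 1) (h, ?\<rho> ?a, out)"
    using assms(1) fun_upd_triv[of \<rho> "d + 2"] by (simp add: algebra_simps)
  have cleared: "runs x (clear (d + 1)) (h, ?\<rho> ?a, out) (?b * 4 + 1) (h, (?\<rho> ?a)(d + 1 := 0), out)"
    using runs_clear[of x "d + 1" h "?\<rho> ?a" out] by simp
  have "(?\<rho> ?a)(d + 1 := 0, d + 2 := 0, d := ?a * ?b) = \<rho>(d := ?a * ?b, d + 1 := 0)"
    using assms(1) by (auto simp: fun_eq_iff)
  with runs_transfer[of "d + 2" d x h "(?\<rho> ?a)(d + 1 := 0)" out]
  have moved: "runs x (transfer (d + 2) d) (h, (?\<rho> ?a)(d + 1 := 0), out) (?a * ?b * 6 + 1)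
     (h, \<rho>(d := ?a * ?b, d + 1 := 0), out)" by simp
  show ?thesis unfolding multiply_def
    by (rule runs_mono[OF runs_Then[OF product runs_Then[OF cleared moved]]])
      (simp add: algebra_simps)
qed

subsection \<open>Access to the input\<close>

definition read_symbol :: "nat \<Rightarrow> com" where
  "read_symbol d = Choose (InputNot 1) (Choose (InputNot 2) Done (add_const d 2)) (add_const d 1)"

lemma runs_read_symbol:
  assumes "\<rho> d = 0"
  shows "runs x (read_symbol d) (h, \<rho>, out) 6 (h, \<rho>(d := string_contents x h), out)"
proof -
  let ?s = "string_contents x h" and ?S = "(h, \<rho>, out)"
  let ?c = "if ?s = 1 then add_const d 1 else if ?s = 2 then add_const d 2 else Done"
  have "?s \<in> {0, 1, 2}" by (simp add: string_contents_def)
  then have "runs x ?c ?S 4 (h, \<rho>(d := ?s), out)"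
    using runs_add_const[of x d 1 h \<rho> out] runs_add_const[of x d 2 h \<rho> out] assms
    by (auto intro: runs_Done runs_mono simp: fun_upd_idem numeral_2_eq_2)
  then have "runs x (if ?s \<noteq> 1 then Choose (InputNot 2) Done (add_const d 2) else add_const d 1) ?S
      5 (h, \<rho>(d := ?s), out)"
    using runs_Choose[of x ?S "InputNot 2" Done "add_const d 2" 4]
    by (auto elim: runs_mono split: if_splits)
  then show ?thesis
    using runs_Choose[of x ?S "InputNot 1" _ "add_const d 1" 5] by (simp add: read_symbol_def)
qed

definition read_input :: "nat \<Rightarrow> com" where
  "read_input d = drain d (prims [Inc (d + 1), InputRight]) ;; read_symbol d ;;
     drain (d + 1) (prims [InputLeft])"

lemma runs_read_input:
  assumes "\<rho> (d + 1) = 0"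
  shows "runs x (read_input d) (0, \<rho>, out) (\<rho> d * 14 + 10)
     (0, \<rho>(d := string_contents x (int (\<rho> d))), out)"
proof -
  let ?a = "\<rho> d" and ?s = "string_contents x (int (\<rho> d))"
  let ?\<rho> = "\<lambda>i. \<rho>(d := ?a - i, d + 1 := i)" and ?\<rho>' = "\<lambda>i. \<rho>(d := ?s, d + 1 := ?a - i)"
  have "?\<rho> 0 = \<rho>" using assms by (auto simp: fun_eq_iff)
  then have there: "runs x (drain d (prims [Inc (d + 1), InputRight])) (0, \<rho>, out) (?a * 8 + 1)
      (int ?a, ?\<rho> ?a, out)"
    using runs_drain_prims[of ?a "[Inc (d + 1), InputRight]" int ?\<rho> d out x]
    by (simp add: fun_upd_twist)
  have read: "runs x (read_symbol d) (int ?a, ?\<rho> ?a, out) 6 (int ?a, ?\<rho>' 0, out)"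
    using runs_read_symbol[of "?\<rho> ?a" d x "int ?a" out] by (simp add: fun_upd_twist)
  have "?\<rho>' ?a = \<rho>(d := ?s)" using assms by (auto simp: fun_eq_iff)
  then have returned: "runs x (drain (d + 1) (prims [InputLeft])) (int ?a, ?\<rho>' 0, out) (?a * 6 + 1)
      (0, \<rho>(d := ?s), out)"
    using runs_drain_prims[of ?a "[InputLeft]" "\<lambda>i. int ?a - int i" ?\<rho>' "d + 1" out x]
    by simp
  show ?thesis unfolding read_input_def
    by (rule runs_mono[OF runs_Then[OF there runs_Then[OF read returned]]]) simp
qed

definition input_length :: "nat \<Rightarrow> com" where
  "input_length d = Loop (InputNot 0) (prims [Inc d, InputRight]) ;;
     drain d (prims [Inc (d + 1), InputLeft]) ;; transfer (d + 1) d"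

lemma runs_input_length:
  assumes "\<rho> d = 0" "\<rho> (d + 1) = 0"
  shows "runs x (input_length d) (0, \<rho>, out) (length x * 20 + 5) (0, \<rho>(d := length x), out)"
proof -
  let ?n = "length x"
  let ?S = "\<lambda>i. (int i, \<rho>(d := i), out)"
  have "runs x (prims [Inc d, InputRight]) (?S i) 4 (?S (Suc i))" for i
    using runs_prims[of "[Inc d, InputRight]" "?S i" "?S (Suc i)" x] by simp
  then have "runs x (Loop (InputNot 0) (prims [Inc d, InputRight])) (?S 0)
      (?n * (4 + 2) + 1) (?S ?n)"
    by (intro runs_Loop[of ?n x ?S]) (auto simp: string_contents_def)
  then have right: "runs x (Loop (InputNot 0) (prims [Inc d, InputRight])) (0, \<rho>, out) (?n * 6 + 1)
      (?S ?n)"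
    using assms(1) fun_upd_triv[of \<rho> d] by simp
  let ?\<rho> = "\<lambda>i. \<rho>(d := ?n - i, d + 1 := i)"
  have "?\<rho> 0 = \<rho>(d := ?n)" using assms by (auto simp: fun_eq_iff)
  then have returned: "runs x (drain d (prims [Inc (d + 1), InputLeft])) (?S ?n) (?n * 8 + 1)
      (0, ?\<rho> ?n, out)"
    using runs_drain_prims[of ?n "[Inc (d + 1), InputLeft]" "\<lambda>i. int ?n - int i" ?\<rho> d out x]
    by (simp add: fun_upd_twist)
  have "(?\<rho> ?n)(d + 1 := 0, d := ?n) = \<rho>(d := ?n)" using assms(2) by (auto simp: fun_eq_iff)
  then have moved: "runs x (transfer (d + 1) d) (0, ?\<rho> ?n, out) (?n * 6 + 1) (0, \<rho>(d := ?n), out)"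
    using runs_transfer[of "d + 1" d x 0 "?\<rho> ?n" out] by simp
  show ?thesis unfolding input_length_def
    by (rule runs_mono[OF runs_Then[OF right runs_Then[OF returned moved]]]) simp
qed

subsection \<open>Evaluation of expressions\<close>

primrec compile_exp :: "exp \<Rightarrow> nat \<Rightarrow> com" where
  "compile_exp (Const n) d = add_const d n"
| "compile_exp (Var k) d = copy k d (d + 1)"
| "compile_exp Len d = input_length d"
| "compile_exp (Bit e) d = compile_exp e d ;; read_input d"
| "compile_exp (Add e1 e2) d = compile_exp e1 d ;; compile_exp e2 (d + 1) ;; transfer (d + 1) d"
| "compile_exp (Sub e1 e2) d = compile_exp e1 d ;; compile_exp e2 (d + 1) ;; trunc_sub (d + 1) d"
| "compile_exp (Mul e1 e2) d = compile_exp e1 d ;; compile_exp e2 (d + 1) ;; multiply d"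

definition zero_from :: "nat \<Rightarrow> (nat \<Rightarrow> nat) \<Rightarrow> bool" where
  "zero_from d \<rho> \<longleftrightarrow> (\<forall>r \<ge> d. \<rho> r = 0)"

lemma zero_fromD: "zero_from d \<rho> \<Longrightarrow> d \<le> r \<Longrightarrow> \<rho> r = 0"
  by (simp add: zero_from_def)

definition bounded_env :: "nat \<Rightarrow> nat \<Rightarrow> bool list \<Rightarrow> (nat \<Rightarrow> nat) \<Rightarrow> bool" where
  "bounded_env D N x \<rho> \<longleftrightarrow> length x \<le> N \<and> (\<forall>k < D. \<rho> k \<le> N)"

definition exp_cost :: "nat \<Rightarrow> exp \<Rightarrow> nat poly \<Rightarrow> bool" where
  "exp_cost D e p \<longleftrightarrow> (\<forall>d x \<rho> N out. D \<le> d \<longrightarrow> bounded_env D N x \<rho> \<longrightarrow> zero_from d \<rho> \<longrightarrow>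
    eval x \<rho> e \<le> poly p N \<and>
    runs x (compile_exp e d) (0, \<rho>, out) (poly p N) (0, \<rho>(d := eval x \<rho> e), out))"

lemma exp_costI:
  assumes "\<And>d x \<rho> N out. D \<le> d \<Longrightarrow> bounded_env D N x \<rho> \<Longrightarrow> zero_from d \<rho> \<Longrightarrow>
      eval x \<rho> e \<le> poly p N"
    and "\<And>d x \<rho> N out. D \<le> d \<Longrightarrow> bounded_env D N x \<rho> \<Longrightarrow> zero_from d \<rho> \<Longrightarrow>
      runs x (compile_exp e d) (0, \<rho>, out) (poly p N) (0, \<rho>(d := eval x \<rho> e), out)"
  shows "exp_cost D e p"
  unfolding exp_cost_def using assms by blast

lemma exp_costD:
  assumes "exp_cost D e p" "D \<le> d" "bounded_env D N x \<rho>" "zero_from d \<rho>"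
  shows "eval x \<rho> e \<le> poly p N"
    "runs x (compile_exp e d) (0, \<rho>, out) (poly p N) (0, \<rho>(d := eval x \<rho> e), out)"
  using assms unfolding exp_cost_def by blast+

lemma exp_cost_Const: "exp_cost D (Const n) [:2 * n:]"
proof (rule exp_costI)
  fix d x N out and \<rho> :: "nat \<Rightarrow> nat"
  assume "zero_from d \<rho>"
  then show "runs x (compile_exp (Const n) d) (0, \<rho>, out) (poly [:2 * n:] N)
      (0, \<rho>(d := eval x \<rho> (Const n)), out)"
    using runs_add_const[of x d n 0 \<rho> out] by (simp add: zero_fromD)
qed simp

lemma exp_cost_Var:
  assumes "k < D"
  shows "exp_cost D (Var k) [:3, 14:]"
proof (rule exp_costI)
  fix d x N out and \<rho> :: "nat \<Rightarrow> nat"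
  assume "D \<le> d" "bounded_env D N x \<rho>" "zero_from d \<rho>"
  then have \<rho>: "\<rho> k \<le> N" "k < d" "\<rho> d = 0" "\<rho> (d + 1) = 0"
    using assms by (auto simp: bounded_env_def zero_fromD)
  from \<rho>(1) show "eval x \<rho> (Var k) \<le> poly [:3, 14:] N" by simp
  have "runs x (copy k d (d + 1)) (0, \<rho>, out) (\<rho> k * 14 + 3) (0, \<rho>(d := \<rho> k), out)"
    using runs_copy[of k d "d + 1" \<rho> x 0 out] \<rho> by simp
  then show "runs x (compile_exp (Var k) d) (0, \<rho>, out) (poly [:3, 14:] N)
      (0, \<rho>(d := eval x \<rho> (Var k)), out)"
    using \<rho>(1) by (auto elim: runs_mono)
qed

lemma exp_cost_Len: "exp_cost D Len [:5, 20:]"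
proof (rule exp_costI)
  fix d x N out and \<rho> :: "nat \<Rightarrow> nat"
  assume env: "bounded_env D N x \<rho>" "zero_from d \<rho>"
  then show "eval x \<rho> Len \<le> poly [:5, 20:] N" by (simp add: bounded_env_def)
  have "runs x (input_length d) (0, \<rho>, out) (length x * 20 + 5) (0, \<rho>(d := length x), out)"
    using env by (intro runs_input_length) (simp_all add: zero_fromD)
  then show "runs x (compile_exp Len d) (0, \<rho>, out) (poly [:5, 20:] N)
      (0, \<rho>(d := eval x \<rho> Len), out)"
    using env by (auto elim: runs_mono simp: bounded_env_def)
qed

lemma exp_cost_Bit:
  assumes "exp_cost D e p"
  shows "exp_cost D (Bit e) (smult 15 p + [:11:])"
proof (rule exp_costI)
  fix d x N out and \<rho> :: "nat \<Rightarrow> nat"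
  assume env: "D \<le> d" "bounded_env D N x \<rho>" "zero_from d \<rho>"
  let ?v = "eval x \<rho> e"
  note cost = exp_costD[OF assms env]
  have "runs x (read_input d) (0, \<rho>(d := ?v), out) (?v * 14 + 10)
      (0, \<rho>(d := eval x \<rho> (Bit e)), out)"
    using runs_read_input[of "\<rho>(d := ?v)" d x out] env(3) by (simp add: zero_fromD)
  from runs_Then[OF cost(2) this]
  show "runs x (compile_exp (Bit e) d) (0, \<rho>, out) (poly (smult 15 p + [:11:]) N)
      (0, \<rho>(d := eval x \<rho> (Bit e)), out)"
    unfolding compile_exp.simps by (rule runs_mono) (use cost(1) in simp)
qed (simp add: string_contents_def)

lemma exp_cost_binary:
  assumes p: "exp_cost D e1 p" and q: "exp_cost D e2 q" and scope: "exp_vars e2 \<subseteq> {..<D}"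
    and code: "\<And>d. compile_exp e d = compile_exp e1 d ;; compile_exp e2 (d + 1) ;; c d"
    and val: "\<And>x \<rho>. eval x \<rho> e = g (eval x \<rho> e1) (eval x \<rho> e2)"
    and op: "\<And>d x \<rho> out v w. zero_from d \<rho> \<Longrightarrow>
      runs x (c d) (0, \<rho>(d := v, d + 1 := w), out) (t v w) (0, \<rho>(d := g v w), out)"
    and bound: "\<And>N v w. v \<le> poly p N \<Longrightarrow> w \<le> poly q N \<Longrightarrow>
      g v w \<le> poly r N \<and> poly p N + (poly q N + t v w + 1) + 1 \<le> poly r N"
  shows "exp_cost D e r"
proof (rule exp_costI)
  fix d x N out and \<rho> :: "nat \<Rightarrow> nat"
  assume env: "D \<le> d" "bounded_env D N x \<rho>" "zero_from d \<rho>"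
  let ?v = "eval x \<rho> e1" and ?w = "eval x \<rho> e2"
  have w: "eval x (\<rho>(d := ?v)) e2 = ?w" by (rule eval_cong) (use scope env(1) in auto)
  have "D \<le> d + 1" "bounded_env D N x (\<rho>(d := ?v))" "zero_from (d + 1) (\<rho>(d := ?v))"
    using env by (auto simp: bounded_env_def zero_from_def)
  note snd = exp_costD[OF q this, unfolded w]
  note fst = exp_costD[OF p env]
  note bounds = bound[OF fst(1) snd(1), THEN conjunct1] bound[OF fst(1) snd(1), THEN conjunct2]
  show "eval x \<rho> e \<le> poly r N" using bounds(1) unfolding val .
  from runs_mono[OF runs_Then[OF fst(2) runs_Then[OF snd(2) op[OF env(3)]]] bounds(2)]
  show "runs x (compile_exp e d) (0, \<rho>, out) (poly r N) (0, \<rho>(d := eval x \<rho> e), out)"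
    unfolding code val .
qed

lemma exp_cost_Add:
  assumes "exp_cost D e1 p" "exp_cost D e2 q" "exp_vars e2 \<subseteq> {..<D}"
  shows "exp_cost D (Add e1 e2) (p + smult 7 q + [:3:])"
  using assms
proof (rule exp_cost_binary[where g = "(+)" and t = "\<lambda>v w. w * 6 + 1"])
  fix d x out and v w :: nat and \<rho> :: "nat \<Rightarrow> nat"
  assume "zero_from d \<rho>"
  then have "\<rho>(d := v, d + 1 := w, d + 1 := 0, d := v + w) = \<rho>(d := v + w)"
    by (auto simp: fun_eq_iff zero_fromD)
  then show "runs x (transfer (d + 1) d) (0, \<rho>(d := v, d + 1 := w), out) (w * 6 + 1)
      (0, \<rho>(d := v + w), out)"
    using runs_transfer[of "d + 1" d x 0 "\<rho>(d := v, d + 1 := w)" out] by simp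
qed auto

lemma exp_cost_Sub:
  assumes "exp_cost D e1 p" "exp_cost D e2 q" "exp_vars e2 \<subseteq> {..<D}"
  shows "exp_cost D (Sub e1 e2) (p + smult 7 q + [:3:])"
  using assms
proof (rule exp_cost_binary[where g = "(-)" and t = "\<lambda>v w. w * 6 + 1"])
  fix d x out and v w :: nat and \<rho> :: "nat \<Rightarrow> nat"
  assume "zero_from d \<rho>"
  then have "\<rho>(d := v, d + 1 := w, d + 1 := 0, d := v - w) = \<rho>(d := v - w)"
    by (auto simp: fun_eq_iff zero_fromD)
  then show "runs x (trunc_sub (d + 1) d) (0, \<rho>(d := v, d + 1 := w), out) (w * 6 + 1)
      (0, \<rho>(d := v - w), out)"
    using runs_trunc_sub[of "d + 1" d x 0 "\<rho>(d := v, d + 1 := w)" out] by simp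
qed auto

lemma exp_cost_Mul:
  fixes p q :: "nat poly"
  defines "r \<equiv> p + q + p * (smult 20 q + [:7:]) + smult 4 q + [:7:]"
  assumes "exp_cost D e1 p" "exp_cost D e2 q" "exp_vars e2 \<subseteq> {..<D}"
  shows "exp_cost D (Mul e1 e2) r"
  using assms(2-)
proof (rule exp_cost_binary[where g = times and t = "\<lambda>v w. v * (w * 20 + 7) + w * 4 + 5"])
  fix d x out and v w :: nat and \<rho> :: "nat \<Rightarrow> nat"
  assume zero: "zero_from d \<rho>"
  then have "\<rho>(d := v, d + 1 := w, d := v * w, d + 1 := 0) = \<rho>(d := v * w)"
    by (auto simp: fun_eq_iff zero_fromD)
  then show "runs x (multiply d) (0, \<rho>(d := v, d + 1 := w), out) (v * (w * 20 + 7) + w * 4 + 5)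
      (0, \<rho>(d := v * w), out)"
    using runs_multiply[of "\<rho>(d := v, d + 1 := w)" d x 0 out] zero by (simp add: zero_fromD)
next
  fix N v w :: nat assume bounds: "v \<le> poly p N" "w \<le> poly q N"
  then have "v * w \<le> poly p N * poly q N" "v * (w * 20 + 7) \<le> poly p N * (poly q N * 20 + 7)"
    by (auto intro!: mult_mono add_mono)
  then show "v * w \<le> poly r N \<and>
      poly p N + (poly q N + (v * (w * 20 + 7) + w * 4 + 5) + 1) + 1 \<le> poly r N"
    using bounds(2) by (simp add: r_def algebra_simps)
qed auto

lemma ex_exp_cost: "exp_vars e \<subseteq> {..<D} \<Longrightarrow> \<exists>p. exp_cost D e p"
proof (induction e)
  case (Var k)
  then show ?case using exp_cost_Var by auto
next
  case (Add e1 e2)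
  then show ?case using exp_cost_Add by fastforce
next
  case (Sub e1 e2)
  then show ?case using exp_cost_Sub by fastforce
next
  case (Mul e1 e2)
  then show ?case using exp_cost_Mul by fastforce
qed (use exp_cost_Const exp_cost_Len exp_cost_Bit in fastforce)+

subsection \<open>Output of binary numbers\<close>

lemma encode_nat_rec:
  "encode_nat v = (if v = 0 then [False] else True # odd v # encode_nat (v div 2))"
  by (subst encode_nat_def, subst binary.simps) (simp add: encode_list_def encode_nat_def)

definition halve :: "nat \<Rightarrow> com" where
  "halve d = drain d (Choose (NonZero (d + 2)) (prims [Dec (d + 2), Inc (d + 1)])
     (prims [Inc (d + 2)]))"

lemma runs_halve:
  assumes "\<rho> (d + 1) = 0" "\<rho> (d + 2) = 0"
  shows "runs x (halve d) (h, \<rho>, out) (\<rho> d * 9 + 1)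
    (h, \<rho>(d := 0, d + 1 := \<rho> d div 2, d + 2 := \<rho> d mod 2), out)"
proof -
  let ?v = "\<rho> d"
  let ?\<rho> = "\<lambda>i. \<rho>(d := ?v - i, d + 1 := i div 2, d + 2 := i mod 2)"
  let ?S = "\<lambda>i. (h, (?\<rho> i)(d := ?v - Suc i), out)"
  have step: "fold perform (if odd i then [Dec (d + 2), Inc (d + 1)] else [Inc (d + 2)]) (?S i) =
      (h, ?\<rho> (Suc i), out)" for i
    by (auto simp: fun_eq_iff odd_iff_mod_2_eq_one even_iff_mod_2_eq_zero div_Suc mod_Suc)
  have "runs x (if holds x (?S i) (NonZero (d + 2)) then prims [Dec (d + 2), Inc (d + 1)]
      else prims [Inc (d + 2)]) (?S i) 4 (h, ?\<rho> (Suc i), out)" for i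
    using runs_mono[OF runs_prims[OF step[of i]], of 4 x]
    by (cases "odd i") (simp_all add: odd_iff_mod_2_eq_one del: fun_upd_apply, simp_all)
  from runs_drain[of ?v x _ "\<lambda>_. h" ?\<rho> d "\<lambda>_. out", OF runs_Choose[OF this]]
  have "runs x (halve d) (h, ?\<rho> 0, out) (?v * 9 + 1) (h, ?\<rho> ?v, out)" by (simp add: halve_def)
  moreover have "?\<rho> 0 = \<rho>" using assms by (auto simp: fun_eq_iff)
  ultimately show ?thesis by simp
qed

definition emit_flag :: "nat \<Rightarrow> com" where
  "emit_flag r = Choose (NonZero r) (prims [Dec r, Out True]) (prims [Out False])"

lemma runs_emit_flag:
  assumes "\<rho> r \<le> 1"
  shows "runs x (emit_flag r) (h, \<rho>, out) 5 (h, \<rho>(r := 0), out @ [\<rho> r = 1])"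
proof -
  have "fold perform (if \<rho> r \<noteq> 0 then [Dec r, Out True] else [Out False]) (h, \<rho>, out) =
      (h, \<rho>(r := 0), out @ [\<rho> r = 1])"
    using assms by (auto simp: fun_eq_iff)
  from runs_prims[OF this, of x]
  have "runs x (if \<rho> r \<noteq> 0 then prims [Dec r, Out True] else prims [Out False]) (h, \<rho>, out) 4
      (h, \<rho>(r := 0), out @ [\<rho> r = 1])"
    by (auto elim: runs_mono split: if_splits)
  then show ?thesis
    using runs_Choose[of x "(h, \<rho>, out)" "NonZero r"] by (fastforce simp: emit_flag_def)
qed

definition emit_digit :: "nat \<Rightarrow> com" where
  "emit_digit d = Prim (Out True) ;; halve d ;; emit_flag (d + 2) ;; transfer (d + 1) d"

lemma runs_emit_digit:
  assumes "\<rho> (d + 1) = 0" "\<rho> (d + 2) = 0"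
  shows "runs x (emit_digit d) (h, \<rho>, out) (\<rho> d * 12 + 11)
    (h, \<rho>(d := \<rho> d div 2), out @ [True, odd (\<rho> d)])"
proof -
  let ?v = "\<rho> d"
  let ?\<rho> = "\<rho>(d := 0, d + 1 := ?v div 2)"
  have mark: "runs x (Prim (Out True)) (h, \<rho>, out) 1 (h, \<rho>, out @ [True])"
    using runs_Prim[of x "Out True" "(h, \<rho>, out)"] by simp
  note halved = runs_halve[of \<rho> d x h "out @ [True]", OF assms]
  have "?\<rho>(d + 2 := ?v mod 2, d + 2 := 0) = ?\<rho>" using assms by (auto simp: fun_eq_iff)
  then have flag: "runs x (emit_flag (d + 2)) (h, ?\<rho>(d + 2 := ?v mod 2), out @ [True]) 5
      (h, ?\<rho>, out @ [True, odd ?v])"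
    using runs_emit_flag[of "?\<rho>(d + 2 := ?v mod 2)" "d + 2" x h "out @ [True]"]
    by (simp add: odd_iff_mod_2_eq_one)
  have "?\<rho>(d + 1 := 0, d := ?v div 2) = \<rho>(d := ?v div 2)"
    using assms by (auto simp: fun_eq_iff)
  then have moved: "runs x (transfer (d + 1) d) (h, ?\<rho>, out @ [True, odd ?v]) (?v div 2 * 6 + 1)
      (h, \<rho>(d := ?v div 2), out @ [True, odd ?v])"
    using runs_transfer[of "d + 1" d x h ?\<rho> "out @ [True, odd ?v]"] by simp
  show ?thesis
    unfolding emit_digit_def
    by (rule runs_mono[OF runs_Then[OF mark runs_Then[OF halved runs_Then[OF flag moved]]]]) simp
qed

definition emit_nat :: "nat \<Rightarrow> com" where
  "emit_nat d = Loop (NonZero d) (emit_digit d) ;; Prim (Out False)"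

lemma runs_emit_digits:
  assumes "\<rho> (d + 1) = 0" "\<rho> (d + 2) = 0"
  shows "\<exists>out'. out' @ [False] = encode_nat v \<and>
    runs x (Loop (NonZero d) (emit_digit d)) (h, \<rho>(d := v), out) (v * (v * 12 + 13) + 1)
      (h, \<rho>(d := 0), out @ out')"
proof (induction v arbitrary: out rule: less_induct)
  case (less v)
  let ?loop = "Loop (NonZero d) (emit_digit d)"
  show ?case
  proof (cases "v = 0")
    case True
    then show ?thesis
      using runs_Loop_false[of x "(h, \<rho>(d := 0), out)" "NonZero d" "emit_digit d"]
      by (intro exI[of _ "[]"]) (simp add: encode_nat_rec del: fun_upd_apply, simp)
  next
    case False
    let ?w = "v div 2"
    let ?o = "out @ [True, odd v]"
    have "?w < v" using False by simp
    from less[OF this, of ?o] obtain out' where out': "out' @ [False] = encode_nat ?w"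
      and rest: "runs x ?loop (h, \<rho>(d := ?w), ?o) (?w * (?w * 12 + 13) + 1)
        (h, \<rho>(d := 0), ?o @ out')"
      by blast
    have "runs x (emit_digit d) (h, \<rho>(d := v), out) (v * 12 + 11) (h, \<rho>(d := ?w), ?o)"
      using runs_emit_digit[of "\<rho>(d := v)" d x h out] assms by simp
    from runs_Loop_true[OF _ this rest] False
    have loop: "runs x ?loop (h, \<rho>(d := v), out)
       (v * 12 + 11 + (?w * (?w * 12 + 13) + 1) + 2) (h, \<rho>(d := 0), ?o @ out')" by simp
    have "?w * (?w * 12 + 13) \<le> (v - 1) * (v * 12 + 13)"
      using \<open>?w < v\<close> by (intro mult_mono) auto
    moreover have "v * (v * 12 + 13) = (v - 1) * (v * 12 + 13) + (v * 12 + 13)"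
      using False by (cases v) auto
    ultimately have "runs x ?loop (h, \<rho>(d := v), out) (v * (v * 12 + 13) + 1)
        (h, \<rho>(d := 0), ?o @ out')"
      by (intro runs_mono[OF loop]) simp
    then show ?thesis using out' False
      by (intro exI[of _ "True # odd v # out'"]) (simp add: encode_nat_rec[of v] del: fun_upd_apply)
  qed
qed

lemma runs_emit_nat:
  assumes "\<rho> (d + 1) = 0" "\<rho> (d + 2) = 0"
  shows "runs x (emit_nat d) (h, \<rho>(d := v), out) (v * (v * 12 + 13) + 3)
    (h, \<rho>(d := 0), out @ encode_nat v)"
proof -
  obtain out' where out': "out' @ [False] = encode_nat v"
    and digits: "runs x (Loop (NonZero d) (emit_digit d)) (h, \<rho>(d := v), out)
      (v * (v * 12 + 13) + 1) (h, \<rho>(d := 0), out @ out')"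
    using runs_emit_digits[of \<rho> d v x h out] assms by blast
  have "runs x (Prim (Out False)) (h, \<rho>(d := 0), out @ out') 1 (h, \<rho>(d := 0), out @ encode_nat v)"
    using runs_Prim[of x "Out False" "(h, \<rho>(d := 0), out @ out')"] by (simp flip: out')
  from runs_mono[OF runs_Then[OF digits this]] show ?thesis by (simp add: emit_nat_def)
qed

subsection \<open>Loop programs\<close>

datatype prog = Nop | Emit bool | EmitNat exp | Seq prog prog | For exp prog

text \<open>
  The loop counter of \<open>For\<close> at depth \<open>d\<close> is variable \<open>d\<close>; variable \<open>d + 1\<close> holds the number of
  remaining iterations and thus counts downwards.
\<close>

primrec emitted :: "bool list \<Rightarrow> prog \<Rightarrow> nat \<Rightarrow> (nat \<Rightarrow> nat) \<Rightarrow> bool list" where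
  "emitted x Nop d \<rho> = []"
| "emitted x (Emit b) d \<rho> = [b]"
| "emitted x (EmitNat e) d \<rho> = encode_nat (eval x \<rho> e)"
| "emitted x (Seq p q) d \<rho> = emitted x p d \<rho> @ emitted x q d \<rho>"
| "emitted x (For e p) d \<rho> = concat (map (\<lambda>i. emitted x p (d + 2)
     (\<rho>(d := i, d + 1 := eval x \<rho> e - Suc i))) [0..<eval x \<rho> e])"

primrec well_scoped :: "nat \<Rightarrow> prog \<Rightarrow> bool" where
  "well_scoped d Nop \<longleftrightarrow> True"
| "well_scoped d (Emit b) \<longleftrightarrow> True"
| "well_scoped d (EmitNat e) \<longleftrightarrow> exp_vars e \<subseteq> {..<d}"
| "well_scoped d (Seq p q) \<longleftrightarrow> well_scoped d p \<and> well_scoped d q"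
| "well_scoped d (For e p) \<longleftrightarrow> exp_vars e \<subseteq> {..<d} \<and> well_scoped (d + 2) p"

primrec compile_prog :: "prog \<Rightarrow> nat \<Rightarrow> com" where
  "compile_prog Nop d = Done"
| "compile_prog (Emit b) d = Prim (Out b)"
| "compile_prog (EmitNat e) d = compile_exp e d ;; emit_nat d"
| "compile_prog (Seq p q) d = compile_prog p d ;; compile_prog q d"
| "compile_prog (For e p) d = compile_exp e (d + 1) ;;
     drain (d + 1) (compile_prog p (d + 2) ;; Prim (Inc d)) ;; clear d"

definition prog_cost :: "nat \<Rightarrow> prog \<Rightarrow> nat poly \<Rightarrow> bool" where
  "prog_cost d pr q \<longleftrightarrow> (\<forall>x \<rho> N out. bounded_env d N x \<rho> \<longrightarrow> zero_from d \<rho> \<longrightarrow>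
    runs x (compile_prog pr d) (0, \<rho>, out) (poly q N) (0, \<rho>, out @ emitted x pr d \<rho>))"

lemma prog_costI:
  assumes "\<And>x \<rho> N out. bounded_env d N x \<rho> \<Longrightarrow> zero_from d \<rho> \<Longrightarrow>
    runs x (compile_prog pr d) (0, \<rho>, out) (poly q N) (0, \<rho>, out @ emitted x pr d \<rho>)"
  shows "prog_cost d pr q"
  unfolding prog_cost_def using assms by blast

lemma prog_costD:
  assumes "prog_cost d pr q" "bounded_env d N x \<rho>" "zero_from d \<rho>"
  shows "runs x (compile_prog pr d) (0, \<rho>, out) (poly q N) (0, \<rho>, out @ emitted x pr d \<rho>)"
  using assms unfolding prog_cost_def by blast

lemma prog_cost_Nop: "prog_cost d Nop 0"
  by (rule prog_costI) (simp add: runs_Done)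

lemma prog_cost_Emit: "prog_cost d (Emit b) 1"
proof (rule prog_costI)
  show "runs x (compile_prog (Emit b) d) (0, \<rho>, out) (poly 1 N)
      (0, \<rho>, out @ emitted x (Emit b) d \<rho>)"
    for x \<rho> N out
    using runs_Prim[of x "Out b" "(0, \<rho>, out)"] by simp
qed

lemma prog_cost_EmitNat:
  assumes "exp_cost d e p"
  shows "prog_cost d (EmitNat e) (p + p * (smult 12 p + [:13:]) + [:4:])" (is "prog_cost _ _ ?q")
proof (rule prog_costI)
  fix x N out and \<rho> :: "nat \<Rightarrow> nat"
  assume env: "bounded_env d N x \<rho>" "zero_from d \<rho>"
  let ?v = "eval x \<rho> e"
  note cost = exp_costD[OF assms order_refl env]
  have emit: "runs x (emit_nat d) (0, \<rho>(d := ?v), out) (?v * (?v * 12 + 13) + 3)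
      (0, \<rho>, out @ encode_nat ?v)"
    using runs_emit_nat[of \<rho> d x 0 ?v out] env(2) by (simp add: zero_fromD fun_upd_idem)
  have "?v * (?v * 12 + 13) \<le> poly p N * (poly p N * 12 + 13)"
    using cost(1) by (intro mult_mono add_mono) auto
  then show "runs x (compile_prog (EmitNat e) d) (0, \<rho>, out) (poly ?q N)
      (0, \<rho>, out @ emitted x (EmitNat e) d \<rho>)"
    using runs_Then[OF cost(2) emit] by (auto elim!: runs_mono simp: algebra_simps)
qed

lemma prog_cost_Seq:
  assumes "prog_cost d p1 q1" "prog_cost d p2 q2"
  shows "prog_cost d (Seq p1 p2) (q1 + q2 + 1)"
proof (rule prog_costI)
  fix x N out and \<rho> :: "nat \<Rightarrow> nat"
  assume env: "bounded_env d N x \<rho>" "zero_from d \<rho>"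
  show "runs x (compile_prog (Seq p1 p2) d) (0, \<rho>, out) (poly (q1 + q2 + 1) N)
      (0, \<rho>, out @ emitted x (Seq p1 p2) d \<rho>)"
    using runs_Then[OF prog_costD[OF assms(1) env] prog_costD[OF assms(2) env]] by simp
qed

lemma runs_For:
  fixes d e x and \<rho> :: "nat \<Rightarrow> nat"
  defines "n \<equiv> eval x \<rho> e"
  defines "env \<equiv> \<lambda>i. \<rho>(d := i, d + 1 := n - Suc i)"
  assumes zero: "zero_from d \<rho>"
    and count: "runs x (compile_exp e (d + 1)) (0, \<rho>, out) t (0, \<rho>(d + 1 := n), out)"
    and body: "\<And>i out. i < n \<Longrightarrow> runs x (compile_prog p (d + 2)) (0, env i, out) t'
      (0, env i, out @ emitted x p (d + 2) (env i))"
  shows "runs x (compile_prog (For e p) d) (0, \<rho>, out) (t + n * (t' + 10) + 4)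
    (0, \<rho>, out @ emitted x (For e p) d \<rho>)"
proof -
  let ?\<rho> = "\<lambda>i. \<rho>(d := i, d + 1 := n - i)"
  let ?out = "\<lambda>i. out @ concat (map (\<lambda>i. emitted x p (d + 2) (env i)) [0..<i])"
  have \<rho>0: "\<rho>(d + 1 := n) = ?\<rho> 0" using zero by (auto simp: fun_eq_iff zero_fromD)
  have "runs x (compile_prog p (d + 2) ;; Prim (Inc d)) (0, (?\<rho> i)(d + 1 := n - Suc i), ?out i)
      (t' + 2) (0, ?\<rho> (Suc i), ?out (Suc i))" if "i < n" for i
  proof -
    have "runs x (Prim (Inc d)) (0, env i, ?out i @ emitted x p (d + 2) (env i)) 1
        (0, ?\<rho> (Suc i), ?out (Suc i))"
      using runs_Prim[of x "Inc d" "(0, env i, ?out i @ emitted x p (d + 2) (env i))"]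
      by (simp add: env_def fun_upd_twist)
    from runs_Then[OF body[OF that] this] show ?thesis by (simp add: env_def)
  qed
  from runs_drain[of n x _ "\<lambda>_. 0" ?\<rho> "d + 1" ?out, OF this]
  have loop: "runs x (drain (d + 1) (compile_prog p (d + 2) ;; Prim (Inc d)))
      (0, \<rho>(d + 1 := n), out) (n * (t' + 6) + 1) (0, ?\<rho> n, ?out n)"
    unfolding \<rho>0 by (simp add: add.commute)
  have "(?\<rho> n)(d := 0) = \<rho>" using zero by (auto simp: fun_eq_iff zero_fromD)
  then have reset: "runs x (clear d) (0, ?\<rho> n, ?out n) (n * 4 + 1) (0, \<rho>, ?out n)"
    using runs_clear[of x d 0 "?\<rho> n" "?out n"] by simp
  have "?out n = out @ emitted x (For e p) d \<rho>" by (simp add: env_def n_def)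
  with runs_Then[OF count runs_Then[OF loop reset]] show ?thesis
    by (auto elim!: runs_mono simp: algebra_simps)
qed

lemma prog_cost_For:
  assumes "exp_cost d e p" "prog_cost (d + 2) pr q"
  shows "prog_cost d (For e pr) (p + p * (pcompose q ([:0, 1:] + p) + [:10:]) + [:4:])"
    (is "prog_cost _ _ ?r")
proof (rule prog_costI)
  fix x N out and \<rho> :: "nat \<Rightarrow> nat"
  assume env: "bounded_env d N x \<rho>" "zero_from d \<rho>"
  let ?n = "eval x \<rho> e" and ?N = "N + poly p N"
  have "zero_from (d + 1) \<rho>" using env(2) by (simp add: zero_from_def)
  note count = exp_costD[OF assms(1) le_add1 env(1) this]
  have "runs x (compile_prog pr (d + 2)) (0, \<rho>(d := i, d + 1 := ?n - Suc i), out) (poly q ?N)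
      (0, \<rho>(d := i, d + 1 := ?n - Suc i),
        out @ emitted x pr (d + 2) (\<rho>(d := i, d + 1 := ?n - Suc i)))"
    if "i < ?n" for i out
  proof (rule prog_costD[OF assms(2)])
    show "bounded_env (d + 2) ?N x (\<rho>(d := i, d + 1 := ?n - Suc i))"
      unfolding bounded_env_def
    proof (intro conjI allI impI)
      fix k assume "k < d + 2"
      then consider "k < d" | "k = d" | "k = d + 1" by linarith
      then show "(\<rho>(d := i, d + 1 := ?n - Suc i)) k \<le> ?N"
        using env(1) count(1) that by cases (auto simp: bounded_env_def intro: trans_le_add1)
    qed (use env(1) in \<open>simp add: bounded_env_def\<close>)
    show "zero_from (d + 2) (\<rho>(d := i, d + 1 := ?n - Suc i))"
      using env(2) by (simp add: zero_from_def)
  qed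
  from runs_For[OF env(2) count(2) this]
  have "runs x (compile_prog (For e pr) d) (0, \<rho>, out) (poly p N + ?n * (poly q ?N + 10) + 4)
      (0, \<rho>, out @ emitted x (For e pr) d \<rho>)" .
  then show "runs x (compile_prog (For e pr) d) (0, \<rho>, out) (poly ?r N)
      (0, \<rho>, out @ emitted x (For e pr) d \<rho>)"
    by (rule runs_mono) (use mult_le_mono1[OF count(1), of "poly q ?N + 10"] in
        \<open>simp add: poly_pcompose add.commute del: mult_le_cancel2\<close>)
qed

lemma ex_prog_cost: "well_scoped d pr \<Longrightarrow> \<exists>q. prog_cost d pr q"
proof (induction pr arbitrary: d)
  case (EmitNat e)
  then obtain p where "exp_cost d e p" using ex_exp_cost[of e d] by auto
  then show ?case by (blast intro: prog_cost_EmitNat)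
next
  case (Seq p1 p2)
  then obtain q1 q2 where "prog_cost d p1 q1" "prog_cost d p2 q2" by fastforce
  then show ?case by (blast intro: prog_cost_Seq)
next
  case (For e pr)
  then have "exp_vars e \<subseteq> {..<d}" "\<exists>q. prog_cost (d + 2) pr q" by simp_all
  then obtain p q where "exp_cost d e p" "prog_cost (d + 2) pr q" using ex_exp_cost by blast
  then show ?case by (blast intro: prog_cost_For)
qed (use prog_cost_Nop prog_cost_Emit in blast)+

theorem polytime_prog:
  assumes "well_scoped 0 pr"
  shows "polytime (\<lambda>x. emitted x pr 0 (\<lambda>_. 0))"
proof -
  obtain q where q: "prog_cost 0 pr q" using ex_prog_cost[OF assms] by blast
  have "bounded_env 0 (length x) x (\<lambda>_. 0)" "zero_from 0 (\<lambda>_. 0)" for x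
    by (simp_all add: bounded_env_def zero_from_def)
  from prog_costD[OF q this, of _ "[]"] show ?thesis
    by (intro polytime_com[of "compile_prog pr 0" q]) auto
qed

section \<open>Families of clauses\<close>

definition fulfils :: "(nat \<Rightarrow> bool) \<Rightarrow> (bool \<times> nat) list \<Rightarrow> bool" where
  "fulfils A C \<longleftrightarrow> (\<exists>(s, v) \<in> set C. A v = s)"

definition satisfiable :: "(bool \<times> nat) list list \<Rightarrow> bool" where
  "satisfiable cls \<longleftrightarrow> (\<exists>A. \<forall>C \<in> set cls. fulfils A C)"

lemma fulfils_simps [simp]:
  "fulfils A [] \<longleftrightarrow> False"
  "fulfils A ((s, v) # C) \<longleftrightarrow> A v = s \<or> fulfils A C"
  "fulfils A (C @ D) \<longleftrightarrow> fulfils A C \<or> fulfils A D"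
  by (auto simp: fulfils_def)

text \<open>
  A family \<open>(b1, b2, lits)\<close> stands for one clause for each \<open>i < b1\<close> and \<open>j < b2\<close>; the literals refer
  to \<open>i\<close> as variable 0 and to \<open>j\<close> as variable 2, as in a nest of two loops.
\<close>

type_synonym family = "exp \<times> exp \<times> (bool \<times> exp) list"

definition loop_env :: "nat \<Rightarrow> nat \<Rightarrow> nat \<Rightarrow> nat" where
  "loop_env i j = (\<lambda>k. if k = 0 then i else if k = 2 then j else 0)"

lemma loop_env_simps [simp]: "loop_env i j 0 = i" "loop_env i j 2 = j"
  by (simp_all add: loop_env_def)

abbreviation ceval :: "bool list \<Rightarrow> exp \<Rightarrow> nat" where
  "ceval x \<equiv> eval x (\<lambda>_. 0)"

lemma eval_closed: "exp_vars e = {} \<Longrightarrow> eval x \<rho> e = ceval x e"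
  by (rule eval_cong) simp

abbreviation instantiate :: "bool list \<Rightarrow> nat \<Rightarrow> nat \<Rightarrow> (bool \<times> exp) list \<Rightarrow> (bool \<times> nat) list" where
  "instantiate x i j \<equiv> map (\<lambda>(s, e). (s, eval x (loop_env i j) e))"

fun family_ok :: "family \<Rightarrow> bool" where
  "family_ok (b1, b2, lits) \<longleftrightarrow> exp_vars b1 = {} \<and> exp_vars b2 = {} \<and>
      (\<forall>(s, e) \<in> set lits. exp_vars e \<subseteq> {0, 2})"

fun family_clauses :: "bool list \<Rightarrow> family \<Rightarrow> (bool \<times> nat) list list" where
  "family_clauses x (b1, b2, lits) =
    concat (map (\<lambda>i. map (\<lambda>j. instantiate x i j lits) [0..<ceval x b2]) [0..<ceval x b1])"

definition clauses :: "bool list \<Rightarrow> family list \<Rightarrow> (bool \<times> nat) list list" where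
  "clauses x fams = concat (map (family_clauses x) fams)"

lemma set_clauses: "set (clauses x fams) = (\<Union>fam \<in> set fams. set (family_clauses x fam))"
  by (simp add: clauses_def)

lemma in_family_clauses:
  "C \<in> set (family_clauses x (b1, b2, lits)) \<longleftrightarrow>
    (\<exists>i < ceval x b1. \<exists>j < ceval x b2. C = instantiate x i j lits)"
  by (fastforce simp del: map_eq_conv)

declare family_clauses.simps [simp del]

locale cnf_families =
  fixes fams :: "family list" and var_count :: exp
  assumes families_ok: "fam \<in> set fams \<Longrightarrow> family_ok fam"
    and closed_var_count: "exp_vars var_count = {}"
    and var_less_count: "C \<in> set (clauses x fams) \<Longrightarrow> (s, v) \<in> set C \<Longrightarrow> v < ceval x var_count"

lemma ex_poly_exp: "\<exists>e. exp_vars e = {} \<and> (\<forall>x. ceval x e = poly p (length x))"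
proof (induction p)
  case 0
  then show ?case by (intro exI[of _ "Const 0"]) simp
next
  case (pCons a p)
  then obtain e where "exp_vars e = {}" "\<forall>x. ceval x e = poly p (length x)" by blast
  then show ?case by (intro exI[of _ "Add (Const a) (Mul Len e)"]) simp
qed

section \<open>Turing machine runs relative to the heads\<close>

fun offset :: "move \<Rightarrow> int" where
  "offset Left = -1"
| "offset Stay = 0"
| "offset Right = 1"

lemma move_head_offset: "move_head m h = h + offset m"
  by (cases m) auto

lemma offset_bounds: "- 1 \<le> offset m" "offset m \<le> 1"
  by (cases m; simp)+

lemma act_tape_sel:
  "fst (act_tape a tp) = (fst tp)(snd tp := fst a)" "snd (act_tape a tp) = snd tp + offset (snd a)"
  by (cases a; cases tp; simp add: move_head_offset)+

text \<open>
  Tape contents are addressed relative to the head, so that the head is always at position 0; the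
  state is treated as the content of one more tape.
\<close>

fun scan :: "config \<Rightarrow> nat \<Rightarrow> int \<Rightarrow> nat" where
  "scan (q, ts) i h =
    (if i < length ts then fst (ts ! i) (snd (ts ! i) + h) else if h = 0 then q else 0)"

definition wf_config :: "tm \<Rightarrow> config \<Rightarrow> bool" where
  "wf_config M cfg \<longleftrightarrow> fst cfg \<le> states M \<and> length (snd cfg) = tapes M \<and>
    (\<forall>tp \<in> set (snd cfg). \<forall>y. fst tp y < symbols M)"

definition view :: "tm \<Rightarrow> config \<Rightarrow> nat list" where
  "view M cfg = map (\<lambda>i. scan cfg i 0) [0..<tapes M + 1]"

definition valid_view :: "tm \<Rightarrow> nat list \<Rightarrow> bool" where
  "valid_view M e \<longleftrightarrow> length e = tapes M + 1 \<and> (\<forall>i < tapes M. e ! i < symbols M) \<and>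
      e ! tapes M \<le> states M"

definition view_act :: "tm \<Rightarrow> nat list \<Rightarrow> nat \<Rightarrow> nat \<times> int" where
  "view_act M e i = (let K = tapes M; q = e ! K; d = delta M q (take K e) in
    if states M \<le> q then (e ! i, 0)
    else if i < K then (fst (snd d ! i), offset (snd (snd d ! i)))
    else (fst d, 0))"

lemma view_act_bounds: "- 1 \<le> snd (view_act M e i)" "snd (view_act M e i) \<le> 1"
  by (auto simp: view_act_def Let_def offset_bounds)

lemma snd_view_act_state: "snd (view_act M e (tapes M)) = 0"
  by (simp add: view_act_def Let_def)

lemma valid_view_view: "wf_config M cfg \<Longrightarrow> valid_view M (view M cfg)"
  by (cases cfg) (auto simp: wf_config_def valid_view_def view_def nth_append simp del: upt_Suc)

lemma nth_view: "i \<le> tapes M \<Longrightarrow> view M cfg ! i = scan cfg i 0"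
  by (auto simp: view_def simp del: upt_Suc)

lemma take_view:
  "length (snd cfg) = tapes M \<Longrightarrow> take (tapes M) (view M cfg) = map (\<lambda>(c, h). c h) (snd cfg)"
  by (cases cfg) (auto simp: view_def take_map split_beta intro!: nth_equalityI simp del: upt_Suc)

lemma delta_valid_view:
  assumes "wf_tm M" "valid_view M e" "e ! tapes M < states M"
    and "delta M (e ! tapes M) (take (tapes M) e) = (q', acts)"
  shows "q' \<le> states M" "length acts = tapes M" "fst ` set acts \<subseteq> {..<symbols M}"
proof -
  have "length (take (tapes M) e) = tapes M \<and> set (take (tapes M) e) \<subseteq> {..<symbols M}"
    using assms(2) by (auto simp: valid_view_def in_set_conv_nth)
  then show "q' \<le> states M" "length acts = tapes M" "fst ` set acts \<subseteq> {..<symbols M}"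
    using assms(1,3,4) unfolding wf_tm_def by fastforce+
qed

lemma view_act_valid:
  assumes "wf_tm M" "valid_view M e"
  shows "i < tapes M \<Longrightarrow> fst (view_act M e i) < symbols M" "fst (view_act M e (tapes M)) \<le> states M"
proof -
  obtain q' acts where d: "delta M (e ! tapes M) (take (tapes M) e) = (q', acts)"
    by (metis surj_pair)
  note wf = delta_valid_view[OF assms _ d]
  show "i < tapes M \<Longrightarrow> fst (view_act M e i) < symbols M"
    using assms(2) wf nth_mem[of i acts]
    by (auto simp: view_act_def Let_def d valid_view_def image_subset_iff)
  show "fst (view_act M e (tapes M)) \<le> states M"
    using assms(2) wf by (auto simp: view_act_def Let_def d valid_view_def)
qed

lemma tm_step_view:
  assumes "wf_tm M" "wf_config M (q, ts)" "q < states M"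
  obtains q' acts where "delta M q (take (tapes M) (view M (q, ts))) = (q', acts)"
    "tm_step M (q, ts) = (q', map2 act_tape acts ts)"
    "q' \<le> states M" "length acts = tapes M" "fst ` set acts \<subseteq> {..<symbols M}"
proof -
  let ?e = "view M (q, ts)"
  have len: "length ts = tapes M" using assms(2) by (simp add: wf_config_def)
  then have state: "?e ! tapes M = q" by (simp add: nth_view)
  obtain q' acts where d: "delta M q (take (tapes M) ?e) = (q', acts)" by (metis surj_pair)
  have "tm_step M (q, ts) = (q', map2 act_tape acts ts)"
    using assms(3) d take_view[of "(q, ts)" M] len by (simp add: tm_step_def)
  from that[OF d this
      delta_valid_view[OF assms(1) valid_view_view[OF assms(2)], unfolded state, OF assms(3) d]]
  show ?thesis .
qed

lemma wf_config_tm_step: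
  assumes "wf_tm M" "wf_config M cfg"
  shows "wf_config M (tm_step M cfg)"
proof -
  obtain q ts where cfg: "cfg = (q, ts)" by (metis surj_pair)
  show ?thesis
  proof (cases "q < states M")
    case True
    from tm_step_view[OF assms[unfolded cfg] True] obtain q' acts
      where step: "tm_step M (q, ts) = (q', map2 act_tape acts ts)"
        and wf: "q' \<le> states M" "length acts = tapes M" "fst ` set acts \<subseteq> {..<symbols M}" .
    have "fst (act_tape a tp) y < symbols M" if "a \<in> set acts" "tp \<in> set ts" for a tp y
      using wf(3) assms(2) that by (auto simp: act_tape_sel cfg wf_config_def)
    then have "fst tp y < symbols M" if "tp \<in> set (map2 act_tape acts ts)" for tp y
      using that by (auto elim!: in_set_zipE simp del: act_tape.simps)
    then show ?thesis using step wf assms(2) by (simp add: cfg wf_config_def)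
  next
    case False
    then show ?thesis using assms(2) by (simp add: cfg tm_step_def)
  qed
qed

lemma scan_tm_step:
  assumes "wf_tm M" "wf_config M cfg" "i \<le> tapes M" "view_act M (view M cfg) i = (s, d)"
  shows "scan (tm_step M cfg) i h = (if h + d = 0 then s else scan cfg i (h + d))"
proof -
  obtain q ts where cfg: "cfg = (q, ts)" by (metis surj_pair)
  have len: "length ts = tapes M" using assms(2) by (simp add: wf_config_def cfg)
  then have state: "view M (q, ts) ! tapes M = q" by (simp add: nth_view)
  show ?thesis
  proof (cases "q < states M")
    case True
    from tm_step_view[OF assms(1) assms(2)[unfolded cfg] True] obtain q' acts
      where delta: "delta M q (take (tapes M) (view M (q, ts))) = (q', acts)"
        and step: "tm_step M (q, ts) = (q', map2 act_tape acts ts)"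
        and acts: "length acts = tapes M" .
    have "(s, d) = (if i < tapes M then (fst (acts ! i), offset (snd (acts ! i))) else (q', 0))"
      using True assms(4) by (simp add: view_act_def Let_def cfg state delta split: if_splits)
    then show ?thesis
      using len acts by (auto simp: cfg step act_tape_sel algebra_simps split: if_splits)
  next
    case False
    then have "tm_step M cfg = cfg" "s = view M cfg ! i" "d = 0"
      using assms(4) by (simp_all add: cfg tm_step_def view_act_def Let_def state)
    then show ?thesis using assms(3) by (simp add: nth_view)
  qed
qed

lemma head_tm_step:
  assumes "wf_tm M" "wf_config M cfg" "i < tapes M"
  shows "\<bar>snd (snd (tm_step M cfg) ! i)\<bar> \<le> \<bar>snd (snd cfg ! i)\<bar> + 1"
proof -
  obtain q ts where cfg: "cfg = (q, ts)" by (metis surj_pair)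
  show ?thesis
  proof (cases "q < states M")
    case True
    from tm_step_view[OF assms(1) assms(2)[unfolded cfg] True] obtain q' acts
      where "tm_step M (q, ts) = (q', map2 act_tape acts ts)" "length acts = tapes M" .
    then show ?thesis
      using assms(2,3) offset_bounds[of "snd (acts ! i)"]
      by (simp add: cfg wf_config_def act_tape_sel)
  next
    case False
    then show ?thesis by (simp add: cfg tm_step_def)
  qed
qed

lemma tm_steps_halted:
  assumes "fst cfg = states M"
  shows "(tm_step M ^^ k) cfg = cfg"
  by (induction k) (use assms in \<open>auto simp: tm_step_def split: prod.splits\<close>)

definition run_config :: "tm \<Rightarrow> bool list \<Rightarrow> nat \<Rightarrow> config" where
  "run_config M z t = (tm_step M ^^ t) (initial_config M z)"

lemma run_config_simps:
  "run_config M z 0 = initial_config M z" "run_config M z (Suc t) = tm_step M (run_config M z t)"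
  by (simp_all add: run_config_def)

lemma wf_run_config:
  assumes "wf_tm M"
  shows "wf_config M (run_config M z t)"
proof (induction t)
  case 0
  then show ?case
    using assms by (auto simp: run_config_simps wf_config_def initial_config_def wf_tm_def
        string_contents_def)
qed (simp add: run_config_simps wf_config_tm_step assms)

lemma scan_initial:
  assumes "wf_tm M" "i \<le> tapes M"
  shows "scan (run_config M z 0) i h = (if i = 0 then string_contents z h else 0)"
proof -
  have "0 < tapes M" using assms(1) by (simp add: wf_tm_def)
  then show ?thesis using assms(2) by (cases i) (auto simp: run_config_simps initial_config_def)
qed

lemma scan_run_Suc:
  assumes "wf_tm M" "i \<le> tapes M" "view_act M (view M (run_config M z t)) i = (s, d)"
  shows "scan (run_config M z (Suc t)) i h =
    (if h + d = 0 then s else scan (run_config M z t) i (h + d))"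
  unfolding run_config_simps by (rule scan_tm_step[OF assms(1) wf_run_config assms(2,3)]) fact

lemma head_run_config:
  assumes "wf_tm M" "i < tapes M"
  shows "\<bar>snd (snd (run_config M z t) ! i)\<bar> \<le> int t"
proof (induction t)
  case 0
  then show ?case using assms(2) by (cases i) (auto simp: run_config_simps initial_config_def)
next
  case (Suc t)
  then show ?case
    using head_tm_step[OF assms(1) wf_run_config[OF assms(1)] assms(2), of z t]
    by (simp add: run_config_simps)
qed

lemma scan_output:
  assumes "wf_tm M" "halts_with_output M ((tm_step M ^^ n) (initial_config M z)) y" "n \<le> T"
  shows "scan (run_config M z T) 1 h = string_contents y (snd (snd (run_config M z T) ! 1) + h)"
proof -
  have "run_config M z T = (tm_step M ^^ (T - n)) ((tm_step M ^^ n) (initial_config M z))"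
    using assms(3) by (simp add: run_config_def flip: funpow_add[THEN fun_cong, unfolded o_apply])
  also have "\<dots> = (tm_step M ^^ n) (initial_config M z)"
    using assms(2) by (intro tm_steps_halted) (simp add: halts_with_output_def)
  finally have "halts_with_output M (run_config M z T) y" using assms(2) by simp
  moreover have "1 < length (snd (run_config M z T))"
    using wf_run_config[OF assms(1), of z T] assms(1) by (auto simp: wf_config_def wf_tm_def)
  ultimately show ?thesis by (cases "run_config M z T") (auto simp: halts_with_output_def)
qed

text \<open>The bit \<open>False\<close> is the symbol 1, and the head cannot be further than \<open>T\<close> from the output.\<close>

definition accepts :: "tm \<Rightarrow> bool list \<Rightarrow> nat \<Rightarrow> bool" where
  "accepts M z T \<longleftrightarrow> (\<forall>h. \<bar>h\<bar> \<le> int T \<longrightarrow> scan (run_config M z T) 1 h \<noteq> 1)"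

lemma accepts_iff:
  assumes "wf_tm M" "halts_with_output M ((tm_step M ^^ n) (initial_config M z)) [b]" "n \<le> T"
  shows "accepts M z T \<longleftrightarrow> b"
proof -
  let ?p = "snd (snd (run_config M z T) ! 1)"
  have out: "scan (run_config M z T) 1 h = string_contents [b] (?p + h)" for h
    by (rule scan_output[OF assms])
  have "\<bar>- ?p\<bar> \<le> int T" using head_run_config[OF assms(1), of 1] assms(1) by (simp add: wf_tm_def)
  moreover have "scan (run_config M z T) 1 (- ?p) = 1" if "\<not> b"
    unfolding out using that by (simp add: string_contents_def)
  moreover have "scan (run_config M z T) 1 h \<noteq> 1" if b for h
    unfolding out using that by (simp add: string_contents_def)
  ultimately show ?thesis unfolding accepts_def by blast
qed

subsection \<open>Strings on tapes\<close>

lemma string_contents_range: "string_contents x h \<in> {0, 1, 2}"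
  by (simp add: string_contents_def)

lemma string_contents_outside:
  "h < 0 \<Longrightarrow> string_contents x h = 0" "int (length x) \<le> h \<Longrightarrow> string_contents x h = 0"
  by (simp_all add: string_contents_def)

lemma string_contents_Cons:
  "string_contents (b # z) h = (if h = 0 then if b then 2 else 1 else string_contents z (h - 1))"
  by (auto simp: string_contents_def nth_Cons' nat_diff_distrib)

lemma encode_pair_simps:
  "encode_pair [] y = False # y" "encode_pair (b # x) y = True # b # encode_pair x y"
  by (simp_all add: encode_pair_def encode_list_def)

lemma length_encode_pair: "length (encode_pair x y) = 2 * length x + 1 + length y"
  by (induction x) (simp_all add: encode_pair_simps)

lemma string_contents_encode_pair:
  "j < length x \<Longrightarrow> string_contents (encode_pair x y) (2 * int j) = 2"
  "j < length x \<Longrightarrow> string_contents (encode_pair x y) (2 * int j + 1) = string_contents x (int j)"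
  "string_contents (encode_pair x y) (2 * int (length x)) = 1"
  "0 \<le> h \<Longrightarrow> string_contents (encode_pair x y) (2 * int (length x) + 1 + h) = string_contents y h"
proof -
  show "j < length x \<Longrightarrow> string_contents (encode_pair x y) (2 * int j) = 2"
  proof (induction x arbitrary: j)
    case (Cons b x)
    then show ?case by (cases j) (auto simp: encode_pair_simps string_contents_Cons)
  qed simp
  show "j < length x \<Longrightarrow>
      string_contents (encode_pair x y) (2 * int j + 1) = string_contents x (int j)"
  proof (induction x arbitrary: j)
    case (Cons b x)
    then show ?case
      by (cases j) (auto simp: encode_pair_simps string_contents_Cons add.commute[of 1])
  qed simp
  show "string_contents (encode_pair x y) (2 * int (length x)) = 1"
    by (induction x) (auto simp: encode_pair_simps string_contents_Cons)
  show "0 \<le> h \<Longrightarrow>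
      string_contents (encode_pair x y) (2 * int (length x) + 1 + h) = string_contents y h"
    by (induction x) (auto simp: encode_pair_simps string_contents_Cons ac_simps)
qed

lemma ex_string_with_symbols:
  assumes "\<And>j. j < n \<Longrightarrow> B j 0 \<or> B j 1 \<or> B j 2" "\<And>j. j < n \<Longrightarrow> B j 0 \<Longrightarrow> B (Suc j) 0"
  obtains y where "length y \<le> n" "\<And>j. j < n \<Longrightarrow> B j (string_contents y (int j))"
proof -
  define l where "l = (LEAST j. j = n \<or> B j 0)"
  have l: "l = n \<or> B l 0" unfolding l_def by (rule LeastI[of _ n]) simp
  have "l \<le> n" unfolding l_def by (rule Least_le) simp
  have before: "\<not> B j 0" if "j < l" for j
    using not_less_Least[of j "\<lambda>j. j = n \<or> B j 0"] that unfolding l_def by blast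
  have after: "B j 0" if "l \<le> j" "j < n" for j
    using that by (induction j rule: dec_induct) (use l assms(2) in auto)
  define y where "y = map (\<lambda>j. B j 2) [0..<l]"
  have "B j (string_contents y (int j))" if "j < n" for j
  proof (cases "j < l")
    case True
    then show ?thesis using assms(1)[OF that] before[OF True]
      by (auto simp: y_def string_contents_def)
  next
    case False
    then show ?thesis using after[of j] that by (simp add: y_def string_contents_def)
  qed
  moreover have "length y \<le> n" using \<open>l \<le> n\<close> by (simp add: y_def)
  ultimately show ?thesis by (rule that[rotated])
qed

section \<open>The tableau of a Turing machine\<close>

lemma mixed_radix_less:
  fixes a b m n :: nat
  assumes "a < m" "b < n"
  shows "a * n + b < m * n"
proof -
  have "a * n + b < (a + 1) * n" using assms by simp
  also have "\<dots> \<le> m * n" using assms by (intro mult_le_mono1) simp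
  finally show ?thesis .
qed

lemma mixed_radix_inj:
  fixes a b a' b' n :: nat
  assumes "a * n + b = a' * n + b'" "b < n" "b' < n"
  shows "a = a' \<and> b = b'"
proof -
  have "a = (a * n + b) div n" "a' = (a' * n + b') div n" using assms(2,3) by simp_all
  then have "a = a'" using assms(1) by simp
  then show ?thesis using assms(1) by simp
qed

lemma ex_shifted_iff: "(\<exists>j<n. P (a + int j)) \<longleftrightarrow> (\<exists>h. a \<le> h \<and> h < a + int n \<and> P h)"
proof
  assume "\<exists>h. a \<le> h \<and> h < a + int n \<and> P h"
  then obtain h where h: "a \<le> h" "h < a + int n" "P h" by blast
  then have "nat (h - a) < n" "a + int (nat (h - a)) = h" by auto
  with h(3) show "\<exists>j<n. P (a + int j)" by metis
next
  assume "\<exists>j<n. P (a + int j)"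
  then obtain j where "j < n" "P (a + int j)" by blast
  then show "\<exists>h. a \<le> h \<and> h < a + int n \<and> P h" by (intro exI[of _ "a + int j"]) simp
qed

lemma ex_nonzero_iff:
  "(\<exists>j<n. P (- 1 - int j) \<or> P (1 + int j)) \<longleftrightarrow> (\<exists>h. h \<noteq> 0 \<and> \<bar>h\<bar> \<le> int n \<and> P h)"
proof
  assume "\<exists>h. h \<noteq> 0 \<and> \<bar>h\<bar> \<le> int n \<and> P h"
  then obtain h where h: "h \<noteq> 0" "\<bar>h\<bar> \<le> int n" "P h" by blast
  then have "nat (\<bar>h\<bar> - 1) < n" "- 1 - int (nat (\<bar>h\<bar> - 1)) = h \<or> 1 + int (nat (\<bar>h\<bar> - 1)) = h"
    by auto
  with h(3) show "\<exists>j<n. P (- 1 - int j) \<or> P (1 + int j)" by metis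
next
  assume "\<exists>j<n. P (- 1 - int j) \<or> P (1 + int j)"
  then obtain j where "j < n" "P (- 1 - int j) \<or> P (1 + int j)" by blast
  then show "\<exists>h. h \<noteq> 0 \<and> \<bar>h\<bar> \<le> int n \<and> P h"
    by (elim disjE) (intro exI[of _ "- 1 - int j"], simp, intro exI[of _ "1 + int j"], simp)
qed

text \<open>
  The variable \<open>cell_exp i s t p\<close> says that at time \<open>t\<close> tape \<open>i\<close> has symbol \<open>s\<close> at index \<open>p\<close>, where
  index \<open>origin_exp\<close> is the head position and tape \<open>tapes M\<close> holds the state.
\<close>

locale tableau =
  fixes M :: tm and time_exp cert_exp :: exp
  assumes wf: "wf_tm M" and closed: "exp_vars time_exp = {}" "exp_vars cert_exp = {}"
    and time_large: "2 * length x + ceval x cert_exp < ceval x time_exp"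
begin

abbreviation K :: nat where "K \<equiv> tapes M"

definition content_count :: nat where "content_count = symbols M + states M + 1"

definition radius_exp :: exp where
  "radius_exp = Add (Mul (Const 2) time_exp) (Const 1)"

definition origin_exp :: exp where
  "origin_exp = Add radius_exp (Const 1)"

definition width_exp :: exp where
  "width_exp = Add (Mul (Const 2) radius_exp) (Const 3)"

definition cell_exp :: "nat \<Rightarrow> exp \<Rightarrow> exp \<Rightarrow> exp \<Rightarrow> exp" where
  "cell_exp i s t p =
    Add (Mul (Add (Mul (Add (Const (i * content_count)) s) (Add time_exp (Const 1))) t) width_exp)
      p"

definition cell_count :: exp where
  "cell_count = Mul (Mul (Const ((K + 1) * content_count)) (Add time_exp (Const 1))) width_exp"

text \<open>Since the moves \<open>d\<close> lie between -1 and 1, this is the index \<open>p - d\<close>.\<close>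

definition shift_exp :: "exp \<Rightarrow> int \<Rightarrow> exp" where
  "shift_exp p d = Sub (Add p (Const (nat (1 - d)))) (Const 1)"

definition view_lits :: "nat list \<Rightarrow> (bool \<times> exp) list" where
  "view_lits e = map (\<lambda>k. (False, cell_exp k (Const (e ! k)) (Var 0) origin_exp)) [0..<K + 1]"

definition write_lits :: "nat list \<Rightarrow> nat \<Rightarrow> (bool \<times> exp) list" where
  "write_lits e i = (case view_act M e i of (s, d) \<Rightarrow> view_lits e @
     [(True, cell_exp i (Const s) (Add (Var 0) (Const 1)) (shift_exp origin_exp d))])"

definition keep_lits :: "nat list \<Rightarrow> nat \<Rightarrow> nat \<Rightarrow> exp \<Rightarrow> (bool \<times> exp) list" where
  "keep_lits e i s p = view_lits e @
     [(False, cell_exp i (Const s) (Var 0) p),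
      (True, cell_exp i (Const s) (Add (Var 0) (Const 1)) (shift_exp p (snd (view_act M e i))))]"

definition views :: "nat list list" where
  "views = filter (valid_view M) (List.n_lists (K + 1) [0..<content_count])"

definition write_fams :: "family list" where
  "write_fams = [(time_exp, Const 1, write_lits e i). e \<leftarrow> views, i \<leftarrow> [0..<K + 1]]"

definition keep_fams :: "family list" where
  "keep_fams = [(time_exp, radius_exp, keep_lits e i s p).
     e \<leftarrow> views, i \<leftarrow> [0..<K], s \<leftarrow> [0..<symbols M],
     p \<leftarrow> [Sub radius_exp (Var 2), Add (Add origin_exp (Const 1)) (Var 2)]]"

definition initial_fam :: "exp \<Rightarrow> nat \<Rightarrow> exp \<Rightarrow> exp \<Rightarrow> family" where
  "initial_fam b i s p = (b, Const 1, [(True, cell_exp i s (Const 0) p)])"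

definition blank_fams :: "family list" where
  "blank_fams = map (\<lambda>i. initial_fam (Add (Mul (Const 2) radius_exp) (Const 1)) i (Const 0)
      (Add (Var 0) (Const 1))) [1..<K]"

definition separator_exp :: exp where
  "separator_exp = Add origin_exp (Mul (Const 2) Len)"

definition cert_start_exp :: exp where
  "cert_start_exp = Add separator_exp (Const 1)"

definition input_fams :: "family list" where
  "input_fams = [
     initial_fam (Const 1) K (Const 0) origin_exp,
     initial_fam radius_exp 0 (Const 0) (Add (Var 0) (Const 1)),
     initial_fam Len 0 (Const 2) (Add origin_exp (Mul (Const 2) (Var 0))),
     initial_fam Len 0 (Bit (Var 0)) (Add (Add origin_exp (Mul (Const 2) (Var 0))) (Const 1)),
     initial_fam (Const 1) 0 (Const 1) separator_exp,
     initial_fam (Sub radius_exp (Add (Mul (Const 2) Len) cert_exp)) 0 (Const 0)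
       (Add (Add cert_start_exp cert_exp) (Var 0))]"

definition guess_fam :: family where
  "guess_fam = (cert_exp, Const 1,
     map (\<lambda>s. (True, cell_exp 0 (Const s) (Const 0) (Add cert_start_exp (Var 0)))) [0, 1, 2])"

definition guess_end_fam :: family where
  "guess_end_fam = (cert_exp, Const 1,
     [(False, cell_exp 0 (Const 0) (Const 0) (Add cert_start_exp (Var 0))),
      (True, cell_exp 0 (Const 0) (Const 0) (Add (Add cert_start_exp (Const 1)) (Var 0)))])"

definition accept_fam :: family where
  "accept_fam = (Add (Mul (Const 2) time_exp) (Const 1), Const 1,
     [(False, cell_exp 1 (Const 1) time_exp (Add (Var 0) (Add time_exp (Const 2))))])"

definition fams :: "family list" where
  "fams = write_fams @ keep_fams @ blank_fams @ input_fams @ [guess_fam, guess_end_fam, accept_fam]"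

lemma exp_vars_exps [simp]:
  "exp_vars radius_exp = {}" "exp_vars origin_exp = {}" "exp_vars width_exp = {}"
  "exp_vars separator_exp = {}" "exp_vars cert_start_exp = {}" "exp_vars cell_count = {}"
  "exp_vars (shift_exp p d) = exp_vars p"
  "exp_vars (cell_exp i s t p) = exp_vars s \<union> exp_vars t \<union> exp_vars p"
  by (simp_all add: closed radius_exp_def origin_exp_def width_exp_def separator_exp_def
      cert_start_exp_def cell_count_def shift_exp_def cell_exp_def)

lemma fams_ok:
  assumes "fam \<in> set fams"
  shows "family_ok fam"
proof -
  let ?scoped = "\<lambda>lits. \<forall>(s, e) \<in> set lits. exp_vars e \<subseteq> {0, 2}"
  have view: "?scoped (view_lits e)" for e
    by (auto simp: view_lits_def simp del: upt_Suc)
  have "?scoped (write_lits e i)" for e i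
    using view[of e] by (cases "view_act M e i") (auto simp: write_lits_def)
  then have "family_ok (time_exp, Const 1, write_lits e i)" for e i
    by (simp add: closed)
  moreover have "?scoped (keep_lits e i s p)" if "exp_vars p \<subseteq> {2}" for e i s p
    using view[of e] that by (auto simp: keep_lits_def)
  then have "family_ok (time_exp, radius_exp, keep_lits e i s p)" if "exp_vars p \<subseteq> {2}" for e i s p
    using that by (simp add: closed)
  ultimately have "\<forall>fam \<in> set write_fams. family_ok fam" "\<forall>fam \<in> set keep_fams. family_ok fam"
    by (auto simp: write_fams_def keep_fams_def simp del: family_ok.simps upt_Suc)
  then show ?thesis
    using assms unfolding fams_def blank_fams_def input_fams_def initial_fam_def guess_fam_def
      guess_end_fam_def accept_fam_def
    by (auto simp: closed)
qed

lemma tapes_ge: "2 \<le> K" and symbols_ge: "3 \<le> symbols M"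
  using wf by (auto simp: wf_tm_def)

lemma nth_view_less: "valid_view M e \<Longrightarrow> k \<le> K \<Longrightarrow> e ! k < content_count"
  by (cases "k = K") (auto simp: valid_view_def content_count_def dest: spec[of _ k])

lemma set_views: "set views = {e. valid_view M e}"
proof -
  have "set e \<subseteq> {0..<content_count}" "length e = K + 1" if "valid_view M e" for e
    using nth_view_less[OF that] that by (auto simp: valid_view_def in_set_conv_nth)
  then show ?thesis unfolding views_def set_filter set_n_lists by auto
qed

lemma view_act_less: "valid_view M e \<Longrightarrow> i \<le> K \<Longrightarrow> fst (view_act M e i) < content_count"
  using view_act_valid(1)[OF wf, of e i] view_act_valid(2)[OF wf, of e]
  by (cases "i = K") (auto simp: content_count_def)

lemma less_content_count:
  "s < symbols M \<Longrightarrow> s < content_count" "string_contents x h < content_count"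
  "0 < content_count" "1 < content_count" "2 < content_count"
  using symbols_ge by (auto simp: content_count_def string_contents_def)

context
  fixes x :: "bool list"
begin

definition T :: nat where "T = ceval x time_exp"
definition cert_bound :: nat where "cert_bound = ceval x cert_exp"
abbreviation radius :: nat where "radius \<equiv> 2 * T + 1"
abbreviation width :: nat where "width \<equiv> 2 * radius + 3"
abbreviation cert_start :: int where "cert_start \<equiv> 2 * int (length x) + 1"

definition cell_code :: "nat \<Rightarrow> nat \<Rightarrow> nat \<Rightarrow> nat \<Rightarrow> nat" where
  "cell_code i s t p = ((i * content_count + s) * (T + 1) + t) * width + p"

definition index :: "int \<Rightarrow> nat" where
  "index h = nat (h + int radius + 1)"

definition cell :: "nat \<Rightarrow> nat \<Rightarrow> nat \<Rightarrow> int \<Rightarrow> nat" where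
  "cell i s t h = cell_code i s t (index h)"

lemma eval_exps [simp]:
  "eval x \<rho> time_exp = T" "eval x \<rho> cert_exp = cert_bound" "eval x \<rho> radius_exp = radius"
  "eval x \<rho> origin_exp = radius + 1" "eval x \<rho> width_exp = width"
  "eval x \<rho> separator_exp = radius + 1 + 2 * length x"
  "eval x \<rho> cert_start_exp = radius + 2 + 2 * length x"
  "eval x \<rho> (cell_exp i s t p) = cell_code i (eval x \<rho> s) (eval x \<rho> t) (eval x \<rho> p)"
proof -
  show eqs: "eval x \<rho> time_exp = T" "eval x \<rho> cert_exp = cert_bound" for \<rho>
    unfolding T_def cert_bound_def by (rule eval_closed, rule closed)+
  show "eval x \<rho> radius_exp = radius"
    "eval x \<rho> origin_exp = radius + 1" "eval x \<rho> width_exp = width"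
    "eval x \<rho> separator_exp = radius + 1 + 2 * length x"
    "eval x \<rho> cert_start_exp = radius + 2 + 2 * length x"
    "eval x \<rho> (cell_exp i s t p) = cell_code i (eval x \<rho> s) (eval x \<rho> t) (eval x \<rho> p)"
    by (simp_all add: eqs radius_exp_def origin_exp_def width_exp_def separator_exp_def
        cert_start_exp_def cell_exp_def cell_code_def)
qed

lemma cert_end_less: "2 * length x + cert_bound < T"
  using time_large unfolding T_def cert_bound_def .

lemma cell_less:
  assumes "i \<le> K" "s < content_count" "t \<le> T" "\<bar>h\<bar> \<le> int radius + 1"
  shows "cell i s t h < eval x \<rho> cell_count"
proof -
  have "cell i s t h < (K + 1) * content_count * (T + 1) * width"
    unfolding cell_def cell_code_def using assms
    by (intro mixed_radix_less) (auto simp: index_def)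
  then show ?thesis by (simp add: cell_count_def)
qed

lemma cell_inj:
  assumes "cell i s t h = cell i' s' t' h'" "s < content_count" "s' < content_count"
    and "t \<le> T" "t' \<le> T"
    and "\<bar>h\<bar> \<le> int radius + 1" "\<bar>h'\<bar> \<le> int radius + 1"
  shows "i = i' \<and> s = s' \<and> t = t' \<and> h = h'"
proof -
  have "index h < width" "index h' < width" using assms by (auto simp: index_def)
  note outer = mixed_radix_inj[OF assms(1)[unfolded cell_def cell_code_def] this]
  have "t < T + 1" "t' < T + 1" using assms by auto
  note inner = mixed_radix_inj[OF conjunct1[OF outer] this]
  have "i = i' \<and> s = s'" by (rule mixed_radix_inj[OF conjunct1[OF inner] assms(2,3)])
  moreover have "h = h'" using outer assms by (auto simp: index_def)
  ultimately show ?thesis using inner by blast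
qed

definition view_clause :: "nat list \<Rightarrow> nat \<Rightarrow> (bool \<times> nat) list" where
  "view_clause e t = map (\<lambda>k. (False, cell k (e ! k) t 0)) [0..<K + 1]"

lemma fulfils_view_clause:
  "fulfils A (view_clause e t) \<longleftrightarrow> \<not> (\<forall>k \<le> K. A (cell k (e ! k) t 0))"
  by (auto simp: fulfils_def view_clause_def less_Suc_eq_le simp del: upt_Suc)

inductive_set tableau_clauses :: "(bool \<times> nat) list set" where
  write_symbol: "valid_view M e \<Longrightarrow> i \<le> K \<Longrightarrow> t < T \<Longrightarrow> view_act M e i = (s, d) \<Longrightarrow>
    view_clause e t @ [(True, cell i s (t + 1) (- d))] \<in> tableau_clauses"
| keep_symbol: "valid_view M e \<Longrightarrow> i < K \<Longrightarrow> s < symbols M \<Longrightarrow> t < T \<Longrightarrow> h \<noteq> 0 \<Longrightarrow> \<bar>h\<bar> \<le> int radius \<Longrightarrow>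
    view_clause e t @ [(False, cell i s t h), (True, cell i s (t + 1) (h - snd (view_act M e i)))]
      \<in> tableau_clauses"
| blank_tape: "0 < i \<Longrightarrow> i < K \<Longrightarrow> \<bar>h\<bar> \<le> int radius \<Longrightarrow> [(True, cell i 0 0 h)] \<in> tableau_clauses"
| start_state: "[(True, cell K 0 0 0)] \<in> tableau_clauses"
| before_input: "- int radius \<le> h \<Longrightarrow> h < 0 \<Longrightarrow> [(True, cell 0 0 0 h)] \<in> tableau_clauses"
| input_mark: "j < length x \<Longrightarrow> [(True, cell 0 2 0 (2 * int j))] \<in> tableau_clauses"
| input_bit: "j < length x \<Longrightarrow>
    [(True, cell 0 (string_contents x (int j)) 0 (2 * int j + 1))] \<in> tableau_clauses"
| separator: "[(True, cell 0 1 0 (2 * int (length x)))] \<in> tableau_clauses"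
| after_input: "cert_start + int cert_bound \<le> h \<Longrightarrow> h \<le> int radius \<Longrightarrow>
    [(True, cell 0 0 0 h)] \<in> tableau_clauses"
| guess: "j < cert_bound \<Longrightarrow>
    map (\<lambda>s. (True, cell 0 s 0 (cert_start + int j))) [0, 1, 2] \<in> tableau_clauses"
| guess_end: "j < cert_bound \<Longrightarrow>
    [(False, cell 0 0 0 (cert_start + int j)), (True, cell 0 0 0 (cert_start + int (Suc j)))]
      \<in> tableau_clauses"
| accept: "\<bar>h\<bar> \<le> int T \<Longrightarrow> [(False, cell 1 1 T h)] \<in> tableau_clauses"

subsection \<open>The families produce the tableau clauses\<close>

lemma index_eqI: "h + int radius + 1 = int p \<Longrightarrow> index h = p"
  by (simp add: index_def)

lemma index_0: "index 0 = radius + 1"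
  by (rule index_eqI) simp

lemma index_shift:
  assumes "- 1 \<le> d" "d \<le> 1" "- int radius \<le> h" "eval x \<rho> p = index h"
  shows "eval x \<rho> (shift_exp p d) = index (h - d)"
proof -
  have "int (index h + nat (1 - d) - 1) = int (index (h - d))"
    using assms(1-3) by (simp add: index_def of_nat_diff)
  then show ?thesis using assms(4) by (simp add: shift_exp_def)
qed

lemma instantiate_view_lits: "instantiate x t j (view_lits e) = view_clause e t"
  by (simp add: view_lits_def view_clause_def cell_def index_0 del: upt_Suc)

lemma instantiate_write_lits:
  assumes "view_act M e i = (s, d)"
  shows "instantiate x t j (write_lits e i) = view_clause e t @ [(True, cell i s (t + 1) (- d))]"
proof -
  have "eval x \<rho> (shift_exp origin_exp d) = index (0 - d)" for \<rho>
    using view_act_bounds[of M e i] assms by (intro index_shift) (simp_all add: index_0)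
  then show ?thesis
    by (simp add: write_lits_def assms instantiate_view_lits cell_def)
qed

lemma instantiate_keep_lits:
  assumes "eval x (loop_env t j) p = index h" "- int radius \<le> h"
  shows "instantiate x t j (keep_lits e i s p) = view_clause e t @
    [(False, cell i s t h), (True, cell i s (t + 1) (h - snd (view_act M e i)))]"
  using index_shift[OF view_act_bounds assms(2,1), of M e i] assms(1)
  unfolding keep_lits_def map_append instantiate_view_lits by (simp add: cell_def)

lemma write_fams_clauses:
  "C \<in> set (clauses x write_fams) \<longleftrightarrow> (\<exists>e i t s d.
    C = view_clause e t @ [(True, cell i s (t + 1) (- d))] \<and>
    valid_view M e \<and> i \<le> K \<and> t < T \<and> view_act M e i = (s, d))"
proof -
  have family: "C \<in> set (family_clauses x (time_exp, Const 1, write_lits e i)) \<longleftrightarrow>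
      (\<exists>t s d. t < T \<and> view_act M e i = (s, d) \<and>
        C = view_clause e t @ [(True, cell i s (t + 1) (- d))])" for e i
    unfolding in_family_clauses by (cases "view_act M e i") (simp add: instantiate_write_lits)
  have "C \<in> set (clauses x write_fams) \<longleftrightarrow> (\<exists>e. valid_view M e \<and>
      (\<exists>i \<le> K. C \<in> set (family_clauses x (time_exp, Const 1, write_lits e i))))"
    by (simp add: write_fams_def set_clauses set_views Bex_def less_Suc_eq_le del: upt_Suc)
  then show ?thesis unfolding family by blast
qed

lemma keep_fams_clauses:
  "C \<in> set (clauses x keep_fams) \<longleftrightarrow> (\<exists>e i s t h. C = view_clause e t @
      [(False, cell i s t h), (True, cell i s (t + 1) (h - snd (view_act M e i)))] \<and>
    valid_view M e \<and> i < K \<and> s < symbols M \<and> t < T \<and> h \<noteq> 0 \<and> \<bar>h\<bar> \<le> int radius)"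
proof -
  let ?C = "\<lambda>e i s t h. view_clause e t @
      [(False, cell i s t h), (True, cell i s (t + 1) (h - snd (view_act M e i)))]"
  let ?left = "Sub radius_exp (Var 2)" and ?right = "Add (Add origin_exp (Const 1)) (Var 2)"
  have left: "instantiate x t j (keep_lits e i s ?left) = ?C e i s t (- 1 - int j)" if "j < radius"
    for e i s t j
    using that by (intro instantiate_keep_lits index_eqI[symmetric]) (simp_all add: of_nat_diff)
  have right: "instantiate x t j (keep_lits e i s ?right) = ?C e i s t (1 + int j)" for e i s t j
    by (intro instantiate_keep_lits index_eqI[symmetric]) simp_all
  have family: "C \<in> set (family_clauses x (time_exp, radius_exp, keep_lits e i s ?left)) \<or>
      C \<in> set (family_clauses x (time_exp, radius_exp, keep_lits e i s ?right)) \<longleftrightarrow>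
      (\<exists>t<T. \<exists>h. h \<noteq> 0 \<and> \<bar>h\<bar> \<le> int radius \<and> C = ?C e i s t h)" for e i s
    unfolding in_family_clauses ex_nonzero_iff[symmetric] eval_exps right using left by metis
  have "C \<in> set (clauses x keep_fams) \<longleftrightarrow> (\<exists>e. valid_view M e \<and> (\<exists>i<K. \<exists>s<symbols M.
      C \<in> set (family_clauses x (time_exp, radius_exp, keep_lits e i s ?left)) \<or>
      C \<in> set (family_clauses x (time_exp, radius_exp, keep_lits e i s ?right))))"
    by (simp add: keep_fams_def set_clauses set_views Bex_def)
  then show ?thesis unfolding family by blast
qed

lemma initial_fam_clauses:
  assumes "\<And>\<rho>. eval x \<rho> p = index (a + int (\<rho> 0))"
    and "\<And>h. R h \<longleftrightarrow> a \<le> h \<and> h < a + int (ceval x b)"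
  shows "C \<in> set (family_clauses x (initial_fam b i (Const s) p)) \<longleftrightarrow>
    (\<exists>h. C = [(True, cell i s 0 h)] \<and> R h)"
  unfolding initial_fam_def in_family_clauses assms(2) conj_commute[of "C = _"] conj_assoc
    ex_shifted_iff[symmetric]
  by (simp add: assms(1) cell_def)

lemma blank_fams_clauses:
  "C \<in> set (clauses x blank_fams) \<longleftrightarrow>
    (\<exists>i h. C = [(True, cell i 0 0 h)] \<and> 0 < i \<and> i < K \<and> \<bar>h\<bar> \<le> int radius)"
proof -
  have family: "C \<in> set (family_clauses x (initial_fam (Add (Mul (Const 2) radius_exp) (Const 1)) i
      (Const 0) (Add (Var 0) (Const 1)))) \<longleftrightarrow>
      (\<exists>h. C = [(True, cell i 0 0 h)] \<and> \<bar>h\<bar> \<le> int radius)" for i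
    by (rule initial_fam_clauses[where a = "- int radius"]) (auto intro!: index_eqI[symmetric])
  have "C \<in> set (clauses x blank_fams) \<longleftrightarrow> (\<exists>i. 0 < i \<and> i < K \<and>
      C \<in> set (family_clauses x (initial_fam (Add (Mul (Const 2) radius_exp) (Const 1)) i
        (Const 0) (Add (Var 0) (Const 1)))))"
    by (simp add: blank_fams_def set_clauses Bex_def Suc_le_eq)
  then show ?thesis unfolding family by blast
qed

lemma input_fams_clauses:
  "C \<in> set (clauses x input_fams) \<longleftrightarrow>
    C = [(True, cell K 0 0 0)] \<or>
    (\<exists>h. C = [(True, cell 0 0 0 h)] \<and> - int radius \<le> h \<and> h < 0) \<or>
    (\<exists>j. C = [(True, cell 0 2 0 (2 * int j))] \<and> j < length x) \<or>
    (\<exists>j. C = [(True, cell 0 (string_contents x (int j)) 0 (2 * int j + 1))] \<and> j < length x) \<or>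
    C = [(True, cell 0 1 0 (2 * int (length x)))] \<or>
    (\<exists>h. C = [(True, cell 0 0 0 h)] \<and> cert_start + int cert_bound \<le> h \<and> h \<le> int radius)"
proof -
  have before: "C \<in> set (family_clauses x (initial_fam radius_exp 0 (Const 0)
      (Add (Var 0) (Const 1)))) \<longleftrightarrow> (\<exists>h. C = [(True, cell 0 0 0 h)] \<and> - int radius \<le> h \<and> h < 0)"
    by (rule initial_fam_clauses[where a = "- int radius"]) (auto intro!: index_eqI[symmetric])
  have after: "C \<in> set (family_clauses x
      (initial_fam (Sub radius_exp (Add (Mul (Const 2) Len) cert_exp)) 0 (Const 0)
        (Add (Add cert_start_exp cert_exp) (Var 0)))) \<longleftrightarrow>
      (\<exists>h. C = [(True, cell 0 0 0 h)] \<and> cert_start + int cert_bound \<le> h \<and> h \<le> int radius)"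
    using cert_end_less
    by (intro initial_fam_clauses[where a = "cert_start + int cert_bound"])
      (auto intro!: index_eqI[symmetric] simp: of_nat_diff)
  have even: "index (2 * int j) = radius + 1 + 2 * j"
    and odd: "index (2 * int j + 1) = radius + 1 + 2 * j + 1" for j
    by (rule index_eqI, simp)+
  show ?thesis
    unfolding input_fams_def set_clauses list.set UN_insert Un_iff before after
    unfolding initial_fam_def in_family_clauses cell_def index_0 even odd
    by (simp add: conj_commute)
qed

lemma guess_clauses:
  "C \<in> set (family_clauses x guess_fam) \<longleftrightarrow>
    (\<exists>j. C = map (\<lambda>s. (True, cell 0 s 0 (cert_start + int j))) [0, 1, 2] \<and> j < cert_bound)"
  "C \<in> set (family_clauses x guess_end_fam) \<longleftrightarrow> (\<exists>j. C =
    [(False, cell 0 0 0 (cert_start + int j)), (True, cell 0 0 0 (cert_start + int (Suc j)))] \<and>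
    j < cert_bound)"
proof -
  have index: "index (cert_start + int j) = radius + 2 + 2 * length x + j" for j
    by (rule index_eqI) simp
  show "C \<in> set (family_clauses x guess_fam) \<longleftrightarrow>
      (\<exists>j. C = map (\<lambda>s. (True, cell 0 s 0 (cert_start + int j))) [0, 1, 2] \<and> j < cert_bound)"
    unfolding guess_fam_def in_family_clauses cell_def index by (simp add: conj_commute)
  show "C \<in> set (family_clauses x guess_end_fam) \<longleftrightarrow> (\<exists>j. C =
      [(False, cell 0 0 0 (cert_start + int j)), (True, cell 0 0 0 (cert_start + int (Suc j)))] \<and>
      j < cert_bound)"
    unfolding guess_end_fam_def in_family_clauses cell_def index by (simp add: conj_commute)
qed

lemma accept_clauses:
  "C \<in> set (family_clauses x accept_fam) \<longleftrightarrow> (\<exists>h. C = [(False, cell 1 1 T h)] \<and> \<bar>h\<bar> \<le> int T)"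
proof -
  have index: "index (- int T + int j) = j + (T + 2)" for j
    by (rule index_eqI) simp
  have "C \<in> set (family_clauses x accept_fam) \<longleftrightarrow>
      (\<exists>j < 2 * T + 1. C = [(False, cell 1 1 T (- int T + int j))])"
    unfolding accept_fam_def in_family_clauses cell_def index by simp
  moreover have "(- int T \<le> h \<and> h < - int T + int (2 * T + 1)) \<longleftrightarrow> \<bar>h\<bar> \<le> int T" for h
    by auto
  ultimately show ?thesis
    using ex_shifted_iff[of "2 * T + 1" "\<lambda>h. C = [(False, cell 1 1 T h)]" "- int T"]
    by (simp only: conj_assoc[symmetric] conj_commute)
qed

lemma set_clauses_fams: "set (clauses x fams) = tableau_clauses"
proof -
  have "C \<in> set (clauses x fams) \<longleftrightarrow>
      C \<in> set (clauses x write_fams) \<or> C \<in> set (clauses x keep_fams) \<or>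
      C \<in> set (clauses x blank_fams) \<or> C \<in> set (clauses x input_fams) \<or>
      C \<in> set (family_clauses x guess_fam) \<or> C \<in> set (family_clauses x guess_end_fam) \<or>
      C \<in> set (family_clauses x accept_fam)" for C
    by (auto simp: fams_def set_clauses)
  then have "C \<in> set (clauses x fams) \<longleftrightarrow> C \<in> tableau_clauses" for C
    unfolding tableau_clauses.simps[of C] write_fams_clauses keep_fams_clauses blank_fams_clauses
      input_fams_clauses guess_clauses accept_clauses
    by (simp only: disj_assoc)
  then show ?thesis by blast
qed

lemma tableau_clauses_bounded:
  assumes "C \<in> tableau_clauses" "(b, v) \<in> set C"
  shows "v < eval x \<rho> cell_count"
proof -
  have view: "v < eval x \<rho> cell_count"
    if "valid_view M e" "t < T" "(b, v) \<in> set (view_clause e t)" for b v e t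
    using that nth_view_less[OF that(1)]
    by (auto simp: view_clause_def less_Suc_eq_le intro!: cell_less simp del: upt_Suc)
  have "\<forall>(b, v) \<in> set C. v < eval x \<rho> cell_count"
    using assms(1)
  proof cases
    case (write_symbol e i t s d)
    then show ?thesis
      using view[of e t] view_act_less[of e i] view_act_bounds[of M e i]
      by (auto intro!: cell_less)
  next
    case (keep_symbol e i s t h)
    then show ?thesis
      using view[of e t] less_content_count(1)[of s] view_act_bounds[of M e i]
      by (auto intro!: cell_less)
  qed (use tapes_ge less_content_count cert_end_less in \<open>auto intro!: cell_less\<close>)
  then show ?thesis using assms(2) by blast
qed

subsection \<open>Soundness\<close>

text \<open>The cells whose content is determined by the clauses at time \<open>t\<close>.\<close>

definition visible :: "nat \<Rightarrow> nat \<Rightarrow> int \<Rightarrow> bool" where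
  "visible t i h \<longleftrightarrow> i < K \<and> \<bar>h\<bar> \<le> int radius - int t \<or> i = K \<and> h = 0"

lemma visible_cells_step:
  assumes sat: "\<And>C. C \<in> tableau_clauses \<Longrightarrow> fulfils A C"
    and cells: "\<And>i h. visible t i h \<Longrightarrow> A (cell i (scan (run_config M z t) i h) t h)"
    and t: "t < T" and visible: "visible (Suc t) i h"
  shows "A (cell i (scan (run_config M z (Suc t)) i h) (Suc t) h)"
proof -
  let ?c = "run_config M z t"
  let ?e = "view M ?c"
  have wfc: "wf_config M ?c" by (rule wf_run_config[OF wf])
  note valid = valid_view_view[OF wfc]
  obtain s d where act: "view_act M ?e i = (s, d)" by (metis surj_pair)
  have "A (cell k (?e ! k) t 0)" if "k \<le> K" for k
    using cells[of k 0] that t by (cases "k = K") (simp_all add: nth_view visible_def)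
  then have view: "\<not> fulfils A (view_clause ?e t)" by (simp add: fulfils_view_clause)
  have i: "i \<le> K" using visible by (auto simp: visible_def)
  note step = scan_run_Suc[OF wf i act, of h]
  show ?thesis
  proof (cases "h + d = 0")
    case True
    then have "h = - d" by simp
    with sat[OF write_symbol[OF valid i t act]] view True show ?thesis unfolding step by simp
  next
    case False
    have "i \<noteq> K"
    proof
      assume "i = K"
      then have "h = 0" "d = 0" using visible act snd_view_act_state[of M ?e]
        by (simp_all add: visible_def)
      then show False using False by simp
    qed
    with i have less: "i < K" by simp
    then have vis: "visible t i (h + d)" and abs: "\<bar>h + d\<bar> \<le> int radius"
      using visible view_act_bounds[of M ?e i] act by (auto simp: visible_def)
    have "scan ?c i (h + d) < symbols M"
      using wfc less by (cases ?c) (auto simp: wf_config_def)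
    from sat[OF keep_symbol[OF valid less this t False abs]] view cells[OF vis] act
    show ?thesis using False unfolding step by simp
  qed
qed

lemma visible_cells:
  assumes "\<And>C. C \<in> tableau_clauses \<Longrightarrow> fulfils A C"
    and "\<And>i h. visible 0 i h \<Longrightarrow> A (cell i (scan (run_config M z 0) i h) 0 h)"
  shows "t \<le> T \<Longrightarrow> visible t i h \<Longrightarrow> A (cell i (scan (run_config M z t) i h) t h)"
proof (induction t arbitrary: i h)
  case (Suc t)
  then show ?case by (intro visible_cells_step[OF assms(1)]) auto
qed (use assms(2) in blast)

lemma input_cell_cases:
  obtains (before) "h < 0"
  | (mark) j where "h = 2 * int j" "j < length x"
  | (bit) j where "h = 2 * int j + 1" "j < length x"
  | (separator) "h = 2 * int (length x)"
  | (certificate) j where "h = cert_start + int j" "j < cert_bound"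
  | (after) "cert_start + int cert_bound \<le> h"
proof -
  let ?i = "nat (h div 2)" and ?j = "nat (h - cert_start)"
  have "h < 0 \<or> (h = 2 * int ?i \<or> h = 2 * int ?i + 1) \<and> ?i < length x \<or> h = 2 * int (length x) \<or>
      h = cert_start + int ?j \<and> ?j < cert_bound \<or> cert_start + int cert_bound \<le> h"
    by linarith
  then show ?thesis using that by blast
qed

lemma initial_cells:
  assumes sat: "\<And>C. C \<in> tableau_clauses \<Longrightarrow> fulfils A C"
    and y: "length y \<le> cert_bound"
    and cert: "\<And>j. j < cert_bound \<Longrightarrow> A (cell 0 (string_contents y (int j)) 0 (cert_start + int j))"
    and visible: "visible 0 i h"
  shows "A (cell i (scan (run_config M (encode_pair x y) 0) i h) 0 h)"
proof (cases "i = 0")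
  case False
  then show ?thesis
    using visible sat[OF blank_tape, of i h] sat[OF start_state] scan_initial[OF wf, of i]
    by (auto simp: visible_def)
next
  case True
  have h: "\<bar>h\<bar> \<le> int radius" using visible True tapes_ge by (auto simp: visible_def)
  have "A (cell 0 (string_contents (encode_pair x y) h) 0 h)"
  proof (cases h rule: input_cell_cases)
    case before
    then show ?thesis using sat[OF before_input, of h] h by (simp add: string_contents_outside)
  next
    case (mark j)
    then show ?thesis using sat[OF input_mark, of j] by (simp add: string_contents_encode_pair)
  next
    case (bit j)
    then show ?thesis using sat[OF input_bit, of j] by (simp add: string_contents_encode_pair)
  next
    case separator
    then show ?thesis
      using sat[OF tableau_clauses.separator] by (simp add: string_contents_encode_pair)
  next
    case (certificate j)
    then show ?thesis
      using cert[of j] string_contents_encode_pair(4)[of "int j" x y] by simp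
  next
    case after
    then have "string_contents (encode_pair x y) h = 0"
      using y by (intro string_contents_outside) (simp add: length_encode_pair)
    then show ?thesis using sat[OF after_input, of h] after h by simp
  qed
  then show ?thesis using scan_initial[OF wf, of 0] True by simp
qed

lemma tableau_sound:
  assumes sat: "\<And>C. C \<in> tableau_clauses \<Longrightarrow> fulfils A C"
  obtains y where "length y \<le> cert_bound" "accepts M (encode_pair x y) T"
proof -
  define B where "B j s \<longleftrightarrow> A (cell 0 s 0 (cert_start + int j))" for j s
  have "B j 0 \<or> B j 1 \<or> B j 2" "B j 0 \<Longrightarrow> B (Suc j) 0" if "j < cert_bound" for j
    using sat[OF guess[OF that]] sat[OF guess_end[OF that]] by (auto simp: B_def)
  then obtain y where y: "length y \<le> cert_bound"
    "\<And>j. j < cert_bound \<Longrightarrow> B j (string_contents y (int j))"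
    using ex_string_with_symbols[of cert_bound B] by blast
  let ?z = "encode_pair x y"
  have "A (cell i (scan (run_config M ?z 0) i h) 0 h)" if "visible 0 i h" for i h
    using initial_cells[OF sat y(1) _ that] y(2) unfolding B_def by blast
  note cells = visible_cells[OF sat this order_refl]
  have "scan (run_config M ?z T) 1 h \<noteq> 1" if h: "\<bar>h\<bar> \<le> int T" for h
    using cells[of 1 h] sat[OF accept[OF h]] h tapes_ge by (auto simp: visible_def)
  then show ?thesis using that y(1) unfolding accepts_def by blast
qed

subsection \<open>Completeness\<close>

definition run_assignment :: "bool list \<Rightarrow> nat \<Rightarrow> bool" where
  "run_assignment z v \<longleftrightarrow> (\<exists>i s t h. i \<le> K \<and> s < content_count \<and> t \<le> T \<and> \<bar>h\<bar> \<le> int radius + 1 \<and>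
     v = cell i s t h \<and> scan (run_config M z t) i h = s)"

lemma run_assignment_cell:
  assumes "i \<le> K" "s < content_count" "t \<le> T" "\<bar>h\<bar> \<le> int radius + 1"
  shows "run_assignment z (cell i s t h) \<longleftrightarrow> scan (run_config M z t) i h = s"
  unfolding run_assignment_def using cell_inj assms by blast

lemma view_of_run_assignment:
  assumes "valid_view M e" "t < T" "\<not> fulfils (run_assignment z) (view_clause e t)"
  shows "e = view M (run_config M z t)"
proof (rule nth_equalityI)
  show "length e = length (view M (run_config M z t))"
    using assms(1) by (simp add: valid_view_def view_def)
  fix k assume "k < length e"
  then have k: "k \<le> K" using assms(1) by (simp add: valid_view_def)
  then show "e ! k = view M (run_config M z t) ! k"
    using assms run_assignment_cell[of k "e ! k" t 0 z] nth_view_less[OF assms(1) k]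
    by (simp add: nth_view fulfils_view_clause)
qed

lemma run_assignment_fulfils_write:
  assumes "valid_view M e" "i \<le> K" "t < T" "view_act M e i = (s, d)"
  shows "fulfils (run_assignment z) (view_clause e t @ [(True, cell i s (t + 1) (- d))])"
proof (cases "fulfils (run_assignment z) (view_clause e t)")
  case False
  note e = view_of_run_assignment[OF assms(1,3) False]
  have "s < content_count" "\<bar>- d\<bar> \<le> int radius + 1"
    using view_act_less[OF assms(1,2)] view_act_bounds[of M e i] assms(4) by auto
  then have "run_assignment z (cell i s (Suc t) (- d))"
    using scan_run_Suc[OF wf assms(2) assms(4)[unfolded e], of "- d"] assms
    by (subst run_assignment_cell) auto
  then show ?thesis by simp
qed simp

lemma run_assignment_fulfils_keep:
  assumes "valid_view M e" "i < K" "s < symbols M" "t < T" "h \<noteq> 0" "\<bar>h\<bar> \<le> int radius"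
  shows "fulfils (run_assignment z) (view_clause e t @
    [(False, cell i s t h), (True, cell i s (t + 1) (h - snd (view_act M e i)))])"
proof (cases "fulfils (run_assignment z) (view_clause e t)")
  case False
  note e = view_of_run_assignment[OF assms(1,4) False]
  obtain s' d where act: "view_act M e i = (s', d)" by (metis surj_pair)
  have bounds: "i \<le> K" "s < content_count" "\<bar>h - d\<bar> \<le> int radius + 1"
    using view_act_bounds[of M e i] act assms less_content_count(1) by auto
  have "run_assignment z (cell i s (Suc t) (h - d))" if "run_assignment z (cell i s t h)"
    using scan_run_Suc[OF wf bounds(1) act[unfolded e], of "h - d"] that bounds assms
    by (simp add: run_assignment_cell)
  then show ?thesis by (auto simp: act)
qed simp

lemma tableau_complete:
  assumes y: "length y \<le> cert_bound" and acc: "accepts M (encode_pair x y) T"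
    and C: "C \<in> tableau_clauses"
  shows "fulfils (run_assignment (encode_pair x y)) C"
proof -
  let ?z = "encode_pair x y"
  have initial: "run_assignment ?z (cell i s 0 h) \<longleftrightarrow>
      (if i = 0 then string_contents ?z h else 0) = s"
    if "i \<le> K" "s < content_count" "\<bar>h\<bar> \<le> int radius + 1" for i s h
    using that scan_initial[OF wf that(1)] by (simp add: run_assignment_cell)
  note bounds = less_content_count cert_end_less tapes_ge
  from C show ?thesis
  proof cases
    case (write_symbol e i t s d)
    then show ?thesis using run_assignment_fulfils_write by blast
  next
    case (keep_symbol e i s t h)
    then show ?thesis using run_assignment_fulfils_keep by blast
  next
    case (after_input h)
    then have "string_contents ?z h = 0"
      using y by (intro string_contents_outside) (simp add: length_encode_pair)
    then show ?thesis using after_input bounds by (simp add: initial)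
  next
    case (guess j)
    then show ?thesis
      using bounds string_contents_encode_pair(4)[of "int j" x y]
        string_contents_range[of y "int j"]
      by (auto simp: initial)
  next
    case (guess_end j)
    have "run_assignment ?z (cell 0 0 0 (cert_start + int i)) \<longleftrightarrow> string_contents y (int i) = 0"
      if "i \<le> cert_bound" for i
      using that bounds string_contents_encode_pair(4)[of "int i" x y] by (subst initial) auto
    moreover have "string_contents y (int (Suc j)) = 0" if "string_contents y (int j) = 0"
      using that by (auto simp: string_contents_def split: if_splits)
    ultimately show ?thesis
      using guess_end by (cases "string_contents y (int j) = 0") (simp_all del: of_nat_Suc)
  next
    case (accept h)
    then show ?thesis using acc bounds
      by (auto simp: run_assignment_cell accepts_def)
  qed (use bounds in \<open>auto simp: initial string_contents_encode_pair string_contents_outside\<close>)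
qed

theorem satisfiable_tableau:
  "satisfiable (clauses x fams) \<longleftrightarrow> (\<exists>y. length y \<le> cert_bound \<and> accepts M (encode_pair x y) T)"
proof
  assume "satisfiable (clauses x fams)"
  then obtain A where "\<And>C. C \<in> tableau_clauses \<Longrightarrow> fulfils A C"
    unfolding satisfiable_def set_clauses_fams by blast
  from tableau_sound[OF this]
  show "\<exists>y. length y \<le> cert_bound \<and> accepts M (encode_pair x y) T" by blast
next
  assume "\<exists>y. length y \<le> cert_bound \<and> accepts M (encode_pair x y) T"
  then show "satisfiable (clauses x fams)"
    using tableau_complete unfolding satisfiable_def set_clauses_fams by blast
qed

end

sublocale cnf_families fams cell_count
proof unfold_locales
  show "family_ok fam" if "fam \<in> set fams" for fam using that by (rule fams_ok)
  show "exp_vars cell_count = {}" by simp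
  show "v < ceval x cell_count" if "C \<in> set (clauses x fams)" "(s, v) \<in> set C" for x C s v
    using that unfolding set_clauses_fams by (rule tableau_clauses_bounded)
qed

end

lemma poly_mono_nat: "a \<le> b \<Longrightarrow> poly p a \<le> poly p (b::nat)"
  by (induction p) (auto intro: mult_mono add_mono)

theorem cook_levin:
  assumes "in_NP L"
  obtains fams var_count where "cnf_families fams var_count"
    "\<And>x. x \<in> L \<longleftrightarrow> satisfiable (clauses x fams)"
proof -
  obtain R p where R: "polytime (\<lambda>z. [R z])"
    and L: "\<And>x. x \<in> L \<longleftrightarrow> (\<exists>y. length y \<le> poly p (length x) \<and> R (encode_pair x y))"
    using assms unfolding in_NP_def by blast
  obtain M q where wf: "wf_tm M" and run: "\<And>z. \<exists>n \<le> poly q (length z).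
      halts_with_output M ((tm_step M ^^ n) (initial_config M z)) [R z]"
    using R unfolding polytime_def by blast
  let ?time = "pcompose q ([:1, 2:] + p) + p + [:1, 2:]"
  obtain cert_exp time_exp
    where closed: "exp_vars cert_exp = {}" "exp_vars time_exp = {}"
      and cert: "\<And>x. ceval x cert_exp = poly p (length x)"
      and time: "\<And>x. ceval x time_exp = poly ?time (length x)"
    using ex_poly_exp[of p] ex_poly_exp[of ?time] by blast
  interpret tableau M time_exp cert_exp
  proof unfold_locales
    show "wf_tm M" by (rule wf)
    show "exp_vars time_exp = {}" "exp_vars cert_exp = {}" by (rule closed)+
    show "2 * length x + ceval x cert_exp < ceval x time_exp" for x
      unfolding cert time by simp
  qed
  have cert_bound: "cert_bound x = poly p (length x)" and T: "T x = poly ?time (length x)" for x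
    unfolding cert_bound_def T_def by (rule cert, rule time)
  have accepts: "accepts M (encode_pair x y) (T x) \<longleftrightarrow> R (encode_pair x y)"
    if "length y \<le> cert_bound x" for x y
  proof -
    let ?z = "encode_pair x y"
    have "length ?z \<le> poly ([:1, 2:] + p) (length x)"
      using that by (simp add: length_encode_pair cert_bound)
    from poly_mono_nat[OF this, of q] have "poly q (length ?z) \<le> T x"
      unfolding T by (simp add: poly_pcompose)
    moreover obtain n where "n \<le> poly q (length ?z)"
      "halts_with_output M ((tm_step M ^^ n) (initial_config M ?z)) [R ?z]"
      using run by blast
    ultimately show ?thesis using accepts_iff[OF wf] by simp
  qed
  have "x \<in> L \<longleftrightarrow> satisfiable (clauses x fams)" for x
    unfolding L satisfiable_tableau using accepts[of _ x] by (auto simp: cert_bound)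
  with cnf_families_axioms show ?thesis by (rule that)
qed

section \<open>Journeys\<close>

inductive journey :: "'v temporal_edge set \<Rightarrow> 'v \<Rightarrow> real \<Rightarrow> 'v \<Rightarrow> real \<Rightarrow> bool" for E where
  wait: "t \<le> t' \<Longrightarrow> journey E u t u t'"
| ride: "(u, w, s, d) \<in> E \<Longrightarrow> t \<le> s \<Longrightarrow> journey E w (s + d) v t' \<Longrightarrow> journey E u t v t'"

lemma journey_trans: "journey E u t v t' \<Longrightarrow> t' \<le> s \<Longrightarrow> journey E v s w s' \<Longrightarrow> journey E u t w s'"
proof (induction rule: journey.induct)
  case (wait t t' u)
  then have "t \<le> s" by simp
  from wait(3) show ?case
  proof cases
    case wait
    then show ?thesis using \<open>t \<le> s\<close> by (auto intro: journey.wait)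
  next
    case (ride w s' d)
    then show ?thesis using \<open>t \<le> s\<close> by (auto intro: journey.ride)
  qed
next
  case (ride u w s d t v t')
  then show ?case by (auto intro: journey.ride)
qed

lemma journey_edge: "(u, w, s, d) \<in> E \<Longrightarrow> journey E u s w (s + d)"
  by (auto intro: journey.intros)

lemma journey_invariant:
  assumes "journey E u t v t'" "I u t"
    and "\<And>u w s d t. (u, w, s, d) \<in> E \<Longrightarrow> t \<le> s \<Longrightarrow> I u t \<Longrightarrow> I w (s + d)"
  shows "\<exists>t. I v t"
  using assms by (induction rule: journey.induct) blast+

lemma journey_reverse:
  assumes "journey E u t v t'" "\<And>u w s d. (u, w, s, d) \<in> E \<Longrightarrow> (w, u, - (s + d), d) \<in> E"
  shows "journey E v (- t') u (- t)"
  using assms(1)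
proof (induction rule: journey.induct)
  case (wait t t' u)
  then show ?case by (auto intro: journey.wait)
next
  case (ride u w s d t v t')
  have "journey E w (- (s + d)) u (- s)" using journey_edge[OF assms(2)[OF ride(1)]] by simp
  moreover have "journey E u (- s) u (- t)" using ride(2) by (auto intro: journey.wait)
  ultimately have "journey E w (- (s + d)) u (- t)" by (metis journey_trans order_refl)
  with ride.IH show ?case by (metis journey_trans order_refl)
qed

definition connects :: "'v temporal_edge set \<Rightarrow> 'v \<Rightarrow> 'v \<Rightarrow> bool" where
  "connects E u v \<longleftrightarrow> (\<exists>t t'. journey E u t v t')"

lemma journey_temporal_path:
  "journey E u t v t' \<Longrightarrow>
    \<exists>p. temporal_path E u p v \<and> (case p of [] \<Rightarrow> True | (a, b, s, d) # _ \<Rightarrow> t \<le> s)"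
proof (induction rule: journey.induct)
  case (wait t t' u)
  then show ?case by (intro exI[of _ "[]"]) simp
next
  case (ride u w s d t v t')
  then obtain p where "temporal_path E w p v"
    "case p of [] \<Rightarrow> True | (a, b, s', d') # _ \<Rightarrow> s + d \<le> s'" by blast
  then show ?case using ride(1,2) by (intro exI[of _ "(u, w, s, d) # p"]) (auto split: list.splits)
qed

lemma temporal_path_journey:
  "temporal_path E u p v \<Longrightarrow> (case p of [] \<Rightarrow> True | (a, b, s, d) # _ \<Rightarrow> t \<le> s) \<Longrightarrow>
    \<exists>t'. journey E u t v t'"
proof (induction p arbitrary: u t)
  case Nil
  then show ?case by (auto intro: journey.wait)
next
  case (Cons e p)
  obtain a b s d where e: "e = (a, b, s, d)" by (metis surj_pair)
  have "\<exists>t'. journey E b (s + d) v t'"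
    using Cons.prems by (intro Cons.IH) (auto simp: e split: list.splits)
  then show ?case using Cons.prems by (auto simp: e intro: journey.ride)
qed

lemma connects_iff_temporal_path: "connects E u v \<longleftrightarrow> (\<exists>p. temporal_path E u p v)"
proof
  assume "\<exists>p. temporal_path E u p v"
  then obtain p where p: "temporal_path E u p v" ..
  show "connects E u v"
  proof (cases p)
    case Nil
    then show ?thesis using temporal_path_journey[OF p, of 0] by (auto simp: connects_def)
  next
    case (Cons e p')
    obtain a b s d where "e = (a, b, s, d)" by (metis surj_pair)
    then show ?thesis using Cons temporal_path_journey[OF p, of s] by (auto simp: connects_def)
  qed
qed (auto simp: connects_def dest: journey_temporal_path)

definition map_edges :: "('a \<Rightarrow> 'b) \<Rightarrow> 'a temporal_edge set \<Rightarrow> 'b temporal_edge set" where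
  "map_edges g E = (\<lambda>(u, v, s, d). (g u, g v, s, d)) ` E"

lemma journey_map: "journey E u t v t' \<Longrightarrow> journey (map_edges g E) (g u) t (g v) t'"
  by (induction rule: journey.induct) (force intro: journey.intros simp: map_edges_def)+

lemma journey_unmap:
  assumes "journey (map_edges g E) x t y t'" "inj_on g V" "x = g u" "y = g v" "u \<in> V" "v \<in> V"
    and "\<And>a b s d. (a, b, s, d) \<in> E \<Longrightarrow> a \<in> V \<and> b \<in> V"
  shows "journey E u t v t'"
  using assms(1,3,4,5)
proof (induction arbitrary: u rule: journey.induct)
  case (wait t t' x)
  then show ?case using assms by (auto dest: inj_onD intro: journey.wait)
next
  case (ride x w s d t y t')
  then obtain a b where ab: "(a, b, s, d) \<in> E" "x = g a" "w = g b" by (auto simp: map_edges_def)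
  then have "a = u" "b \<in> V" using assms ride by (auto dest!: inj_onD)
  then show ?case using ride ab by (auto intro: journey.ride)
qed

lemma connects_map:
  assumes "inj_on g V" "u \<in> V" "v \<in> V" "\<And>a b s d. (a, b, s, d) \<in> E \<Longrightarrow> a \<in> V \<and> b \<in> V"
  shows "connects (map_edges g E) (g u) (g v) \<longleftrightarrow> connects E u v"
  unfolding connects_def
  using journey_map[of E u _ v _ g] journey_unmap[OF _ assms(1) refl refl assms(2,3), of E] assms(4)
  by blast

definition connected_pairs :: "'v set \<Rightarrow> 'v temporal_edge set \<Rightarrow> ('v \<times> 'v) set" where
  "connected_pairs V E = {(u, v). u \<in> V \<and> v \<in> V \<and> connects E u v}"

lemma card_connected_pairs_map:
  assumes "inj_on g V" "\<And>a b s d. (a, b, s, d) \<in> E \<Longrightarrow> a \<in> V \<and> b \<in> V"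
  shows "card (connected_pairs (g ` V) (map_edges g E)) = card (connected_pairs V E)"
proof -
  have "connected_pairs (g ` V) (map_edges g E) = map_prod g g ` connected_pairs V E"
    using connects_map[OF assms(1) _ _ assms(2)] by (auto simp: connected_pairs_def image_iff)
  moreover have "inj_on (map_prod g g) (connected_pairs V E)"
    using assms(1) by (auto simp: inj_on_def connected_pairs_def)
  ultimately show ?thesis by (simp add: card_image)
qed

section \<open>Networks of routes\<close>

text \<open>A walk \<open>pos 0, \<dots>, pos len\<close> where \<open>cum i\<close> is the total weight of its first \<open>i\<close> edges.\<close>

datatype 'a route = Route (pos: "nat \<Rightarrow> 'a") (cum: "nat \<Rightarrow> nat") (len: nat)

definition wf_route :: "'a set \<Rightarrow> 'a route \<Rightarrow> bool" where
  "wf_route V r \<longleftrightarrow> 0 < len r \<and> cum r 0 = 0 \<and> (\<forall>i < len r. cum r i < cum r (Suc i)) \<and>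
    (\<forall>i \<le> len r. pos r i \<in> V)"

lemma cum_mono:
  assumes "wf_route V r" "i \<le> j" "j \<le> len r"
  shows "cum r i \<le> cum r j"
  using assms(2,3)
proof (induction j rule: dec_induct)
  case (step j)
  then have "cum r j < cum r (Suc j)" using assms(1) by (simp add: wf_route_def)
  with step show ?case by simp
qed simp

definition route_arcs :: "('a \<Rightarrow> nat) \<Rightarrow> 'a route \<Rightarrow> (nat \<times> nat \<times> nat) list" where
  "route_arcs code r =
    map (\<lambda>i. (code (pos r i), code (pos r (Suc i)), cum r (Suc i) - cum r i)) [0..<len r]"

fun consecutive :: "nat \<Rightarrow> nat list \<Rightarrow> nat list list" where
  "consecutive s [] = []"
| "consecutive s (l # ls) = [s..<s + l] # consecutive (s + l) ls"

definition route_input :: "('a \<Rightarrow> nat) \<Rightarrow> nat \<Rightarrow> 'a route list \<Rightarrow> mrtt_input" where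
  "route_input code n rs =
    (n, map (\<lambda>(u, v, w). (u, v, of_nat w)) (concat (map (route_arcs code) rs)),
      consecutive 0 (map len rs))"

definition route_edges :: "'a route list \<Rightarrow> (nat \<Rightarrow> real) \<Rightarrow> 'a temporal_edge set" where
  "route_edges rs \<tau> =
    {(pos r i, pos r (Suc i), \<tau> j + real (cum r i), real (cum r (Suc i)) - real (cum r i)) | j r i.
       j < length rs \<and> r = rs ! j \<and> i < len r}"

lemma journey_along_route:
  assumes "k < length rs" "r = rs ! k" "i \<le> j" "j \<le> len r"
  shows "journey (route_edges rs \<tau>) (pos r i) (\<tau> k + cum r i) (pos r j) (\<tau> k + cum r j)"
  using assms(3,4)
proof (induction j rule: dec_induct)
  case base
  show ?case by (rule journey.wait) simp
next
  case (step j)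
  then have "j < len r" by simp
  then have "(pos r j, pos r (Suc j), \<tau> k + real (cum r j), real (cum r (Suc j)) - real (cum r j))
      \<in> route_edges rs \<tau>"
    unfolding route_edges_def using assms(1,2) by blast
  from journey_trans[OF step.IH _ journey_edge[OF this]] show ?case using step.prems by simp
qed

lemma length_consecutive [simp]: "length (consecutive s ls) = length ls"
  by (induction s ls rule: consecutive.induct) auto

lemma nth_consecutive:
  "k < length ls \<Longrightarrow> consecutive s ls ! k =
    [s + sum_list (take k ls)..<s + sum_list (take k ls) + ls ! k]"
proof (induction s ls arbitrary: k rule: consecutive.induct)
  case (2 s l ls)
  then show ?case by (cases k) (auto simp: add.assoc)
qed simp

lemma nth_concat_offset:
  assumes "k < length xss" "i < length (xss ! k)"
  shows "sum_list (take k (map length xss)) + i < length (concat xss) \<and>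
    concat xss ! (sum_list (take k (map length xss)) + i) = xss ! k ! i"
  using assms
proof (induction xss arbitrary: k)
  case (Cons xs xss)
  then show ?case by (cases k) (auto simp: nth_append)
qed simp

lemma concat_index_cases:
  assumes "e < length (concat xss)"
  shows "\<exists>k i. k < length xss \<and> i < length (xss ! k) \<and> e = sum_list (take k (map length xss)) + i"
  using assms
proof (induction xss arbitrary: e)
  case (Cons xs xss)
  show ?case
  proof (cases "e < length xs")
    case True
    then show ?thesis by (intro exI[of _ 0] exI[of _ e]) auto
  next
    case False
    then have "e - length xs < length (concat xss)" using Cons.prems by auto
    then obtain k i where "k < length xss" "i < length (xss ! k)"
      "e - length xs = sum_list (take k (map length xss)) + i"
      using Cons.IH by blast
    then show ?thesis using False by (intro exI[of _ "Suc k"] exI[of _ i]) auto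
  qed
qed simp

lemma (in wf_digraph) awalk_map:
  assumes "\<And>i. i < l \<Longrightarrow> g i \<in> arcs G \<and> tail G (g i) = p i \<and> head G (g i) = p (Suc i)"
    and "p 0 \<in> verts G"
  shows "awalk (p 0) (map g [0..<l]) (p l) \<and>
    awalk_verts (p 0) (map g [0..<l]) = map p [0..<Suc l]"
  using assms
proof (induction l arbitrary: g p)
  case 0
  then show ?case by (auto simp: awalk_def)
next
  case (Suc l)
  have "p (Suc 0) \<in> verts G" using Suc.prems(1)[of 0] head_in_verts[of "g 0"] by auto
  moreover have "g (Suc i) \<in> arcs G \<and> tail G (g (Suc i)) = p (Suc i) \<and>
      head G (g (Suc i)) = p (Suc (Suc i))" if "i < l" for i
    using Suc.prems(1)[of "Suc i"] that by auto
  ultimately have IH: "awalk (p (Suc 0)) (map (g \<circ> Suc) [0..<l]) (p (Suc l)) \<and>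
     awalk_verts (p (Suc 0)) (map (g \<circ> Suc) [0..<l]) = map (p \<circ> Suc) [0..<Suc l]"
    using Suc.IH[of "g \<circ> Suc" "p \<circ> Suc"] by (simp add: comp_def)
  have split: "map h [0..<Suc n] = h 0 # map (h \<circ> Suc) [0..<n]" for h :: "nat \<Rightarrow> 'z" and n
    by (metis map_map map_Suc_upt upt_conv_Cons zero_less_Suc list.simps(9))
  show ?case
    unfolding split[of g l] split[of p "Suc l"]
    using IH Suc.prems(1)[of 0] Suc.prems(2) by (auto simp: awalk_def)
qed

locale route_system =
  fixes code :: "'a \<Rightarrow> nat" and V :: "'a set" and rs :: "'a route list" and n :: nat
  assumes code_bij: "bij_betw code V {..<n}"
    and wf_routes: "r \<in> set rs \<Longrightarrow> wf_route V r"
    and covered: "v \<in> V \<Longrightarrow> \<exists>r \<in> set rs. \<exists>i \<le> len r. pos r i = v"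
begin

abbreviation N :: mrtt_input where "N \<equiv> route_input code n rs"
abbreviation D :: "(nat, nat) pre_digraph" where "D \<equiv> input_digraph N"
abbreviation weight :: "nat \<Rightarrow> real" where "weight \<equiv> input_weight N"
abbreviation trips :: "nat list list" where "trips \<equiv> input_trips N"

definition trip_arc :: "nat \<Rightarrow> nat \<Rightarrow> nat" where
  "trip_arc j i = sum_list (take j (map len rs)) + i"

lemma wf_nth: "j < length rs \<Longrightarrow> wf_route V (rs ! j)"
  by (simp add: wf_routes)

lemma verts_D: "verts D = {..<n}"
  by (simp add: route_input_def)

lemma code_in_verts: "v \<in> V \<Longrightarrow> code v \<in> verts D"
  using code_bij unfolding verts_D bij_betw_def by blast

lemma pos_in_verts: "j < length rs \<Longrightarrow> i \<le> len (rs ! j) \<Longrightarrow> code (pos (rs ! j) i) \<in> verts D"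
  using wf_nth code_in_verts by (auto simp: wf_route_def)

lemma length_trips: "length trips = length rs"
  by (simp add: route_input_def)

lemma nth_trips: "j < length rs \<Longrightarrow> trips ! j = map (trip_arc j) [0..<len (rs ! j)]"
  by (rule nth_equalityI) (simp_all add: route_input_def nth_consecutive trip_arc_def)

lemma arc_props:
  assumes "j < length rs" "r = rs ! j" "i < len r"
  shows "trip_arc j i \<in> arcs D" "tail D (trip_arc j i) = code (pos r i)"
    "head D (trip_arc j i) = code (pos r (Suc i))"
    "weight (trip_arc j i) = real (cum r (Suc i)) - real (cum r i)"
proof -
  let ?U = "map (route_arcs code) rs"
  have lens: "map length ?U = map len rs" by (simp add: route_arcs_def comp_def)
  have "trip_arc j i < length (concat ?U) \<and> concat ?U ! trip_arc j i = ?U ! j ! i"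
    using nth_concat_offset[of j ?U i] assms unfolding trip_arc_def lens
    by (simp add: route_arcs_def)
  then have "trip_arc j i < length (concat ?U)"
    "concat ?U ! trip_arc j i = (code (pos r i), code (pos r (Suc i)), cum r (Suc i) - cum r i)"
    using assms by (simp_all add: route_arcs_def)
  moreover have "cum r i \<le> cum r (Suc i)" using wf_nth assms by (simp add: wf_route_def less_imp_le)
  ultimately show "trip_arc j i \<in> arcs D" "tail D (trip_arc j i) = code (pos r i)"
    "head D (trip_arc j i) = code (pos r (Suc i))"
    "weight (trip_arc j i) = real (cum r (Suc i)) - real (cum r i)"
    by (simp_all add: route_input_def of_nat_diff of_rat_diff)
qed

lemma arc_cases:
  assumes "e \<in> arcs D"
  obtains j i where "j < length rs" "i < len (rs ! j)" "e = trip_arc j i"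
proof -
  let ?U = "map (route_arcs code) rs"
  have lens: "map length ?U = map len rs" by (simp add: route_arcs_def comp_def)
  have "e < length (concat ?U)" using assms by (simp add: route_input_def)
  then show ?thesis
    using that concat_index_cases[of e ?U] unfolding lens trip_arc_def
    by (auto simp: route_arcs_def)
qed

sublocale fin_digraph D
proof
  show "finite (verts D)" "finite (arcs D)" by (simp_all add: route_input_def)
next
  fix e assume "e \<in> arcs D"
  then obtain j i where "j < length rs" "i < len (rs ! j)" "e = trip_arc j i" by (rule arc_cases)
  then show "tail D e \<in> verts D" "head D e \<in> verts D"
    using arc_props[of j _ i] pos_in_verts[of j] by simp_all
qed

lemma awalk_trip:
  assumes "j < length rs" "r = rs ! j"
  shows "awalk (code (pos r 0)) (trips ! j) (code (pos r (len r))) \<and>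
    awalk_verts (code (pos r 0)) (trips ! j) = map (\<lambda>i. code (pos r i)) [0..<Suc (len r)]"
  unfolding nth_trips[OF assms(1)] assms(2)[symmetric]
  using arc_props[OF assms] pos_in_verts[OF assms(1)] assms(2)
  by (intro awalk_map[where p = "\<lambda>i. code (pos r i)"]) auto

lemma trip_nodes_trip:
  assumes "j < length rs" "r = rs ! j"
  shows "trip_nodes D (trips ! j) = map (\<lambda>i. code (pos r i)) [0..<Suc (len r)]"
proof -
  have len: "0 < len r" using wf_nth assms by (simp add: wf_route_def)
  then have "hd (trips ! j) = trip_arc j 0"
    using assms by (simp add: nth_trips hd_map upt_conv_Cons)
  then have "tail D (hd (trips ! j)) = code (pos r 0)" using arc_props(2)[OF assms len] by simp
  then show ?thesis using awalk_trip[OF assms] by (simp add: trip_nodes_def)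
qed

lemma trip_network_routes: "trip_network D weight trips"
proof
  fix e assume "e \<in> arcs D"
  then obtain j i where ji: "j < length rs" "i < len (rs ! j)" "e = trip_arc j i"
    by (rule arc_cases)
  then show "0 < weight e" using arc_props(4)[of j _ i] wf_nth[of j] by (simp add: wf_route_def)
  have "e \<in> set (trips ! j)" using ji by (simp add: nth_trips)
  then show "\<exists>T \<in> set trips. e \<in> set T" using ji(1) length_trips nth_mem by metis
next
  fix T assume "T \<in> set trips"
  then obtain j where j: "j < length rs" "T = trips ! j" by (metis in_set_conv_nth length_trips)
  then show "T \<noteq> []" using wf_nth[of j] by (simp add: nth_trips wf_route_def)
  show "\<exists>u v. awalk u T v" using awalk_trip[of j] j by blast
next
  fix v assume "v \<in> verts D"
  then have "v \<in> code ` V" using code_bij by (simp add: verts_D bij_betw_def)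
  then obtain a where a: "a \<in> V" "v = code a" by blast
  then obtain r i where r: "r \<in> set rs" "i \<le> len r" "pos r i = a" using covered by blast
  then obtain j where j: "j < length rs" "r = rs ! j" by (metis in_set_conv_nth)
  then have "v \<in> set (trip_nodes D (trips ! j))"
    unfolding trip_nodes_trip[OF j] using r a by (auto simp del: upt_Suc)
  then show "\<exists>T \<in> set trips. v \<in> set (trip_nodes D T)" using j(1) length_trips nth_mem by metis
qed

lemma route_reachable:
  assumes "j < length rs" "r = rs ! j" "i \<le> k" "k \<le> len r"
  shows "code (pos r i) \<rightarrow>\<^sup>*\<^bsub>D\<^esub> code (pos r k)"
  using assms(3,4)
proof (induction k rule: dec_induct)
  case base
  then show ?case using pos_in_verts[of j i] assms by simp
next
  case (step k)
  then have "code (pos r k) \<rightarrow>\<^bsub>D\<^esub> code (pos r (Suc k))"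
    using in_arcs_imp_in_arcs_ends[OF arc_props(1)[OF assms(1,2), of k]]
      arc_props(2,3)[OF assms(1,2), of k] by simp
  with step show ?case by (auto intro: reachable_adj_trans)
qed

lemma trip_temporal_edge:
  assumes "j < length rs" "r = rs ! j" "i < len r"
  shows "(tail D (trips ! j ! i), head D (trips ! j ! i),
      t + (\<Sum>l<i. weight (trips ! j ! l)), weight (trips ! j ! i)) =
    (code (pos r i), code (pos r (Suc i)), t + real (cum r i),
      real (cum r (Suc i)) - real (cum r i))"
proof -
  have nth: "trips ! j ! l = trip_arc j l" if "l < len r" for l
    using that assms by (simp add: nth_trips)
  have "(\<Sum>l<i. weight (trips ! j ! l)) = (\<Sum>l<i. real (cum r (Suc l)) - real (cum r l))"
    using assms(3) by (intro sum.cong refl) (simp add: nth arc_props(4)[OF assms(1,2)])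
  also have "\<dots> = real (cum r i)"
    using sum_lessThan_telescope[of "\<lambda>l. real (cum r l)" i] wf_nth[OF assms(1)] assms(2)
    by (simp add: wf_route_def)
  finally show ?thesis using arc_props[OF assms] nth[OF assms(3)] by simp
qed

lemma temporal_edges_routes:
  "temporal_edges D weight trips \<tau> = map_edges code (route_edges rs \<tau>)"
proof -
  have lens: "length (trips ! j) = len (rs ! j)" if "j < length rs" for j
    using that by (simp add: nth_trips)
  let ?edge = "\<lambda>j i. (code (pos (rs ! j) i), code (pos (rs ! j) (Suc i)),
    \<tau> j + real (cum (rs ! j) i), real (cum (rs ! j) (Suc i)) - real (cum (rs ! j) i))"
  have "e \<in> temporal_edges D weight trips \<tau> \<longleftrightarrow>
      (\<exists>j i. j < length rs \<and> i < len (rs ! j) \<and> e = ?edge j i)"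
    for e
    unfolding temporal_edges_def mem_Collect_eq length_trips
    using lens trip_temporal_edge[OF _ refl] by metis
  moreover have "e \<in> map_edges code (route_edges rs \<tau>) \<longleftrightarrow>
      (\<exists>j i. j < length rs \<and> i < len (rs ! j) \<and> e = ?edge j i)" for e
    unfolding map_edges_def route_edges_def image_iff by fastforce
  ultimately show ?thesis by blast
qed

lemma route_edges_in_V: "(u, v, s, d) \<in> route_edges rs \<tau> \<Longrightarrow> u \<in> V \<and> v \<in> V"
  using wf_nth by (auto simp: route_edges_def wf_route_def)

lemma reachability_routes:
  "reachability D weight trips \<tau> = card (connected_pairs V (route_edges rs \<tau>))"
proof -
  have inj: "inj_on code V" and image: "verts D = code ` V"
    using code_bij by (auto simp: bij_betw_def verts_D)
  have "reachability D weight trips \<tau> =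
      card (connected_pairs (code ` V) (map_edges code (route_edges rs \<tau>)))"
    unfolding reachability_def temporal_edges_routes connects_iff_temporal_path[symmetric]
      connected_pairs_def image ..
  then show ?thesis using card_connected_pairs_map[OF inj route_edges_in_V] by simp
qed

end

subsection \<open>Routes in both directions\<close>

definition rev_route :: "'a route \<Rightarrow> 'a route" where
  "rev_route r =
    Route (\<lambda>i. pos r (len r - i)) (\<lambda>i. cum r (len r) - cum r (len r - i)) (len r)"

lemma rev_route_sel [simp]:
  "pos (rev_route r) i = pos r (len r - i)"
  "cum (rev_route r) i = cum r (len r) - cum r (len r - i)"
  "len (rev_route r) = len r"
  by (simp_all add: rev_route_def)

lemma wf_rev_route:
  assumes "wf_route V r"
  shows "wf_route V (rev_route r)"
proof -
  have "cum r (len r) - cum r (len r - i) < cum r (len r) - cum r (len r - Suc i)"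
    if "i < len r" for i
  proof -
    have "cum r (len r - Suc i) < cum r (len r - i)"
      using assms that unfolding wf_route_def
      by (auto dest!: spec[of _ "len r - Suc i"] simp: Suc_diff_Suc)
    moreover have "cum r (len r - i) \<le> cum r (len r)" using cum_mono[OF assms] by simp
    ultimately show ?thesis by simp
  qed
  then show ?thesis using assms by (simp add: wf_route_def)
qed

lemma route_arcs_rev_route:
  assumes "wf_route V r"
  shows "route_arcs code (rev_route r) = rev (map (\<lambda>(u, v, w). (v, u, w)) (route_arcs code r))"
proof (rule nth_equalityI)
  fix i assume "i < length (route_arcs code (rev_route r))"
  then have i: "i < len r" by (simp add: route_arcs_def)
  then have "Suc (len r - Suc i) = len r - i" "len r - Suc i < len r" by simp_all
  moreover have "cum r (len r - i) \<le> cum r (len r)" "cum r (len r - Suc i) \<le> cum r (len r)"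
    using cum_mono[OF assms] by simp_all
  ultimately show "route_arcs code (rev_route r) ! i =
      rev (map (\<lambda>(u, v, w). (v, u, w)) (route_arcs code r)) ! i"
    using i by (simp add: route_arcs_def rev_nth)
qed (simp add: route_arcs_def)

definition both_ways :: "'a route list \<Rightarrow> 'a route list" where
  "both_ways rs = concat (map (\<lambda>r. [r, rev_route r]) rs)"

lemma length_both_ways [simp]: "length (both_ways rs) = 2 * length rs"
  by (induction rs) (simp_all add: both_ways_def)

lemma nth_both_ways:
  "k < length rs \<Longrightarrow>
    both_ways rs ! (2 * k) = rs ! k \<and> both_ways rs ! Suc (2 * k) = rev_route (rs ! k)"
proof (induction rs arbitrary: k)
  case (Cons r rs)
  then show ?case by (cases k) (simp_all add: both_ways_def)
qed simp

lemma set_both_ways: "set (both_ways rs) = set rs \<union> rev_route ` set rs"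
  by (auto simp: both_ways_def)

lemma both_ways_edge_cases:
  assumes "(u, w, s, d) \<in> route_edges (both_ways rs) \<tau>" "\<And>r. r \<in> set rs \<Longrightarrow> wf_route V r"
  obtains k r i where "k < length rs" "r = rs ! k" "i < len r"
    "d = real (cum r (Suc i)) - real (cum r i)"
    "u = pos r i \<and> w = pos r (Suc i) \<and> s = \<tau> (2 * k) + real (cum r i) \<or>
     u = pos r (Suc i) \<and> w = pos r i \<and>
       s = \<tau> (Suc (2 * k)) + real (cum r (len r)) - real (cum r (Suc i))"
proof -
  obtain j q i where j: "j < 2 * length rs" "q = both_ways rs ! j" "i < len q"
    and d: "d = real (cum q (Suc i)) - real (cum q i)"
    and ends: "u = pos q i" "w = pos q (Suc i)" "s = \<tau> j + real (cum q i)"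
    using assms(1) by (auto simp: route_edges_def)
  define k where "k = j div 2"
  have k: "k < length rs" using j(1) by (simp add: k_def)
  consider (forward) "j = 2 * k" | (backward) "j = Suc (2 * k)" unfolding k_def by linarith
  then show ?thesis
  proof cases
    case forward
    then show ?thesis using that[of k q i] j k d ends by (simp add: nth_both_ways)
  next
    case backward
    let ?r = "rs ! k"
    have q: "q = rev_route ?r" using backward j k by (simp add: nth_both_ways)
    then have i: "i < len ?r" "Suc (len ?r - Suc i) = len ?r - i" using j(3) by simp_all
    have "cum ?r (len ?r - i) \<le> cum ?r (len ?r)" "cum ?r (len ?r - Suc i) \<le> cum ?r (len ?r)"
      using cum_mono[OF assms(2), of ?r] k by simp_all
    then show ?thesis
      using that[of k ?r "len ?r - Suc i"] i k d ends backward by (simp add: q of_nat_diff)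
  qed
qed

lemma both_ways_edgeI:
  assumes "k < length rs" "r = rs ! k" "i < len r" "wf_route V r"
  shows "(pos r i, pos r (Suc i), \<tau> (2 * k) + real (cum r i), real (cum r (Suc i)) - real (cum r i))
      \<in> route_edges (both_ways rs) \<tau>"
    and "(pos r (Suc i), pos r i,
      \<tau> (Suc (2 * k)) + real (cum r (len r)) - real (cum r (Suc i)),
      real (cum r (Suc i)) - real (cum r i)) \<in> route_edges (both_ways rs) \<tau>"
proof -
  have edge: "(pos q i, pos q (Suc i), \<tau> j + real (cum q i), real (cum q (Suc i)) - real (cum q i))
      \<in> route_edges (both_ways rs) \<tau>"
    if "j < 2 * length rs" "q = both_ways rs ! j" "i < len q" for j q i
    using that unfolding route_edges_def length_both_ways by blast
  show "(pos r i, pos r (Suc i), \<tau> (2 * k) + real (cum r i), real (cum r (Suc i)) - real (cum r i))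
      \<in> route_edges (both_ways rs) \<tau>"
    using edge[of "2 * k" r i] assms by (simp add: nth_both_ways)
  have "cum r i \<le> cum r (len r)" "cum r (Suc i) \<le> cum r (len r)"
    using cum_mono[OF assms(4)] assms(3) by simp_all
  moreover have "len r - (len r - Suc i) = Suc i" "Suc (len r - Suc i) = len r - i"
    "len r - (len r - i) = i" using assms(3) by simp_all
  ultimately show "(pos r (Suc i), pos r i,
      \<tau> (Suc (2 * k)) + real (cum r (len r)) - real (cum r (Suc i)),
      real (cum r (Suc i)) - real (cum r i)) \<in> route_edges (both_ways rs) \<tau>"
    using edge[of "Suc (2 * k)" "rev_route r" "len r - Suc i"] assms
    by (simp add: nth_both_ways of_nat_diff add_diff_eq)
qed

text \<open>
  The timetable in which the trip along the \<open>k\<close>-th route passes \<open>pos i\<close> at time \<open>f k + cum i\<close> and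
  the reverse trip at the opposite time, so that every journey can be reversed.
\<close>

definition mirrored :: "'a route list \<Rightarrow> (nat \<Rightarrow> real) \<Rightarrow> nat \<Rightarrow> real" where
  "mirrored rs f j = (let k = j div 2; r = rs ! k in
    if even j then f k else - f k - real (cum r (len r)))"

lemma mirrored_simps:
  "mirrored rs f (2 * k) = f k"
  "mirrored rs f (Suc (2 * k)) = - f k - real (cum (rs ! k) (len (rs ! k)))"
  by (simp_all add: mirrored_def Let_def)

lemma mirrored_journey_reverse:
  assumes "journey (route_edges (both_ways rs) (mirrored rs f)) u t v t'"
    and "\<And>r. r \<in> set rs \<Longrightarrow> wf_route V r"
  shows "journey (route_edges (both_ways rs) (mirrored rs f)) v (- t') u (- t)"
proof (rule journey_reverse[OF assms(1)])
  let ?\<tau> = "mirrored rs f"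
  fix u w s d assume "(u, w, s, d) \<in> route_edges (both_ways rs) ?\<tau>"
  then obtain k r i where k: "k < length rs" "r = rs ! k" "i < len r"
    and d: "d = real (cum r (Suc i)) - real (cum r i)"
    and edge: "u = pos r i \<and> w = pos r (Suc i) \<and> s = ?\<tau> (2 * k) + real (cum r i) \<or>
      u = pos r (Suc i) \<and> w = pos r i \<and>
        s = ?\<tau> (Suc (2 * k)) + real (cum r (len r)) - real (cum r (Suc i))"
    by (rule both_ways_edge_cases) (rule assms(2))
  have "wf_route V r" using k assms(2) by simp
  from both_ways_edgeI[OF k this, of ?\<tau>] edge
  show "(w, u, - (s + d), d) \<in> route_edges (both_ways rs) ?\<tau>"
    unfolding d mirrored_simps by (auto simp: k(2) algebra_simps)
qed

lemma mirrored_journey: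
  assumes "k < length rs" "r = rs ! k" "i \<le> j" "j \<le> len r"
  shows "journey (route_edges (both_ways rs) (mirrored rs f))
    (pos r i) (f k + cum r i) (pos r j) (f k + cum r j)"
  using journey_along_route[of "2 * k" "both_ways rs" r i j "mirrored rs f"] assms
  by (simp add: nth_both_ways mirrored_simps)

locale symmetric_routes =
  fixes code :: "'a \<Rightarrow> nat" and V :: "'a set" and routes :: "'a route list" and n :: nat
  assumes code_bij: "bij_betw code V {..<n}"
    and wf_routes: "r \<in> set routes \<Longrightarrow> wf_route V r"
    and covered: "v \<in> V \<Longrightarrow> \<exists>r \<in> set routes. \<exists>i \<le> len r. pos r i = v"
begin

sublocale directed: route_system code V "both_ways routes" n
proof
  show "wf_route V r" if "r \<in> set (both_ways routes)" for r
    using that wf_routes wf_rev_route by (auto simp: set_both_ways)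
  show "\<exists>r \<in> set (both_ways routes). \<exists>i \<le> len r. pos r i = v" if "v \<in> V" for v
    using covered[OF that] by (auto simp: set_both_ways)
qed (rule code_bij)

lemma trip_nodes_rev:
  assumes "k < length routes"
  shows "trip_nodes directed.D (directed.trips ! Suc (2 * k)) =
    rev (trip_nodes directed.D (directed.trips ! (2 * k)))"
proof -
  have "map (\<lambda>i. code (pos r (len r - i))) [0..<Suc (len r)] =
      rev (map (\<lambda>i. code (pos r i)) [0..<Suc (len r)])" for r
    by (rule nth_equalityI) (auto simp: rev_nth simp del: upt_Suc)
  then show ?thesis
    using assms directed.trip_nodes_trip[of "2 * k"] directed.trip_nodes_trip[of "Suc (2 * k)"]
    by (simp add: nth_both_ways del: upt_Suc)
qed

lemma symmetric_trips_routes: "symmetric_trips directed.D directed.trips"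
proof -
  define partner :: "nat \<Rightarrow> nat" where "partner i = (if even i then Suc i else i - 1)" for i
  have "partner i < length directed.trips \<and> partner i \<noteq> i \<and> partner (partner i) = i \<and>
    trip_nodes directed.D (directed.trips ! partner i) =
      rev (trip_nodes directed.D (directed.trips ! i))" if "i < length directed.trips" for i
  proof -
    have "i div 2 < length routes" using that by (simp add: directed.length_trips)
    moreover have "i = 2 * (i div 2) \<or> i = Suc (2 * (i div 2))" by linarith
    ultimately obtain k where "k < length routes" "i = 2 * k \<or> i = Suc (2 * k)" by metis
    then show ?thesis
      using trip_nodes_rev[of k] by (auto simp: partner_def directed.length_trips)
  qed
  then show ?thesis unfolding symmetric_trips_def by blast
qed

definition on_same_route :: "'a rel" where
  "on_same_route = {(pos r i, pos r j) | r i j. r \<in> set routes \<and> i \<le> len r \<and> j \<le> len r}"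

lemma on_same_routeI:
  "r \<in> set routes \<Longrightarrow> i \<le> len r \<Longrightarrow> j \<le> len r \<Longrightarrow> (pos r i, pos r j) \<in> on_same_route"
  by (auto simp: on_same_route_def)

lemma sym_on_same_route: "sym on_same_route"
  by (auto simp: sym_def on_same_route_def)

lemma reachable_on_same_route:
  assumes "(u, v) \<in> on_same_route"
  shows "code u \<rightarrow>\<^sup>*\<^bsub>directed.D\<^esub> code v"
proof -
  obtain r i j where r: "r \<in> set routes" "i \<le> len r" "j \<le> len r" "u = pos r i" "v = pos r j"
    using assms by (auto simp: on_same_route_def)
  then obtain k where k: "k < length routes" "r = routes ! k" by (metis in_set_conv_nth)
  show ?thesis
  proof (cases "i \<le> j")
    case True
    then show ?thesis
      using directed.route_reachable[of "2 * k" r i j] k r by (simp add: nth_both_ways)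
  next
    case False
    then show ?thesis
      using directed.route_reachable[of "Suc (2 * k)" "rev_route r" "len r - i" "len r - j"] k r
      by (simp add: nth_both_ways)
  qed
qed

lemma strongly_connected_routes:
  assumes "centre \<in> V" and centre: "\<And>v. v \<in> V \<Longrightarrow> (v, centre) \<in> on_same_route\<^sup>*"
  shows "strongly_connected directed.D"
proof (rule strongly_connectedI)
  show "verts directed.D \<noteq> {}" using directed.code_in_verts[OF assms(1)] by blast
  fix x y assume "x \<in> verts directed.D" "y \<in> verts directed.D"
  then have "x \<in> code ` V" "y \<in> code ` V"
    using code_bij by (simp_all add: directed.verts_D bij_betw_def)
  then obtain u v where uv: "u \<in> V" "v \<in> V" "x = code u" "y = code v" by (elim imageE)
  have "(centre, v) \<in> on_same_route\<^sup>*"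
    using centre[OF uv(2)] sym_rtrancl[OF sym_on_same_route] by (auto dest: symD)
  with centre[OF uv(1)] have "(u, v) \<in> on_same_route\<^sup>*" by (rule rtrancl_trans)
  then have "code u \<rightarrow>\<^sup>*\<^bsub>directed.D\<^esub> code v"
  proof (induction rule: rtrancl_induct)
    case base
    show ?case using directed.code_in_verts[OF uv(1)] by simp
  next
    case (step v w)
    then show ?case using reachable_on_same_route directed.reachable_trans by blast
  qed
  then show "x \<rightarrow>\<^sup>*\<^bsub>directed.D\<^esub> y" using uv by simp
qed

end

section \<open>The trip network of a formula\<close>

text \<open>
  The nodes \<open>Stop c i\<close> of line \<open>c\<close> form a block for \<open>i < L\<close>, the ports \<open>i = L\<close> and \<open>i = L + 1\<close> on
  both sides of the hub, and a second block for larger \<open>i\<close>. The gadget of variable \<open>v\<close> is entered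
  at \<open>Gadget v 0\<close> by its positive and at \<open>Gadget v 2\<close> by its negative occurrences.
\<close>

datatype node = Stop nat nat | Hub nat | Gadget nat nat

definition nodes :: "nat \<Rightarrow> nat \<Rightarrow> nat \<Rightarrow> node set" where
  "nodes m nv L = {Stop c i | c i. c \<le> m \<and> i < 2 * L + 2} \<union> {Hub j | j. j < 2} \<union>
      {Gadget v i | v i. v < nv \<and> i < 4}"

fun node_code :: "nat \<Rightarrow> nat \<Rightarrow> node \<Rightarrow> nat" where
  "node_code m L (Stop c i) = c * (2 * L + 2) + i"
| "node_code m L (Hub j) = (m + 1) * (2 * L + 2) + j"
| "node_code m L (Gadget v i) = (m + 1) * (2 * L + 2) + 2 + 4 * v + i"

definition node_count :: "nat \<Rightarrow> nat \<Rightarrow> nat \<Rightarrow> nat" where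
  "node_count m nv L = (m + 1) * (2 * L + 2) + 2 + 4 * nv"

lemma nodes_cases:
  assumes "a \<in> nodes m nv L"
  obtains (Stop) c i where "a = Stop c i" "c \<le> m" "i < 2 * L + 2"
  | (Hub) j where "a = Hub j" "j < 2"
  | (Gadget) v i where "a = Gadget v i" "v < nv" "i < 4"
  using assms by (auto simp: nodes_def)

lemma finite_nodes: "finite (nodes m nv L)"
  and card_nodes: "card (nodes m nv L) = node_count m nv L"
proof -
  let ?stops = "(\<lambda>(c, i). Stop c i) ` ({..m} \<times> {..<2 * L + 2})"
  let ?hubs = "Hub ` {..<2}" and ?gadgets = "(\<lambda>(v, i). Gadget v i) ` ({..<nv} \<times> {..<4})"
  have nodes: "nodes m nv L = ?stops \<union> ?hubs \<union> ?gadgets" by (force simp: nodes_def)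
  then show "finite (nodes m nv L)" by simp
  have "card ?stops = (m + 1) * (2 * L + 2)" "card ?hubs = 2" "card ?gadgets = nv * 4"
    by (subst card_image; auto simp: inj_on_def card_cartesian_product)+
  moreover have "?stops \<inter> ?hubs = {}" "(?stops \<union> ?hubs) \<inter> ?gadgets = {}" by auto
  ultimately show "card (nodes m nv L) = node_count m nv L"
    unfolding nodes by (simp add: card_Un_disjoint node_count_def)
qed

lemma inj_on_node_code: "inj_on (node_code m L) (nodes m nv L)"
proof (rule inj_onI)
  fix a b assume a: "a \<in> nodes m nv L" and b: "b \<in> nodes m nv L"
    and same_code: "node_code m L a = node_code m L b"
  have stop: "c * (2 * L + 2) + i < (m + 1) * (2 * L + 2)" if "c \<le> m" "i < 2 * L + 2" for c i
    using that by (intro mixed_radix_less) auto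
  from a show "a = b"
  proof (cases rule: nodes_cases)
    case a': (Stop c i)
    from b show ?thesis
    proof (cases rule: nodes_cases)
      case (Stop c' i')
      then show ?thesis using same_code a' mixed_radix_inj[of c "2 * L + 2" i c' i'] by simp
    qed (use same_code a' stop[of c i] in auto)
  next
    case a': (Hub j)
    from b show ?thesis
      by (cases rule: nodes_cases) (use same_code a' stop in fastforce)+
  next
    case a': (Gadget v i)
    from b show ?thesis
    proof (cases rule: nodes_cases)
      case (Gadget v' i')
      then show ?thesis
        using same_code a' mixed_radix_inj[of v 4 i v' i'] by (simp add: mult.commute)
    qed (use same_code a' stop in fastforce)+
  qed
qed

lemma node_code_less:
  assumes "a \<in> nodes m nv L"
  shows "node_code m L a < node_count m nv L"
  using assms
proof (cases rule: nodes_cases)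
  case (Stop c i)
  then show ?thesis
    using mixed_radix_less[of c "m + 1" i "2 * L + 2"] by (simp add: node_count_def)
qed (simp_all add: node_count_def)

lemma bij_node_code: "bij_betw (node_code m L) (nodes m nv L) {..<node_count m nv L}"
proof -
  have "node_code m L ` nodes m nv L \<subseteq> {..<node_count m nv L}" using node_code_less by auto
  then have "node_code m L ` nodes m nv L = {..<node_count m nv L}"
    by (rule card_subset_eq[OF finite_lessThan])
      (simp add: card_image[OF inj_on_node_code] card_nodes)
  with inj_on_node_code show ?thesis by (simp add: bij_betw_def)
qed

definition line_hub :: "nat \<Rightarrow> nat \<Rightarrow> node" where
  "line_hub m c = Hub (if c = m then 1 else 0)"

definition line_pos :: "nat \<Rightarrow> nat \<Rightarrow> nat \<Rightarrow> nat \<Rightarrow> node" where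
  "line_pos m L c i =
    (if i \<le> L then Stop c i else if i = L + 1 then line_hub m c else Stop c (i - 1))"

definition line_cum :: "nat \<Rightarrow> nat \<Rightarrow> nat" where
  "line_cum L i = (if i \<le> L then i else if i = L + 1 then L + 2 else i + 2)"

definition line_route :: "nat \<Rightarrow> nat \<Rightarrow> nat \<Rightarrow> node route" where
  "line_route m L c = Route (line_pos m L c) (line_cum L) (2 * L + 2)"

definition gadget_cum :: "nat \<Rightarrow> nat" where
  "gadget_cum i = (if i = 0 then 0 else if i = 1 then 1 else if i = 2 then 3 else 4)"

definition gadget_route :: "nat \<Rightarrow> node route" where
  "gadget_route v = Route (Gadget v) gadget_cum 3"

fun link_route :: "node \<times> node \<times> nat \<Rightarrow> node route" where
  "link_route (a, b, w) = Route (\<lambda>i. if i = 0 then a else b) (\<lambda>i. if i = 0 then 0 else w) 1"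

definition literal_node :: "bool \<times> nat \<Rightarrow> node" where
  "literal_node l = Gadget (snd l) (if fst l then 0 else 2)"

definition occurrence_links :: "nat \<Rightarrow> nat \<Rightarrow> (bool \<times> nat) list list \<Rightarrow> (node \<times> node \<times> nat) list" where
  "occurrence_links L s cls =
    concat (map (\<lambda>(c, C). map (\<lambda>l. (Stop c L, literal_node l, 2)) C) (List.enumerate s cls))"

definition links :: "(bool \<times> nat) list list \<Rightarrow> nat \<Rightarrow> nat \<Rightarrow> (node \<times> node \<times> nat) list" where
  "links cls nv L =
    map (\<lambda>c. (Stop c (L + 1), Hub 1, 2)) [0..<length cls] @
    [(Stop (length cls) L, Hub 0, 2)] @
    map (\<lambda>v. (Gadget v 1, Stop (length cls) (L + 1), 1)) [0..<nv] @
    map (\<lambda>v. (Gadget v 3, Stop (length cls) (L + 1), 1)) [0..<nv] @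
    occurrence_links L 0 cls"

definition formula_routes :: "(bool \<times> nat) list list \<Rightarrow> nat \<Rightarrow> nat \<Rightarrow> node route list" where
  "formula_routes cls nv L = map (line_route (length cls) L) [0..<length cls + 1] @
    map gadget_route [0..<nv] @ map link_route (links cls nv L)"

definition formula_input :: "(bool \<times> nat) list list \<Rightarrow> nat \<Rightarrow> nat \<Rightarrow> mrtt_input" where
  "formula_input cls nv L = route_input (node_code (length cls) L) (node_count (length cls) nv L)
      (both_ways (formula_routes cls nv L))"

text \<open>Two blocks without any connection cost \<open>L * L\<close> pairs.\<close>

definition formula_bound :: "nat \<Rightarrow> nat \<Rightarrow> nat \<Rightarrow> nat" where
  "formula_bound m nv L = node_count m nv L * node_count m nv L - L * L + 1"

lemma line_route_sel [simp]:
  "pos (line_route m L c) = line_pos m L c" "cum (line_route m L c) = line_cum L"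
  "len (line_route m L c) = 2 * L + 2"
  by (simp_all add: line_route_def)

lemma gadget_route_sel [simp]:
  "pos (gadget_route v) = Gadget v" "cum (gadget_route v) = gadget_cum" "len (gadget_route v) = 3"
  by (simp_all add: gadget_route_def)

lemma line_step_cases:
  assumes "i < 2 * L + 2"
  obtains
    (left) "i < L" "line_pos m L c i = Stop c i" "line_pos m L c (Suc i) = Stop c (Suc i)"
      "line_cum L i = i" "line_cum L (Suc i) = i + 1"
  | (to_hub) "line_pos m L c i = Stop c L" "line_pos m L c (Suc i) = line_hub m c"
      "line_cum L i = L" "line_cum L (Suc i) = L + 2"
  | (from_hub) "line_pos m L c i = line_hub m c" "line_pos m L c (Suc i) = Stop c (L + 1)"
      "line_cum L i = L + 2" "line_cum L (Suc i) = L + 4"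
  | (right) j where "L < j" "line_pos m L c i = Stop c j" "line_pos m L c (Suc i) = Stop c (Suc j)"
      "line_cum L i = j + 3" "line_cum L (Suc i) = j + 4"
proof -
  consider "i < L" | "i = L" | "i = L + 1" | j where "i = Suc j" "L < j"
    by (metis Suc_eq_plus1 less_antisym less_imp_Suc_add linorder_neqE_nat not_less_eq)
  then show ?thesis
    by cases (use left to_hub from_hub right in \<open>simp_all add: line_pos_def line_cum_def\<close>)
qed

locale formula_network =
  fixes cls :: "(bool \<times> nat) list list" and nv L :: nat
  assumes vars_less: "C \<in> set cls \<Longrightarrow> (s, v) \<in> set C \<Longrightarrow> v < nv"
begin

abbreviation m :: nat where "m \<equiv> length cls"
abbreviation V :: "node set" where "V \<equiv> nodes m nv L"
abbreviation n :: nat where "n \<equiv> node_count m nv L"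
abbreviation Ls :: "(node \<times> node \<times> nat) list" where "Ls \<equiv> links cls nv L"
abbreviation Rs :: "node route list" where "Rs \<equiv> formula_routes cls nv L"

lemma set_links:
  "(a, b, w) \<in> set Ls \<longleftrightarrow>
    (\<exists>c<m. a = Stop c (L + 1) \<and> b = Hub 1 \<and> w = 2) \<or>
    (a = Stop m L \<and> b = Hub 0 \<and> w = 2) \<or>
    (\<exists>v<nv. (a = Gadget v 1 \<or> a = Gadget v 3) \<and> b = Stop m (L + 1) \<and> w = 1) \<or>
    (\<exists>c<m. \<exists>l \<in> set (cls ! c). a = Stop c L \<and> b = literal_node l \<and> w = 2)"
proof -
  have occurrences: "(a, b, w) \<in> set (occurrence_links L 0 cls) \<longleftrightarrow>
      (\<exists>c<m. \<exists>l \<in> set (cls ! c). a = Stop c L \<and> b = literal_node l \<and> w = 2)"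
    by (force simp: occurrence_links_def in_set_enumerate_eq)
  show ?thesis unfolding links_def set_append Un_iff occurrences by auto
qed

lemma link_cases:
  assumes "(a, b, w) \<in> set Ls"
  obtains (second_port) c where "c < m" "a = Stop c (L + 1)" "b = Hub 1" "w = 2"
  | (last_line) "a = Stop m L" "b = Hub 0" "w = 2"
  | (gadget_exit) v i where "v < nv" "i = 1 \<or> i = 3" "a = Gadget v i" "b = Stop m (L + 1)" "w = 1"
  | (literal) c s v where "c < m" "(s, v) \<in> set (cls ! c)" "v < nv" "a = Stop c L"
      "b = Gadget v (if s then 0 else 2)" "w = 2"
  using assms unfolding set_links
proof (elim disjE exE conjE bexE)
  fix c l assume occurrence: "c < m" "l \<in> set (cls ! c)"
    and ends: "a = Stop c L" "b = literal_node l" "w = 2"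
  obtain s v where l: "l = (s, v)" by (metis surj_pair)
  with occurrence have "v < nv" using vars_less[OF nth_mem[OF occurrence(1)], of s v] by simp
  with literal[of c s v] occurrence ends l show thesis by (simp add: literal_node_def)
qed (use second_port last_line gadget_exit in blast)+

lemma links_in_V: "(a, b, w) \<in> set Ls \<Longrightarrow> a \<in> V \<and> b \<in> V \<and> 0 < w"
  by (erule link_cases) (auto simp: nodes_def)

lemma set_formula_routes:
  "set Rs = line_route m L ` {..m} \<union> gadget_route ` {..<nv} \<union> link_route ` set Ls"
proof -
  have "set [0..<m + 1] = {..m}" "set [0..<nv] = {..<nv}" by auto
  then show ?thesis unfolding formula_routes_def set_append set_map by (simp only: Un_assoc)
qed

lemma line_in_routes: "c \<le> m \<Longrightarrow> line_route m L c \<in> set Rs"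
  and gadget_in_routes: "v < nv \<Longrightarrow> gadget_route v \<in> set Rs"
  and link_in_routes: "e \<in> set Ls \<Longrightarrow> link_route e \<in> set Rs"
  unfolding set_formula_routes by blast+

lemma wf_formula_route:
  assumes "r \<in> set Rs"
  shows "wf_route V r"
  using assms unfolding set_formula_routes
proof (elim UnE imageE)
  fix c assume r: "r = line_route m L c" "c \<in> {..m}"
  have "line_cum L i < line_cum L (Suc i)" if "i < 2 * L + 2" for i
    using that by (rule line_step_cases) simp_all
  then show ?thesis
    using r by (auto simp: wf_route_def line_pos_def line_hub_def nodes_def line_cum_def[of _ 0])
next
  fix v assume "r = gadget_route v" "v \<in> {..<nv}"
  then show ?thesis by (auto simp: wf_route_def nodes_def gadget_cum_def)
next
  fix e assume "r = link_route e" "e \<in> set Ls"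
  then show ?thesis using links_in_V by (cases e) (auto simp: wf_route_def)
qed

lemma node_on_route:
  assumes "a \<in> V"
  shows "\<exists>r \<in> set Rs. \<exists>i \<le> len r. pos r i = a"
  using assms
proof (cases rule: nodes_cases)
  case (Stop c i)
  then have "line_pos m L c (if i \<le> L then i else i + 1) = a" by (simp add: line_pos_def)
  with Stop line_in_routes[of c] show ?thesis
    by (intro bexI[of _ "line_route m L c"] exI[of _ "if i \<le> L then i else i + 1"]) auto
next
  case (Hub j)
  then consider (first) "j = 0" | (second) "j = 1" by linarith
  then show ?thesis
  proof cases
    case first
    have "link_route (Stop m L, Hub 0, 2) \<in> set Rs" by (rule link_in_routes) (simp add: set_links)
    with Hub first show ?thesis
      by (intro bexI[of _ "link_route (Stop m L, Hub 0, 2)"] exI[of _ 1]) auto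
  next
    case second
    with Hub line_in_routes[of m] show ?thesis
      by (intro bexI[of _ "line_route m L m"] exI[of _ "L + 1"])
        (simp_all add: line_pos_def line_hub_def)
  qed
next
  case (Gadget v i)
  with gadget_in_routes[of v] show ?thesis
    by (intro bexI[of _ "gadget_route v"] exI[of _ i]) auto
qed

sublocale network: symmetric_routes "node_code m L" V Rs n
  by unfold_locales (fact bij_node_code, fact wf_formula_route, fact node_on_route)

lemma formula_input_eq: "formula_input cls nv L = network.directed.N"
  by (simp add: formula_input_def)

lemma strongly_connected_formula: "strongly_connected network.directed.D"
proof (rule network.strongly_connected_routes)
  let ?R = "network.on_same_route"
  have stop: "(Stop c i, line_hub m c) \<in> ?R" if "c \<le> m" "i < 2 * L + 2" for c i
    using network.on_same_routeI[OF line_in_routes[OF that(1)], of i "L + 1"]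
      network.on_same_routeI[OF line_in_routes[OF that(1)], of "i + 1" "L + 1"] that(2)
    by (cases "i \<le> L") (simp_all add: line_pos_def)
  have link: "(a, b) \<in> ?R" if "(a, b, w) \<in> set Ls" for a b w
    using network.on_same_routeI[OF link_in_routes[OF that], of 0 1] by simp
  have "(Hub 1, Stop m L) \<in> ?R"
    using stop[of m L] network.sym_on_same_route by (simp add: line_hub_def sym_def)
  moreover have "(Stop m L, Hub 0) \<in> ?R" by (rule link[of _ _ 2]) (simp add: set_links)
  ultimately have hub1: "(Hub 1, Hub 0) \<in> ?R\<^sup>*" by (meson r_into_rtrancl rtrancl_trans)
  then have hub: "(line_hub m c, Hub 0) \<in> ?R\<^sup>*" for c by (simp add: line_hub_def)
  show "Hub 0 \<in> V" by (simp add: nodes_def)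
  fix a assume "a \<in> V"
  then show "(a, Hub 0) \<in> ?R\<^sup>*"
  proof (cases rule: nodes_cases)
    case (Stop c i)
    with stop[of c i] hub[of c] show ?thesis by (simp add: converse_rtrancl_into_rtrancl)
  next
    case (Hub j)
    then have "j = 0 \<or> j = 1" by auto
    with Hub(1) hub1 show ?thesis by auto
  next
    case (Gadget v i)
    have "(Gadget v i, Gadget v 1) \<in> ?R"
      using network.on_same_routeI[OF gadget_in_routes[OF Gadget(2)], of i 1] Gadget(3) by simp
    moreover have "(Gadget v 1, Stop m (L + 1)) \<in> ?R"
      by (rule link[of _ _ 1]) (use Gadget in \<open>simp add: set_links\<close>)
    moreover have "(Stop m (L + 1), line_hub m m) \<in> ?R" by (rule stop) simp_all
    ultimately show ?thesis using Gadget(1) hub[of m] by (meson converse_rtrancl_into_rtrancl)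
  qed
qed

lemma length_Rs: "length Rs = m + 1 + nv + length Ls"
  by (simp add: formula_routes_def)

lemma nth_Rs:
  "c \<le> m \<Longrightarrow> Rs ! c = line_route m L c"
  "v < nv \<Longrightarrow> Rs ! (m + 1 + v) = gadget_route v"
  "k < length Ls \<Longrightarrow> Rs ! (m + 1 + nv + k) = link_route (Ls ! k)"
  by (auto simp: formula_routes_def nth_append less_Suc_eq_le)

subsection \<open>Reachability implies satisfiability\<close>

lemma formula_edge_cases:
  assumes "(u, w, s, d) \<in> route_edges (both_ways Rs) \<tau>"
  obtains (line) c i where "c \<le> m" "i < 2 * L + 2"
      "d = real (line_cum L (Suc i)) - real (line_cum L i)"
      "u = line_pos m L c i \<and> w = line_pos m L c (Suc i) \<and> s = \<tau> (2 * c) + real (line_cum L i) \<or>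
       u = line_pos m L c (Suc i) \<and> w = line_pos m L c i"
  | (gadget) v i where "v < nv" "i < 3" "d = real (gadget_cum (Suc i)) - real (gadget_cum i)"
      "u = Gadget v i \<and> w = Gadget v (Suc i) \<and> s = \<tau> (2 * (m + 1 + v)) + real (gadget_cum i) \<or>
       u = Gadget v (Suc i) \<and> w = Gadget v i"
  | (link) a b e where "(a, b, e) \<in> set Ls" "d = real e" "u = a \<and> w = b \<or> u = b \<and> w = a"
proof -
  obtain k r i where k: "k < length Rs" "r = Rs ! k" "i < len r"
    and d: "d = real (cum r (Suc i)) - real (cum r i)"
    and edge: "u = pos r i \<and> w = pos r (Suc i) \<and> s = \<tau> (2 * k) + real (cum r i) \<or>
      u = pos r (Suc i) \<and> w = pos r i"
    using assms by (elim both_ways_edge_cases[OF _ wf_formula_route]) blast+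
  have "k \<le> m \<or> (k = m + 1 + (k - (m + 1)) \<and> k - (m + 1) < nv) \<or>
      (k = m + 1 + nv + (k - (m + 1 + nv)) \<and> k - (m + 1 + nv) < length Ls)"
    using k(1) unfolding length_Rs by linarith
  then consider (line_trip) "k \<le> m" | (gadget_trip) v where "k = m + 1 + v" "v < nv"
    | (link_trip) j where "k = m + 1 + nv + j" "j < length Ls" by blast
  then show ?thesis
  proof cases
    case line_trip
    then show ?thesis using line[of k i] k d edge by (simp add: nth_Rs)
  next
    case (gadget_trip v)
    then have "r = gadget_route v" using k(2) by (simp only: nth_Rs)
    then show ?thesis using gadget[of v i] gadget_trip k d edge by simp
  next
    case (link_trip j)
    obtain a b e where e: "Ls ! j = (a, b, e)" by (metis surj_pair)
    then have "r = link_route (a, b, e)" using k(2) link_trip by (simp only: nth_Rs)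
    moreover have "(a, b, e) \<in> set Ls" using link_trip(2) e by (metis nth_mem)
    ultimately show ?thesis using link[of a b e] k(3) d edge by auto
  qed
qed

lemma journey_invariant_formula:
  assumes "journey (route_edges (both_ways Rs) \<tau>) u t v t'" "I u t"
    and mono: "\<And>a t t'. I a t \<Longrightarrow> t \<le> t' \<Longrightarrow> I a t'"
    and line_forward: "\<And>c i t. c \<le> m \<Longrightarrow> i < 2 * L + 2 \<Longrightarrow> I (line_pos m L c i) t \<Longrightarrow>
      t \<le> \<tau> (2 * c) + line_cum L i \<Longrightarrow> I (line_pos m L c (Suc i)) (\<tau> (2 * c) + line_cum L (Suc i))"
    and line_backward: "\<And>c i t. c \<le> m \<Longrightarrow> i < 2 * L + 2 \<Longrightarrow> I (line_pos m L c (Suc i)) t \<Longrightarrow>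
      I (line_pos m L c i) (t + (real (line_cum L (Suc i)) - real (line_cum L i)))"
    and gadget_forward: "\<And>v i t. v < nv \<Longrightarrow> i < 3 \<Longrightarrow> I (Gadget v i) t \<Longrightarrow>
      t \<le> \<tau> (2 * (m + 1 + v)) + gadget_cum i \<Longrightarrow>
      I (Gadget v (Suc i)) (\<tau> (2 * (m + 1 + v)) + gadget_cum (Suc i))"
    and gadget_backward: "\<And>v i t. v < nv \<Longrightarrow> i < 3 \<Longrightarrow> I (Gadget v (Suc i)) t \<Longrightarrow>
      I (Gadget v i) (t + (real (gadget_cum (Suc i)) - real (gadget_cum i)))"
    and link_forward: "\<And>a b e t. (a, b, e) \<in> set Ls \<Longrightarrow> I a t \<Longrightarrow> I b (t + e)"
    and link_backward: "\<And>a b e t. (a, b, e) \<in> set Ls \<Longrightarrow> I b t \<Longrightarrow> I a (t + e)"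
  shows "\<exists>t. I v t"
proof (rule journey_invariant[where I = I, OF assms(1,2)])
  fix u w s d t
  assume "(u, w, s, d) \<in> route_edges (both_ways Rs) \<tau>" and t: "t \<le> s" and I: "I u t"
  then show "I w (s + d)"
  proof (cases rule: formula_edge_cases)
    case (line c i)
    then show ?thesis
      using I t line_forward[of c i t] line_backward[of c i s] mono[OF I t] by auto
  next
    case (gadget v i)
    then show ?thesis
      using I t gadget_forward[of v i t] gadget_backward[of v i s] mono[OF I t] by auto
  next
    case (link a b e)
    then show ?thesis using link_forward[of a b e s] link_backward[of a b e s] mono[OF I t] by auto
  qed
qed

text \<open>
  Lower bounds for the arrival times of journeys from the first block of line \<open>m\<close>, whose trip
  leaves the first port at time \<open>\<theta>\<close>. If the trip of line \<open>c\<close> is earlier, it is always missed.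
\<close>

definition after_last_line :: "nat \<Rightarrow> real \<Rightarrow> node \<Rightarrow> real \<Rightarrow> bool" where
  "after_last_line c \<theta> a t = (case a of
      Stop d i \<Rightarrow> if d = m then i < L \<or> (if i = L then \<theta> \<le> t else \<theta> + 4 \<le> t)
        else \<not> (d = c \<and> L + 2 \<le> i) \<and> \<theta> + 4 \<le> t
    | Hub j \<Rightarrow> \<theta> + 2 \<le> t
    | Gadget v i \<Rightarrow> \<theta> + 3 \<le> t)"

lemma last_line_not_later:
  assumes "connects (route_edges (both_ways Rs) \<tau>) (Stop m i) (Stop c j)"
    and "i < L" "c < m" "L + 2 \<le> j"
  shows "\<tau> (2 * m) \<le> \<tau> (2 * c)"
proof (rule ccontr)
  assume earlier: "\<not> \<tau> (2 * m) \<le> \<tau> (2 * c)"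
  let ?I = "after_last_line c (\<tau> (2 * m) + L)"
  obtain t t' where "journey (route_edges (both_ways Rs) \<tau>) (Stop m i) t (Stop c j) t'"
    using assms(1) by (auto simp: connects_def)
  then have "\<exists>t. ?I (Stop c j) t"
  proof (rule journey_invariant_formula)
    show "?I (Stop m i) t" using assms by (simp add: after_last_line_def)
  next
    fix d i t assume "i < 2 * L + 2" "?I (line_pos m L d i) t" "t \<le> \<tau> (2 * d) + line_cum L i"
    then show "?I (line_pos m L d (Suc i)) (\<tau> (2 * d) + line_cum L (Suc i))"
      using earlier by (cases rule: line_step_cases[where m = m and c = d])
        (auto simp: after_last_line_def line_hub_def split: if_splits)
  next
    fix d i t assume "i < 2 * L + 2" "?I (line_pos m L d (Suc i)) t"
    then show "?I (line_pos m L d i) (t + (real (line_cum L (Suc i)) - real (line_cum L i)))"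
      by (cases rule: line_step_cases[where m = m and c = d])
        (auto simp: after_last_line_def line_hub_def split: if_splits)
  next
    fix a b e t assume "(a, b, e) \<in> set Ls"
    then show "?I a t \<Longrightarrow> ?I b (t + e)" "?I b t \<Longrightarrow> ?I a (t + e)"
      by (cases rule: link_cases; auto simp: after_last_line_def split: if_splits)+
  qed (auto simp: after_last_line_def gadget_cum_def split: node.splits if_splits)
  then show False using assms by (simp add: after_last_line_def)
qed

text \<open>
  Lower bounds for the arrival times of journeys from the first block of line \<open>c\<close> if the trip of
  line \<open>m\<close> leaves its first port at time \<open>\<theta>\<close> and the one of line \<open>c\<close> not earlier. Unless a gadget
  trip runs exactly when it can be used, the second port of line \<open>m\<close> is reached too late.
\<close>

definition after_clause_line :: "nat \<Rightarrow> real \<Rightarrow> node \<Rightarrow> real \<Rightarrow> bool" where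
  "after_clause_line c \<theta> a t = (case a of
      Stop d i \<Rightarrow> if d = c then i < L \<or> (if i = L then \<theta> \<le> t else \<theta> + 4 \<le> t)
        else if d = m \<and> L < i then i = L + 1 \<and> \<theta> + 4 < t
        else \<theta> + 4 \<le> t
    | Hub j \<Rightarrow> if j = 0 then \<theta> + 2 \<le> t else \<theta> + 2 < t
    | Gadget v i \<Rightarrow> if i = 0 then if (True, v) \<in> set (cls ! c) then \<theta> + 2 \<le> t else \<theta> + 4 \<le> t
        else if i = 2 then if (False, v) \<in> set (cls ! c) then \<theta> + 2 \<le> t else \<theta> + 4 \<le> t
        else \<theta> + 3 < t)"

lemma after_clause_line_mono: "after_clause_line c \<theta> a t \<Longrightarrow> t \<le> t' \<Longrightarrow> after_clause_line c \<theta> a t'"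
  by (cases a) (auto simp: after_clause_line_def split: if_splits)

lemma after_clause_line_link:
  assumes "(a, b, e) \<in> set Ls" "c < m"
  shows "(after_clause_line c \<theta> a t \<longrightarrow> after_clause_line c \<theta> b (t + e)) \<and>
    (after_clause_line c \<theta> b t \<longrightarrow> after_clause_line c \<theta> a (t + e))"
  using assms(1)
proof (cases rule: link_cases)
  case (second_port d)
  with assms(2) show ?thesis by (cases "d = c") (simp_all add: after_clause_line_def)
next
  case (literal d s v)
  with assms(2) show ?thesis
    by (cases "d = c"; cases s; cases "(s, v) \<in> set (cls ! c)")
      (simp_all add: after_clause_line_def)
qed (use assms(2) in \<open>auto simp: after_clause_line_def\<close>)

lemma after_clause_line_gadget:
  fixes \<sigma> :: real
  assumes "i < 3" "after_clause_line c \<theta> (Gadget v i) t" "t \<le> \<sigma> + gadget_cum i"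
    and unused: "\<And>s. (s, v) \<in> set (cls ! c) \<Longrightarrow> \<sigma> \<noteq> \<theta> + (if s then 2 else - 1)"
  shows "after_clause_line c \<theta> (Gadget v (Suc i)) (\<sigma> + gadget_cum (Suc i))"
proof -
  consider "i = 0" | "i = 1" | "i = 2" using assms(1) by linarith
  then show ?thesis
    using assms(2,3) unused[of True] unused[of False]
    by cases (cases "(True, v) \<in> set (cls ! c)"; cases "(False, v) \<in> set (cls ! c)";
      simp add: after_clause_line_def gadget_cum_def)+
qed

lemma clause_needs_gadget:
  assumes "connects (route_edges (both_ways Rs) \<tau>) (Stop c i) (Stop m j)"
    and "i < L" "c < m" "L + 2 \<le> j" "\<tau> (2 * m) \<le> \<tau> (2 * c)"
  shows "\<exists>(s, v) \<in> set (cls ! c). \<tau> (2 * (m + 1 + v)) = \<tau> (2 * m) + L + (if s then 2 else - 1)"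
proof (rule ccontr)
  assume unused: "\<not> ?thesis"
  let ?I = "after_clause_line c (\<tau> (2 * m) + L)"
  obtain t t' where "journey (route_edges (both_ways Rs) \<tau>) (Stop c i) t (Stop m j) t'"
    using assms(1) by (auto simp: connects_def)
  then have "\<exists>t. ?I (Stop m j) t"
  proof (rule journey_invariant_formula)
    show "?I (Stop c i) t" using assms by (simp add: after_clause_line_def)
  next
    fix d i t assume "i < 2 * L + 2" "?I (line_pos m L d i) t" "t \<le> \<tau> (2 * d) + line_cum L i"
    then show "?I (line_pos m L d (Suc i)) (\<tau> (2 * d) + line_cum L (Suc i))"
      using assms(3,5)
      by (cases rule: line_step_cases[where m = m and c = d]; cases "d = m"; cases "d = c")
        (auto simp: after_clause_line_def line_hub_def)
  next
    fix d i t assume "i < 2 * L + 2" "?I (line_pos m L d (Suc i)) t"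
    then show "?I (line_pos m L d i) (t + (real (line_cum L (Suc i)) - real (line_cum L i)))"
      using assms(3)
      by (cases rule: line_step_cases[where m = m and c = d]; cases "d = m"; cases "d = c")
        (auto simp: after_clause_line_def line_hub_def)
  next
    fix v i t assume "i < 3" "?I (Gadget v i) t" "t \<le> \<tau> (2 * (m + 1 + v)) + gadget_cum i"
    then show "?I (Gadget v (Suc i)) (\<tau> (2 * (m + 1 + v)) + gadget_cum (Suc i))"
      by (rule after_clause_line_gadget) (use unused in blast)
  next
    fix v i t assume "i < 3" and I: "?I (Gadget v (Suc i)) t"
    then consider "i = 0" | "i = 1" | "i = 2" by linarith
    then show "?I (Gadget v i) (t + (real (gadget_cum (Suc i)) - real (gadget_cum i)))"
      by cases (use I in \<open>simp_all add: after_clause_line_def gadget_cum_def split: if_splits\<close>)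
  qed (use after_clause_line_mono after_clause_line_link assms(3) in blast)+
  then show False using assms by (simp add: after_clause_line_def)
qed

lemma ex_connected_in_blocks:
  assumes "formula_bound m nv L \<le> card (connected_pairs V E)"
    and "B \<subseteq> V" "B' \<subseteq> V" "card B = L" "card B' = L"
  shows "\<exists>u \<in> B. \<exists>v \<in> B'. connects E u v"
proof (rule ccontr)
  assume "\<not> ?thesis"
  then have "connected_pairs V E \<subseteq> V \<times> V - B \<times> B'" by (auto simp: connected_pairs_def)
  then have "card (connected_pairs V E) \<le> card (V \<times> V - B \<times> B')"
    using finite_nodes by (intro card_mono) auto
  also have "\<dots> = card (V \<times> V) - card (B \<times> B')"
    using assms(2,3) finite_nodes
    by (intro card_Diff_subset) (auto intro: finite_subset[OF _ finite_nodes])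
  also have "\<dots> = n * n - L * L" using assms(4,5) card_nodes by (simp add: card_cartesian_product)
  finally show False using assms(1) by (simp add: formula_bound_def)
qed

lemma satisfiable_if_connected:
  assumes bound: "formula_bound m nv L \<le> card (connected_pairs V (route_edges (both_ways Rs) \<tau>))"
  shows "satisfiable cls"
proof -
  let ?l = "\<lambda>c. Stop c ` {..<L}" and ?r = "\<lambda>c. Stop c ` {L + 2..<2 * L + 2}"
  have blocks: "?l c \<subseteq> V" "?r c \<subseteq> V" "card (?l c) = L" "card (?r c) = L" if "c \<le> m" for c
    using that by (auto simp: nodes_def card_image inj_on_def)
  let ?A = "\<lambda>v. \<tau> (2 * (m + 1 + v)) = \<tau> (2 * m) + L + 2"
  have "fulfils ?A (cls ! c)" if c: "c < m" for c
  proof -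
    obtain i j where "i < L" "L + 2 \<le> j"
      "connects (route_edges (both_ways Rs) \<tau>) (Stop m i) (Stop c j)"
      using ex_connected_in_blocks[OF bound, of "?l m" "?r c"] blocks[of m] blocks[of c] c by auto
    then have order: "\<tau> (2 * m) \<le> \<tau> (2 * c)" using last_line_not_later c by blast
    obtain i j where "i < L" "L + 2 \<le> j"
      "connects (route_edges (both_ways Rs) \<tau>) (Stop c i) (Stop m j)"
      using ex_connected_in_blocks[OF bound, of "?l c" "?r m"] blocks[of m] blocks[of c] c by auto
    from clause_needs_gadget[OF this(3,1) c this(2) order] obtain s v where "(s, v) \<in> set (cls ! c)"
      "\<tau> (2 * (m + 1 + v)) = \<tau> (2 * m) + L + (if s then 2 else - 1)" by blast
    moreover from this(2) have "?A v = s" by (cases s) simp_all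
    ultimately show ?thesis unfolding fulfils_def by blast
  qed
  then show ?thesis unfolding satisfiable_def by (metis in_set_conv_nth)
qed

subsection \<open>Satisfiability implies reachability\<close>

definition departure :: "(nat \<Rightarrow> bool) \<Rightarrow> nat \<Rightarrow> real" where
  "departure A k =
    (if k \<le> m then - real (L + 2)
     else if k < m + 1 + nv then if A (k - (m + 1)) then 0 else - 3
     else if snd (snd (Ls ! (k - (m + 1 + nv)))) = 2 then - 2 else 1)"

context
  fixes A :: "nat \<Rightarrow> bool"
begin

abbreviation E :: "node temporal_edge set" where
  "E \<equiv> route_edges (both_ways Rs) (mirrored Rs (departure A))"

lemma E_reverse: "journey E u t v t' \<Longrightarrow> journey E v (- t') u (- t)"
  by (rule mirrored_journey_reverse[OF _ wf_formula_route])

lemma line_journey: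
  assumes "c \<le> m" "i \<le> j" "j \<le> 2 * L + 2"
  shows "journey E (line_pos m L c i) (real (line_cum L i) - (L + 2))
    (line_pos m L c j) (real (line_cum L j) - (L + 2))"
  using mirrored_journey[of c Rs "line_route m L c" i j "departure A"] assms
  by (simp add: nth_Rs length_Rs departure_def algebra_simps)

lemma gadget_journey:
  assumes "v < nv"
  shows "journey E (literal_node (A v, v)) 0 (Gadget v (if A v then 1 else 3)) 1"
proof -
  have "m + 1 + v < length Rs" "Rs ! (m + 1 + v) = gadget_route v"
    using assms nth_Rs(2) by (simp_all add: length_Rs)
  moreover have "departure A (m + 1 + v) = (if A v then 0 else - 3)"
    using assms by (simp add: departure_def)
  ultimately show ?thesis
    using mirrored_journey[of "m + 1 + v" Rs "gadget_route v" "if A v then 0 else 2"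
        "if A v then 1 else 3" "departure A"]
    by (auto simp: gadget_cum_def literal_node_def)
qed

lemma link_journey:
  assumes "(a, b, w) \<in> set Ls"
  shows "w = 2 \<Longrightarrow> journey E a (-2) b 0" "w = 1 \<Longrightarrow> journey E a 1 b 2"
proof -
  obtain i where i: "i < length Ls" "Ls ! i = (a, b, w)"
    using assms by (metis in_set_conv_nth)
  let ?k = "m + 1 + nv + i"
  have "?k < length Rs" "Rs ! ?k = link_route (a, b, w)"
    using i nth_Rs(3) by (simp_all add: length_Rs)
  moreover have "departure A ?k = (if w = 2 then - 2 else 1)"
    using i by (simp add: departure_def)
  ultimately show "w = 2 \<Longrightarrow> journey E a (-2) b 0" "w = 1 \<Longrightarrow> journey E a 1 b 2"
    using mirrored_journey[of ?k Rs "link_route (a, b, w)" 0 1 "departure A"] by auto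
qed

lemma port_to_line_hub:
  assumes "c \<le> m" "p = L \<or> p = L + 1"
  shows "journey E (Stop c p) (-2) (line_hub m c) 0"
  using assms(2)
proof
  assume "p = L"
  then show ?thesis
    using line_journey[OF assms(1), of L "L + 1"] by (simp add: line_pos_def line_cum_def)
next
  assume "p = L + 1"
  then show ?thesis
    using E_reverse[OF line_journey[OF assms(1), of "L + 1" "L + 2"]]
    by (simp add: line_pos_def line_cum_def)
qed

lemma port_to_hub0:
  assumes "c \<le> m" "p = L \<or> p = L + 1" "\<not> (c = m \<and> p = L + 1)"
  shows "journey E (Stop c p) (-2) (Hub 0) 0"
proof (cases "c = m")
  case True
  then have "(Stop c p, Hub 0, 2) \<in> set Ls" using assms by (auto simp: set_links)
  from link_journey(1)[OF this] show ?thesis by simp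
next
  case False
  then show ?thesis using port_to_line_hub[OF assms(1,2)] by (simp add: line_hub_def)
qed

lemma second_port_to_hub1:
  assumes "c \<le> m"
  shows "journey E (Stop c (L + 1)) (-2) (Hub 1) 0"
proof (cases "c = m")
  case True
  then show ?thesis using port_to_line_hub[OF assms, of "L + 1"] by (simp add: line_hub_def)
next
  case False
  then have "(Stop c (L + 1), Hub 1, 2) \<in> set Ls" using assms by (auto simp: set_links)
  from link_journey(1)[OF this] show ?thesis by simp
qed

lemma journey_via_hub:
  assumes "journey E u (-2) h 0" "journey E v (-2) h 0"
  shows "journey E u (-2) v 2"
  using journey_trans[OF assms(1) order_refl] E_reverse[OF assms(2)] by simp

lemma journey_via_gadget:
  assumes "fulfils A (cls ! c)" "c < m"
  shows "journey E (Stop c L) (-2) (Stop m (L + 1)) 2"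
proof -
  obtain v where v: "(A v, v) \<in> set (cls ! c)" using assms(1) by (auto simp: fulfils_def)
  then have "v < nv" using vars_less nth_mem[OF assms(2)] by blast
  let ?exit = "Gadget v (if A v then 1 else 3)"
  have "(Stop c L, literal_node (A v, v), 2) \<in> set Ls" "(?exit, Stop m (L + 1), 1) \<in> set Ls"
    unfolding set_links using v \<open>v < nv\<close> assms(2) by (blast, simp)
  then have "journey E (Stop c L) (-2) (literal_node (A v, v)) 0"
    "journey E ?exit 1 (Stop m (L + 1)) 2"
    by (auto dest: link_journey)
  with gadget_journey[OF \<open>v < nv\<close>] show ?thesis by (meson journey_trans order_refl)
qed

lemma ports_connected:
  assumes sat: "\<And>c. c < m \<Longrightarrow> fulfils A (cls ! c)"
    and lines: "c \<le> m" "c' \<le> m" "c \<noteq> c'"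
    and ports: "p = L \<or> p = L + 1" "p' = L \<or> p' = L + 1"
  shows "journey E (Stop c p) (-2) (Stop c' p') 2"
proof -
  consider (hub0) "\<not> (c = m \<and> p = L + 1)" "\<not> (c' = m \<and> p' = L + 1)"
    | (hub1) "p = L + 1" "p' = L + 1"
    | (from_last) "c = m" "p = L + 1" "p' = L"
    | (to_last) "c' = m" "p' = L + 1" "p = L"
    using ports by blast
  then show ?thesis
  proof cases
    case hub0
    then show ?thesis using journey_via_hub port_to_hub0 lines ports by blast
  next
    case hub1
    then show ?thesis using journey_via_hub second_port_to_hub1 lines by blast
  next
    case from_last
    then show ?thesis using E_reverse[OF journey_via_gadget[of c']] sat[of c'] lines by simp
  next
    case to_last
    then show ?thesis using journey_via_gadget[of c] sat[of c] lines by simp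
  qed
qed

lemma block_to_port:
  assumes "c \<le> m" "i < L \<or> L + 2 \<le> i \<and> i < 2 * L + 2"
  obtains t p where "p = L \<or> p = L + 1" "journey E (Stop c i) t (Stop c p) (-2)"
  using assms(2)
proof (elim disjE conjE)
  assume "i < L"
  then have "journey E (Stop c i) (real i - (L + 2)) (Stop c L) (-2)"
    using line_journey[OF assms(1), of i L] by (simp add: line_pos_def line_cum_def)
  then show ?thesis by (rule that[rotated]) simp
next
  assume i: "L + 2 \<le> i" "i < 2 * L + 2"
  then have "journey E (Stop c i) (real L - real i - 1) (Stop c (L + 1)) (-2)"
    using E_reverse[OF line_journey[OF assms(1), of "L + 2" "i + 1"]]
    by (simp add: line_pos_def line_cum_def)
  then show ?thesis by (rule that[rotated]) simp
qed

lemma blocks_connected: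
  assumes sat: "\<And>c. c < m \<Longrightarrow> fulfils A (cls ! c)"
    and i: "c \<le> m" "i < L \<or> L + 2 \<le> i \<and> i < 2 * L + 2"
    and j: "c' \<le> m" "j < L \<or> L + 2 \<le> j \<and> j < 2 * L + 2"
  shows "connects E (Stop c i) (Stop c' j)"
proof (cases "c = c'")
  case True
  define q where "q i = (if i \<le> L then i else i + 1)" for i
  have pos: "line_pos m L c (q i) = Stop c i" for i by (auto simp: q_def line_pos_def)
  have "q i \<le> 2 * L + 2" "q j \<le> 2 * L + 2" using i j by (auto simp: q_def)
  then show ?thesis
    using line_journey[OF i(1), of "q i" "q j"]
      E_reverse[OF line_journey[OF i(1), of "q j" "q i"]] True
    unfolding connects_def pos by (meson linear)
next
  case False
  obtain t p where p: "p = L \<or> p = L + 1" "journey E (Stop c i) t (Stop c p) (-2)"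
    using block_to_port[OF i] by blast
  obtain t' p' where p': "p' = L \<or> p' = L + 1" "journey E (Stop c' j) t' (Stop c' p') (-2)"
    using block_to_port[OF j] by blast
  have "journey E (Stop c' p') 2 (Stop c' j) (- t')" using E_reverse[OF p'(2)] by simp
  with ports_connected[OF sat i(1) j(1) False p(1) p'(1)] p(2)
  show ?thesis unfolding connects_def by (meson journey_trans order_refl)
qed

end

lemma connected_if_satisfiable:
  assumes "satisfiable cls"
    and large: "n * n + 1 \<le> L * L + ((m + 1) * (2 * L)) * ((m + 1) * (2 * L))"
  shows "\<exists>\<tau>. formula_bound m nv L \<le> card (connected_pairs V (route_edges (both_ways Rs) \<tau>))"
proof -
  obtain A where "\<And>c. c < m \<Longrightarrow> fulfils A (cls ! c)"
    using assms(1) unfolding satisfiable_def by (metis nth_mem)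
  note connected = blocks_connected[of A, OF this]
  let ?I = "{..<L} \<union> {L + 2..<2 * L + 2}"
  let ?H = "(\<lambda>(c, i). Stop c i) ` ({..m} \<times> ?I)"
  let ?S = "connected_pairs V (E A)"
  have "card ?I = 2 * L" by (subst card_Un_disjoint) auto
  moreover have "card ?H = card ({..m} \<times> ?I)" by (rule card_image) (auto simp: inj_on_def)
  ultimately have card_H: "card ?H = (m + 1) * (2 * L)" by (simp add: card_cartesian_product)
  have "?H \<times> ?H \<subseteq> ?S" using connected by (auto simp: connected_pairs_def nodes_def)
  moreover have "finite ?S"
    by (rule finite_subset[of _ "V \<times> V"]) (auto simp: connected_pairs_def finite_nodes)
  ultimately have "card (?H \<times> ?H) \<le> card ?S" by (intro card_mono)
  then have "((m + 1) * (2 * L)) * ((m + 1) * (2 * L)) \<le> card ?S"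
    using card_H by (simp only: card_cartesian_product)
  moreover have "L * L \<le> n * n" by (intro mult_le_mono) (auto simp: node_count_def)
  ultimately have "formula_bound m nv L \<le> card ?S"
    using large unfolding formula_bound_def by linarith
  then show ?thesis by blast
qed

theorem formula_input_correct:
  assumes large: "n * n + 1 \<le> L * L + ((m + 1) * (2 * L)) * ((m + 1) * (2 * L))"
  defines "N \<equiv> formula_input cls nv L"
  shows "valid_input N" "symmetric_trips (input_digraph N) (input_trips N)"
    "strongly_connected (input_digraph N)"
    "(\<exists>\<tau>. formula_bound m nv L \<le> reachability (input_digraph N) (input_weight N) (input_trips N) \<tau>)
      \<longleftrightarrow> satisfiable cls"
proof -
  show "valid_input N" "symmetric_trips (input_digraph N) (input_trips N)"
    "strongly_connected (input_digraph N)"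
    unfolding N_def formula_input_eq valid_input_def
    by (rule network.directed.trip_network_routes network.symmetric_trips_routes
        strongly_connected_formula)+
  show "(\<exists>\<tau>. formula_bound m nv L \<le>
      reachability (input_digraph N) (input_weight N) (input_trips N) \<tau>) \<longleftrightarrow> satisfiable cls"
    unfolding N_def formula_input_eq network.directed.reachability_routes
    using satisfiable_if_connected connected_if_satisfiable[OF _ large] by blast
qed

end

section \<open>Writing the network of a formula\<close>

subsection \<open>Binary encoding of routes\<close>

definition encode_arcs :: "(nat \<times> nat \<times> nat) list \<Rightarrow> bool list" where
  "encode_arcs as = concat (map
    (\<lambda>(u, v, w). True # encode_nat u @ encode_nat v @ encode_nat w @ encode_nat 1) as)"

definition encode_trips :: "nat list list \<Rightarrow> bool list" where
  "encode_trips Ts = concat (map (\<lambda>T. True # encode_list encode_nat T) Ts)"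

lemma encode_append [simp]:
  "encode_arcs (as @ as') = encode_arcs as @ encode_arcs as'"
  "encode_trips (Ts @ Ts') = encode_trips Ts @ encode_trips Ts'"
  by (simp_all add: encode_arcs_def encode_trips_def)

lemma encode_arcs_concat: "encode_arcs (concat ass) = concat (map encode_arcs ass)"
  by (induction ass) (simp_all add: encode_arcs_def)

lemma encode_rat_of_nat: "encode_rat (of_nat w) = encode_nat w @ encode_nat 1"
proof -
  have "rat_of_nat w = Rat.of_int (int w)" by (simp add: Rat.of_int_def)
  then have "quotient_of (of_nat w) = (int w, 1)" by (simp add: quotient_of_int)
  then show ?thesis by (simp add: encode_rat_def)
qed

lemma encode_list_arcs:
  "encode_list (\<lambda>(u, v, w). encode_nat u @ encode_nat v @ encode_rat w)
    (map (\<lambda>(u, v, w). (u, v, of_nat w)) as) = encode_arcs as @ [False]"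
  by (induction as) (auto simp: encode_list_def encode_arcs_def encode_rat_of_nat)

lemma encode_route_input:
  "encode_mrtt (route_input code n rs) k =
    encode_nat n @ encode_arcs (concat (map (route_arcs code) rs)) @ False #
    encode_trips (consecutive 0 (map len rs)) @ False # encode_nat k"
proof -
  have "encode_list (encode_list encode_nat) Ts = encode_trips Ts @ [False]" for Ts
    by (simp add: encode_trips_def encode_list_def[of "encode_list encode_nat"])
  then show ?thesis unfolding route_input_def encode_mrtt.simps encode_list_arcs by simp
qed

definition encode_both_ways :: "('a \<Rightarrow> nat) \<Rightarrow> 'a route \<Rightarrow> bool list" where
  "encode_both_ways code r =
    encode_arcs (route_arcs code r) @
    encode_arcs (rev (map (\<lambda>(u, v, w). (v, u, w)) (route_arcs code r)))"

lemma encode_arcs_both_ways: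
  assumes "\<And>r. r \<in> set rs \<Longrightarrow> wf_route V r"
  shows "encode_arcs (concat (map (route_arcs code) (both_ways rs))) =
    concat (map (encode_both_ways code) rs)"
  using assms
  by (induction rs)
    (simp_all add: both_ways_def encode_both_ways_def encode_arcs_def[of "[]"]
      route_arcs_rev_route[where V = V])

lemma map_len_both_ways_replicate:
  "(\<And>r. r \<in> set rs \<Longrightarrow> len r = l) \<Longrightarrow> map len (both_ways rs) = replicate (2 * length rs) l"
  by (induction rs) (simp_all add: both_ways_def)

lemma both_ways_append: "both_ways (rs @ rs') = both_ways rs @ both_ways rs'"
  by (simp add: both_ways_def)

lemma consecutive_replicate:
  "consecutive s (replicate k l @ ls) =
    map (\<lambda>i. [s + i * l..<s + i * l + l]) [0..<k] @ consecutive (s + k * l) ls"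
proof (induction k arbitrary: ls)
  case (Suc k)
  have "replicate (Suc k) l @ ls = replicate k l @ (l # ls)" by (simp add: replicate_append_same)
  then show ?case using Suc[of "l # ls"] by (simp add: ac_simps)
qed simp

lemma enumerate_concat_blocks:
  assumes "\<And>i. length (F i) = k"
  shows "List.enumerate s (concat (map F [0..<n])) =
    concat (map (\<lambda>i. List.enumerate (s + i * k) (F i)) [0..<n])"
proof (induction n)
  case (Suc n)
  have "length (concat (map F [0..<n])) = n * k"
    using assms by (simp add: length_concat comp_def sum_list_triv)
  with Suc show ?case by (simp add: enumerate_append_eq)
qed simp

subsection \<open>Programs for routes\<close>

primrec seqs :: "prog list \<Rightarrow> prog" where
  "seqs [] = Nop"
| "seqs (p # ps) = Seq p (seqs ps)"

lemma emitted_seqs: "emitted x (seqs ps) d \<rho> = concat (map (\<lambda>p. emitted x p d \<rho>) ps)"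
  by (induction ps) auto

lemma well_scoped_seqs: "well_scoped d (seqs ps) \<longleftrightarrow> (\<forall>p \<in> set ps. well_scoped d p)"
  by (induction ps) auto

text \<open>A segment \<open>(k, u, v, w)\<close> consists of arcs of weight \<open>w\<close> from \<open>u + i\<close> to \<open>v + i\<close> for \<open>i < k\<close>.\<close>

type_synonym segment = "exp \<times> exp \<times> exp \<times> nat"

fun segment_scoped :: "nat \<Rightarrow> segment \<Rightarrow> bool" where
  "segment_scoped d (k, u, v, w) \<longleftrightarrow> exp_vars k \<union> exp_vars u \<union> exp_vars v \<subseteq> {..<d}"

fun segment_arcs :: "bool list \<Rightarrow> (nat \<Rightarrow> nat) \<Rightarrow> segment \<Rightarrow> (nat \<times> nat \<times> nat) list" where
  "segment_arcs x \<rho> (k, u, v, w) =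
    map (\<lambda>i. (eval x \<rho> u + i, eval x \<rho> v + i, w)) [0..<eval x \<rho> k]"

definition arc_prog :: "exp \<Rightarrow> exp \<Rightarrow> nat \<Rightarrow> prog" where
  "arc_prog u v w =
    seqs [Emit True, EmitNat u, EmitNat v, EmitNat (Const w), EmitNat (Const 1)]"

fun forth_prog :: "nat \<Rightarrow> segment \<Rightarrow> prog" where
  "forth_prog d (k, u, v, w) = For k (arc_prog (Add u (Var d)) (Add v (Var d)) w)"

fun back_prog :: "nat \<Rightarrow> segment \<Rightarrow> prog" where
  "back_prog d (k, u, v, w) = For k (arc_prog (Add v (Var (d + 1))) (Add u (Var (d + 1))) w)"

definition both_ways_prog :: "nat \<Rightarrow> segment list \<Rightarrow> prog" where
  "both_ways_prog d ss = Seq (seqs (map (forth_prog d) ss)) (seqs (map (back_prog d) (rev ss)))"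

lemma eval_upd_loop:
  "exp_vars e \<subseteq> {..<d} \<Longrightarrow> eval x (\<rho>(d := i, d + 1 := j)) e = eval x \<rho> e"
  by (rule eval_cong) auto

lemma emitted_arc_prog:
  "emitted x (arc_prog u v w) d \<rho> = encode_arcs [(eval x \<rho> u, eval x \<rho> v, w)]"
  by (simp add: arc_prog_def encode_arcs_def)

lemma emitted_forth_prog:
  assumes "segment_scoped d s"
  shows "emitted x (forth_prog d s) d \<rho> = encode_arcs (segment_arcs x \<rho> s)"
proof (cases s)
  case (fields k u v w)
  with assms have "eval x (\<rho>(d := i, d + 1 := j)) u = eval x \<rho> u"
    "eval x (\<rho>(d := i, d + 1 := j)) v = eval x \<rho> v" for i j
    by (simp_all only: segment_scoped.simps Un_subset_iff eval_upd_loop)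
  then show ?thesis
    by (simp add: fields emitted_arc_prog encode_arcs_def comp_def)
qed

lemma emitted_back_prog:
  assumes "segment_scoped d s"
  shows "emitted x (back_prog d s) d \<rho> =
    encode_arcs (rev (map (\<lambda>(u, v, w). (v, u, w)) (segment_arcs x \<rho> s)))"
proof (cases s)
  case (fields k u v w)
  have reversed: "map (\<lambda>i. f (n - Suc i)) [0..<n] = rev (map f [0..<n])"
    for f :: "nat \<Rightarrow> bool list" and n
    by (rule nth_equalityI) (simp_all add: rev_nth)
  from fields assms have "eval x (\<rho>(d := i, d + 1 := j)) u = eval x \<rho> u"
    "eval x (\<rho>(d := i, d + 1 := j)) v = eval x \<rho> v" for i j
    by (simp_all only: segment_scoped.simps Un_subset_iff eval_upd_loop)
  then have "emitted x (back_prog d s) d \<rho> = concat (map (\<lambda>i. encode_arcs [(eval x \<rho> v +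
      (eval x \<rho> k - Suc i), eval x \<rho> u + (eval x \<rho> k - Suc i), w)]) [0..<eval x \<rho> k])"
    by (simp add: fields emitted_arc_prog)
  also have "\<dots> = encode_arcs (rev (map (\<lambda>(u, v, w). (v, u, w)) (segment_arcs x \<rho> s)))"
    unfolding reversed[of "\<lambda>i. encode_arcs [(eval x \<rho> v + i, eval x \<rho> u + i, w)]"]
    by (simp add: fields encode_arcs_def comp_def rev_map)
  finally show ?thesis .
qed

lemma emitted_both_ways_prog:
  assumes "\<And>s. s \<in> set ss \<Longrightarrow> segment_scoped d s"
    and "concat (map (segment_arcs x \<rho>) ss) = route_arcs code r"
  shows "emitted x (both_ways_prog d ss) d \<rho> = encode_both_ways code r"
proof -
  have "emitted x (seqs (map (forth_prog d) ss)) d \<rho> =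
      encode_arcs (concat (map (segment_arcs x \<rho>) ss))"
    using assms(1)
    by (simp add: emitted_seqs encode_arcs_concat emitted_forth_prog comp_def cong: map_cong)
  moreover have "map (\<lambda>s. emitted x (back_prog d s) d \<rho>) ss =
      map (\<lambda>s. encode_arcs (rev (map (\<lambda>(u, v, w). (v, u, w)) (segment_arcs x \<rho> s)))) ss"
    using assms(1) by (simp add: emitted_back_prog)
  then have "emitted x (seqs (map (back_prog d) (rev ss))) d \<rho> =
      encode_arcs (rev (map (\<lambda>(u, v, w). (v, u, w)) (concat (map (segment_arcs x \<rho>) ss))))"
    by (simp add: emitted_seqs encode_arcs_concat comp_def map_concat rev_concat
      del: map_eq_conv flip: rev_map)
  ultimately show ?thesis
    by (simp add: both_ways_prog_def encode_both_ways_def assms(2))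
qed

lemma well_scoped_both_ways_prog:
  assumes "\<And>s. s \<in> set ss \<Longrightarrow> segment_scoped d s"
  shows "well_scoped d (both_ways_prog d ss)"
proof -
  have "well_scoped d (forth_prog d s)" "well_scoped d (back_prog d s)" if "s \<in> set ss" for s
    using assms[OF that] by (cases s; force simp: arc_prog_def)+
  then show ?thesis by (auto simp: both_ways_prog_def well_scoped_seqs)
qed

definition trips_prog :: "exp \<Rightarrow> exp \<Rightarrow> exp \<Rightarrow> prog" where
  "trips_prog s k l = For k (seqs [Emit True,
    For l (Seq (Emit True) (EmitNat (Add (Add s (Mul (Var 0) l)) (Var 2)))), Emit False])"

lemma emitted_trips_prog:
  assumes "exp_vars s = {}" "exp_vars l = {}"
  shows "emitted x (trips_prog s k l) 0 \<rho> = encode_trips (map (\<lambda>i.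
    [ceval x s + i * ceval x l..<ceval x s + i * ceval x l + ceval x l]) [0..<eval x \<rho> k])"
proof -
  have upt: "[a..<a + b] = map (\<lambda>j. a + j) [0..<b]" for a b :: nat
    by (rule nth_equalityI) simp_all
  show ?thesis
    unfolding upt
    by (simp add: trips_prog_def encode_trips_def encode_list_def comp_def numeral_2_eq_2
        eval_closed[OF assms(1), of x "fun_upd _ _ _"]
        eval_closed[OF assms(2), of x "fun_upd _ _ _"])
qed

lemma emitted_For_cong:
  assumes "\<And>i. i < eval x \<rho> e \<Longrightarrow>
    emitted x p (d + 2) (\<rho>(d := i, d + 1 := eval x \<rho> e - Suc i)) = f i"
  shows "emitted x (For e p) d \<rho> = concat (map f [0..<eval x \<rho> e])"
  using assms by (auto intro!: arg_cong[of _ _ concat])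

subsection \<open>The program of the reduction\<close>

lemma concat_concat: "concat (concat xsss) = concat (map concat xsss)"
  by (induction xsss) simp_all

definition sum_exp :: "exp list \<Rightarrow> exp" where
  "sum_exp es = foldr Add es (Const 0)"

lemma eval_sum_exp: "eval x \<rho> (sum_exp es) = sum_list (map (eval x \<rho>) es)"
  by (induction es) (simp_all add: sum_exp_def)

lemma exp_vars_sum_exp: "exp_vars (sum_exp es) = (\<Union>e \<in> set es. exp_vars e)"
  by (induction es) (simp_all add: sum_exp_def)

lemma length_family_clauses:
  "length (family_clauses x fam) = ceval x (fst fam) * ceval x (fst (snd fam))"
  by (cases fam) (simp add: family_clauses.simps length_concat comp_def sum_list_triv)

lemma length_concat_family_clauses:
  "length (concat (family_clauses x fam)) =
    ceval x (fst fam) * ceval x (fst (snd fam)) * length (snd (snd fam))"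
proof -
  have "map length (family_clauses x fam) = map (\<lambda>_. length (snd (snd fam))) (family_clauses x fam)"
    by (rule map_cong[OF refl]) (cases fam, auto simp: in_family_clauses)
  then show ?thesis
    by (simp add: length_concat sum_list_triv length_family_clauses del: map_eq_conv)
qed

lemma length_occurrence_links: "length (occurrence_links L s cls) = length (concat cls)"
  by (induction cls arbitrary: s) (simp_all add: occurrence_links_def)

lemma occurrence_links_append:
  "occurrence_links L s (Cs @ Ds) = occurrence_links L s Cs @ occurrence_links L (s + length Cs) Ds"
  by (simp add: occurrence_links_def enumerate_append_eq)

lemma occurrence_links_family:
  "occurrence_links L s (family_clauses x (b1, b2, lits)) =
    concat (map (\<lambda>i. concat (map (\<lambda>j.
      map (\<lambda>l. (Stop (s + i * ceval x b2 + j) L, literal_node l, 2)) (instantiate x i j lits))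
      [0..<ceval x b2])) [0..<ceval x b1])"
proof -
  have "List.enumerate s (map f [0..<k]) = map (\<lambda>j. (s + j, f j)) [0..<k]"
    for s k and f :: "nat \<Rightarrow> (bool \<times> nat) list"
    by (rule nth_equalityI) (simp_all add: nth_enumerate_eq)
  then show ?thesis
    by (simp add: occurrence_links_def family_clauses.simps map_concat concat_concat comp_def
        enumerate_concat_blocks[where k = "ceval x b2"])
qed

context cnf_families
begin

definition clause_count :: exp where
  "clause_count = sum_exp (map (\<lambda>(b1, b2, lits). Mul b1 b2) fams)"

definition occurrence_count :: exp where
  "occurrence_count = sum_exp (map (\<lambda>(b1, b2, lits). Mul (Mul b1 b2) (Const (length lits))) fams)"

text \<open>Large enough for \<open>L * L\<close> to exceed the number of pairs with a node outside the blocks.\<close>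

definition block_length :: exp where
  "block_length = (let lines = Add clause_count (Const 1) in
    Add (Mul (Add (Add (Mul (Const 2) lines) (Const 2)) (Mul (Const 4) var_count))
      (Add (Mul (Const 4) lines) (Const 1))) (Const 1))"

definition line_length :: exp where
  "line_length = Add (Mul (Const 2) block_length) (Const 2)"

definition stop_code :: "exp \<Rightarrow> exp \<Rightarrow> exp" where
  "stop_code c i = Add (Mul c line_length) i"

definition hub_code :: "nat \<Rightarrow> exp" where
  "hub_code j = Add (Mul (Add clause_count (Const 1)) line_length) (Const j)"

definition gadget_code :: "exp \<Rightarrow> nat \<Rightarrow> exp" where
  "gadget_code v i = Add (Add (hub_code 2) (Mul (Const 4) v)) (Const i)"

definition line_segments :: "exp \<Rightarrow> exp \<Rightarrow> segment list" where
  "line_segments c h =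
    [(block_length, stop_code c (Const 0), stop_code c (Const 1), 1),
     (Const 1, stop_code c block_length, h, 2),
     (Const 1, h, stop_code c (Add block_length (Const 1)), 2),
     (block_length, stop_code c (Add block_length (Const 1)),
       stop_code c (Add block_length (Const 2)), 1)]"

definition gadget_segments :: "exp \<Rightarrow> segment list" where
  "gadget_segments v =
    [(Const 1, gadget_code v 0, gadget_code v 1, 1), (Const 1, gadget_code v 1, gadget_code v 2, 2),
     (Const 1, gadget_code v 2, gadget_code v 3, 1)]"

definition link_prog :: "nat \<Rightarrow> exp \<Rightarrow> exp \<Rightarrow> nat \<Rightarrow> prog" where
  "link_prog d a b w = both_ways_prog d [(Const 1, a, b, w)]"

fun occurrence_prog :: "exp \<Rightarrow> bool \<times> exp \<Rightarrow> prog" where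
  "occurrence_prog c (p, e) =
    link_prog 4 (stop_code c block_length) (gadget_code e (if p then 0 else 2)) 2"

fun family_links_prog :: "exp \<Rightarrow> family \<Rightarrow> prog" where
  "family_links_prog s (b1, b2, lits) = For b1 (For b2
    (seqs (map (occurrence_prog (Add (Add s (Mul (Var 0) b2)) (Var 2))) lits)))"

primrec occurrences_prog :: "exp \<Rightarrow> family list \<Rightarrow> prog" where
  "occurrences_prog s [] = Nop"
| "occurrences_prog s (fam # fs) = Seq (family_links_prog s fam)
    (occurrences_prog (Add s (Mul (fst fam) (fst (snd fam)))) fs)"

definition arcs_prog :: prog where
  "arcs_prog = (let port = Add block_length (Const 1) in seqs
    [For clause_count (both_ways_prog 2 (line_segments (Var 0) (hub_code 0))),
     both_ways_prog 0 (line_segments clause_count (hub_code 1)),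
     For var_count (both_ways_prog 2 (gadget_segments (Var 0))),
     For clause_count (link_prog 2 (stop_code (Var 0) port) (hub_code 1) 2),
     link_prog 0 (stop_code clause_count block_length) (hub_code 0) 2,
     For var_count (link_prog 2 (gadget_code (Var 0) 1) (stop_code clause_count port) 1),
     For var_count (link_prog 2 (gadget_code (Var 0) 3) (stop_code clause_count port) 1),
     occurrences_prog (Const 0) fams])"

definition link_count :: exp where
  "link_count = Add (Add clause_count (Const 1)) (Add (Mul (Const 2) var_count) occurrence_count)"

definition all_trips_prog :: prog where
  "all_trips_prog = (let lines = Mul (Const 2) (Add clause_count (Const 1));
      gadgets = Mul (Const 2) var_count;
      first_gadget_arc = Mul lines line_length;
      first_link_arc = Add first_gadget_arc (Mul gadgets (Const 3)) in seqs
    [trips_prog (Const 0) lines line_length,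
     trips_prog first_gadget_arc gadgets (Const 3),
     trips_prog first_link_arc (Mul (Const 2) link_count) (Const 1)])"

definition reduction_prog :: prog where
  "reduction_prog = (let n = gadget_code var_count 0 in seqs
    [EmitNat n, arcs_prog, Emit False, all_trips_prog, Emit False,
     EmitNat (Add (Sub (Mul n n) (Mul block_length block_length)) (Const 1))])"

lemma exp_vars_counts [simp]:
  "exp_vars clause_count = {}" "exp_vars occurrence_count = {}" "exp_vars var_count = {}"
  "exp_vars block_length = {}" "exp_vars line_length = {}" "exp_vars link_count = {}"
proof -
  have "exp_vars b1 = {}" "exp_vars b2 = {}" if "(b1, b2, lits) \<in> set fams" for b1 b2 lits
    using families_ok[OF that] by simp_all
  then show counts: "exp_vars clause_count = {}" "exp_vars occurrence_count = {}"
    by (auto simp: clause_count_def occurrence_count_def exp_vars_sum_exp)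
  show "exp_vars var_count = {}" by (rule closed_var_count)
  with counts show "exp_vars block_length = {}" "exp_vars line_length = {}"
    "exp_vars link_count = {}"
    by (simp_all add: block_length_def line_length_def link_count_def Let_def)
qed

lemma exp_vars_codes [simp]:
  "exp_vars (stop_code c i) = exp_vars c \<union> exp_vars i" "exp_vars (hub_code j) = {}"
  "exp_vars (gadget_code v j) = exp_vars v"
  by (simp_all add: stop_code_def hub_code_def gadget_code_def)

lemma line_segments_scoped:
  "exp_vars c \<union> exp_vars h \<subseteq> {..<d} \<Longrightarrow> s \<in> set (line_segments c h) \<Longrightarrow> segment_scoped d s"
  by (auto simp: line_segments_def)

lemma gadget_segments_scoped:
  "exp_vars v \<subseteq> {..<d} \<Longrightarrow> s \<in> set (gadget_segments v) \<Longrightarrow> segment_scoped d s"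
  by (auto simp: gadget_segments_def)

lemma well_scoped_link_prog:
  "exp_vars a \<union> exp_vars b \<subseteq> {..<d} \<Longrightarrow> well_scoped d (link_prog d a b w)"
  unfolding link_prog_def by (rule well_scoped_both_ways_prog) simp

lemma well_scoped_family_links_prog:
  assumes "family_ok fam" "exp_vars s = {}"
  shows "well_scoped 0 (family_links_prog s fam)"
proof (cases fam)
  case (fields b1 b2 lits)
  have "well_scoped 4 (occurrence_prog (Add (Add s (Mul (Var 0) b2)) (Var 2)) (p, e))"
    if "(p, e) \<in> set lits" for p e
    using assms that unfolding occurrence_prog.simps
    by (intro well_scoped_link_prog) (fastforce simp: fields)
  then show ?thesis
    using assms
    by (auto simp: fields well_scoped_seqs numeral_eq_Suc simp del: occurrence_prog.simps)
qed

lemma well_scoped_occurrences_prog: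
  "(\<And>fam. fam \<in> set fs \<Longrightarrow> family_ok fam) \<Longrightarrow> exp_vars s = {} \<Longrightarrow>
    well_scoped 0 (occurrences_prog s fs)"
proof (induction fs arbitrary: s)
  case (Cons fam fs)
  have "exp_vars (fst fam) = {}" "exp_vars (fst (snd fam)) = {}"
    using Cons.prems(1)[of fam] by (cases fam, simp)+
  with Cons show ?case by (simp add: well_scoped_family_links_prog)
qed simp

lemma well_scoped_reduction_prog: "well_scoped 0 reduction_prog"
proof -
  have "well_scoped 0 arcs_prog"
    using well_scoped_occurrences_prog[OF families_ok, of fams "Const 0"]
    by (auto simp: arcs_prog_def Let_def well_scoped_seqs numeral_2_eq_2
        intro!: well_scoped_both_ways_prog well_scoped_link_prog
        elim: line_segments_scoped[rotated] gadget_segments_scoped[rotated])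
  then show ?thesis
    by (simp add: reduction_prog_def all_trips_prog_def trips_prog_def Let_def)
qed

end


lemma encode_mrtt_in_MRTT_iff:
  "valid_input N \<Longrightarrow> encode_mrtt N k \<in> MRTT \<longleftrightarrow>
    (\<exists>\<tau>. k \<le> reachability (input_digraph N) (input_weight N) (input_trips N) \<tau>)"
  unfolding MRTT_def using encode_mrtt_inj by blast

locale written_formula = cnf_families fams var_count
  for fams :: "family list" and var_count :: exp +
  fixes x :: "bool list"
begin

definition nv :: nat where "nv = ceval x var_count"
definition L :: nat where "L = ceval x block_length"

sublocale formula_network "clauses x fams" nv L
  by unfold_locales (use var_less_count in \<open>simp add: nv_def\<close>)

lemma eval_clause_count: "eval x \<rho> clause_count = m"
proof -
  have "ceval x clause_count = m"
    by (simp add: clause_count_def eval_sum_exp clauses_def length_concat comp_def case_prod_beta'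
        length_family_clauses)
  then show ?thesis using eval_closed[OF exp_vars_counts(1)] by metis
qed

lemma eval_occurrence_count:
  "eval x \<rho> occurrence_count = length (occurrence_links L 0 (clauses x fams))"
proof -
  have "ceval x occurrence_count = length (concat (clauses x fams))"
    by (simp add: occurrence_count_def eval_sum_exp clauses_def concat_concat
        length_concat[of "map _ _"] comp_def case_prod_beta' length_concat_family_clauses)
  then show ?thesis
    using eval_closed[OF exp_vars_counts(2)] length_occurrence_links by metis
qed

lemma eval_counts [simp]:
  "eval x \<rho> clause_count = m" "eval x \<rho> var_count = nv" "eval x \<rho> block_length = L"
  "eval x \<rho> line_length = 2 * L + 2" "eval x \<rho> link_count = length Ls"
proof -
  show m: "eval x \<rho> clause_count = m" by (rule eval_clause_count)
  show nv: "eval x \<rho> var_count = nv" unfolding nv_def by (rule eval_closed) simp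
  show "eval x \<rho> block_length = L" unfolding L_def by (rule eval_closed) simp
  then show "eval x \<rho> line_length = 2 * L + 2" by (simp add: line_length_def)
  show "eval x \<rho> link_count = length Ls"
    by (simp add: link_count_def m nv links_def eval_occurrence_count)
qed

lemma L_eq: "L = (2 * (m + 1) + 2 + 4 * nv) * (4 * (m + 1) + 1) + 1"
  by (simp add: L_def block_length_def Let_def)

lemma eval_codes [simp]:
  "eval x \<rho> (stop_code c i) = node_code m L (Stop (eval x \<rho> c) (eval x \<rho> i))"
  "eval x \<rho> (hub_code j) = node_code m L (Hub j)"
  "eval x \<rho> (gadget_code v j) = node_code m L (Gadget (eval x \<rho> v) j)"
  by (simp_all add: stop_code_def hub_code_def gadget_code_def)

lemma emitted_line:
  assumes "exp_vars c \<union> exp_vars h \<subseteq> {..<d}"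
    and "eval x \<rho> h = node_code m L (line_hub m (eval x \<rho> c))"
  shows "emitted x (both_ways_prog d (line_segments c h)) d \<rho> =
    encode_both_ways (node_code m L) (line_route m L (eval x \<rho> c))"
proof (rule emitted_both_ways_prog)
  have "[0..<2 * L + 2] = [0..<L] @ [L, L + 1] @ map (\<lambda>i. i + (L + 2)) [0..<L]"
    by (rule nth_equalityI) (auto simp: nth_append nth_Cons split: nat.split)
  then show "concat (map (segment_arcs x \<rho>) (line_segments c h)) =
      route_arcs (node_code m L) (line_route m L (eval x \<rho> c))"
    using assms(2) by (auto simp: route_arcs_def line_segments_def line_pos_def line_cum_def)
qed (rule line_segments_scoped[OF assms(1)])

lemma emitted_gadget:
  assumes "exp_vars v \<subseteq> {..<d}"
  shows "emitted x (both_ways_prog d (gadget_segments v)) d \<rho> =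
    encode_both_ways (node_code m L) (gadget_route (eval x \<rho> v))"
proof (rule emitted_both_ways_prog[OF gadget_segments_scoped[OF assms]])
  have "[0..<3] = [0, 1, 2]" by (simp add: upt_conv_Cons)
  then show "concat (map (segment_arcs x \<rho>) (gadget_segments v)) =
      route_arcs (node_code m L) (gadget_route (eval x \<rho> v))"
    by (simp add: route_arcs_def gadget_segments_def gadget_cum_def)
qed

lemma emitted_link:
  assumes "exp_vars a \<union> exp_vars b \<subseteq> {..<d}"
    and "eval x \<rho> a = node_code m L u" "eval x \<rho> b = node_code m L v"
  shows "emitted x (link_prog d a b w) d \<rho> =
    encode_both_ways (node_code m L) (link_route (u, v, w))"
  unfolding link_prog_def
  by (rule emitted_both_ways_prog) (use assms in \<open>auto simp: route_arcs_def\<close>)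

lemma emitted_family_links:
  assumes "family_ok (b1, b2, lits)" "exp_vars s = {}"
  shows "emitted x (family_links_prog s (b1, b2, lits)) 0 (\<lambda>_. 0) =
    concat (map (encode_both_ways (node_code m L) \<circ> link_route)
      (occurrence_links L (ceval x s) (family_clauses x (b1, b2, lits))))"
proof -
  let ?encode = "encode_both_ways (node_code m L) \<circ> link_route"
  from assms(1) have closed: "exp_vars b1 = {}" "exp_vars b2 = {}"
    and lits: "\<And>p e. (p, e) \<in> set lits \<Longrightarrow> exp_vars e \<subseteq> {0, 2}" by auto
  let ?line = "Add (Add s (Mul (Var 0) b2)) (Var 2)"
  let ?link = "\<lambda>i j l. (Stop (ceval x s + i * ceval x b2 + j) L,
      literal_node (fst l, eval x (loop_env i j) (snd l)), 2)"
  have "emitted x (occurrence_prog ?line l) 4 \<rho> = ?encode (?link (\<rho> 0) (\<rho> 2) l)"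
    if "l \<in> set lits" for l \<rho>
  proof (cases l)
    case (Pair p e)
    with that lits have vars: "exp_vars e \<subseteq> {0, 2}" by blast
    then have "eval x \<rho> e = eval x (loop_env (\<rho> 0) (\<rho> 2)) e" by (intro eval_cong) auto
    then show ?thesis
      using vars assms(2) closed unfolding Pair occurrence_prog.simps comp_def
      by (intro emitted_link)
        (auto simp: literal_node_def eval_closed[OF assms(2), of x \<rho>]
          eval_closed[OF closed(2), of x \<rho>])
  qed
  then have "emitted x (seqs (map (occurrence_prog ?line) lits)) 4 \<rho> =
      concat (map (\<lambda>l. ?encode (?link (\<rho> 0) (\<rho> 2) l)) lits)" for \<rho>
    by (auto simp: emitted_seqs intro!: arg_cong[of _ _ concat])
  then have "emitted x (family_links_prog s (b1, b2, lits)) 0 (\<lambda>_. 0) = concat (map (\<lambda>i. concat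
      (map (\<lambda>j. concat (map (\<lambda>l. ?encode (?link i j l)) lits)) [0..<ceval x b2])) [0..<ceval x b1])"
    by (simp add: eval_closed[OF closed(2), of x "fun_upd _ _ _"] numeral_eq_Suc
        del: link_route.simps)
  also have "\<dots> = concat (map ?encode
      (occurrence_links L (ceval x s) (family_clauses x (b1, b2, lits))))"
    by (simp add: occurrence_links_family map_concat concat_concat comp_def case_prod_beta'
        del: link_route.simps)
  finally show ?thesis .
qed

lemma emitted_occurrences_prog:
  assumes "\<And>fam. fam \<in> set fs \<Longrightarrow> family_ok fam" "exp_vars s = {}"
  shows "emitted x (occurrences_prog s fs) 0 (\<lambda>_. 0) =
    concat (map (encode_both_ways (node_code m L) \<circ> link_route)
      (occurrence_links L (ceval x s) (clauses x fs)))"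
  using assms
proof (induction fs arbitrary: s)
  case Nil
  then show ?case by (simp add: clauses_def occurrence_links_def)
next
  case (Cons fam fs)
  obtain b1 b2 lits where fam: "fam = (b1, b2, lits)" by (metis surj_pair)
  have ok: "family_ok (b1, b2, lits)" using Cons.prems(1)[of fam] unfolding fam by simp
  have "emitted x (occurrences_prog (Add s (Mul b1 b2)) fs) 0 (\<lambda>_. 0) =
      concat (map (encode_both_ways (node_code m L) \<circ> link_route)
        (occurrence_links L (ceval x (Add s (Mul b1 b2))) (clauses x fs)))"
    by (rule Cons.IH) (use Cons.prems ok in auto)
  moreover have "clauses x (fam # fs) = family_clauses x fam @ clauses x fs"
    by (simp add: clauses_def)
  ultimately show ?case
    using emitted_family_links[OF ok Cons.prems(2)]
    by (simp add: fam occurrence_links_append length_family_clauses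
        del: family_links_prog.simps comp_apply)
qed

lemma emitted_link_loop:
  assumes "exp_vars a \<union> exp_vars b \<subseteq> {..<2}"
    and "\<And>\<rho>. eval x \<rho> a = node_code m L (u (\<rho> 0))" "\<And>\<rho>. eval x \<rho> b = node_code m L (v (\<rho> 0))"
  shows "emitted x (For k (link_prog 2 a b w)) 0 \<rho> = concat (map
    (\<lambda>i. encode_both_ways (node_code m L) (link_route (u i, v i, w))) [0..<eval x \<rho> k])"
  by (rule emitted_For_cong, subst add_0, subst emitted_link[OF assms(1)])
    (simp_all add: assms(2,3))

lemma emitted_arcs_prog:
  "emitted x arcs_prog 0 (\<lambda>_. 0) = concat (map (encode_both_ways (node_code m L)) Rs)"
proof -
  let ?encode = "encode_both_ways (node_code m L)" and ?port = "Add block_length (Const 1)"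
  have lines: "emitted x (For clause_count (both_ways_prog 2 (line_segments (Var 0) (hub_code 0))))
      0 (\<lambda>_. 0) = concat (map (\<lambda>c. ?encode (line_route m L c)) [0..<ceval x clause_count])"
    by (rule emitted_For_cong, subst add_0, subst emitted_line) (simp_all add: line_hub_def)
  have last_line: "emitted x (both_ways_prog 0 (line_segments clause_count (hub_code 1))) 0
      (\<lambda>_. 0) = ?encode (line_route m L m)"
    by (subst emitted_line) (simp_all add: line_hub_def)
  have gadgets: "emitted x (For var_count (both_ways_prog 2 (gadget_segments (Var 0)))) 0 (\<lambda>_. 0) =
      concat (map (\<lambda>v. ?encode (gadget_route v)) [0..<ceval x var_count])"
    by (rule emitted_For_cong, subst add_0, subst emitted_gadget) simp_all
  have second_ports: "emitted x
      (For clause_count (link_prog 2 (stop_code (Var 0) ?port) (hub_code 1) 2)) 0 (\<lambda>_. 0) =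
      concat (map (\<lambda>c. ?encode (link_route (Stop c (L + 1), Hub 1, 2)))
        [0..<ceval x clause_count])"
    by (rule emitted_link_loop) simp_all
  have last_port: "emitted x (link_prog 0 (stop_code clause_count block_length) (hub_code 0) 2) 0
      (\<lambda>_. 0) = ?encode (link_route (Stop m L, Hub 0, 2))"
    by (rule emitted_link) simp_all
  have gadget_exits: "emitted x (For var_count (link_prog 2 (gadget_code (Var 0) i)
      (stop_code clause_count ?port) 1)) 0 (\<lambda>_. 0) = concat (map (\<lambda>v. ?encode
        (link_route (Gadget v i, Stop m (L + 1), 1))) [0..<ceval x var_count])" for i
    by (rule emitted_link_loop) simp_all
  have occurrences: "emitted x (occurrences_prog (Const 0) fams) 0 (\<lambda>_. 0) =
      concat (map (?encode \<circ> link_route) (occurrence_links L 0 (clauses x fams)))"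
    using emitted_occurrences_prog[OF families_ok, of fams "Const 0"] by simp
  show ?thesis
    unfolding arcs_prog_def Let_def emitted_seqs list.map lines last_line gadgets second_ports
      last_port gadget_exits occurrences eval_counts
    by (simp add: formula_routes_def links_def comp_def del: link_route.simps)
qed

lemma emitted_all_trips_prog:
  "emitted x all_trips_prog 0 (\<lambda>_. 0) = encode_trips (consecutive 0 (map len (both_ways Rs)))"
proof -
  have "len (link_route e) = 1" for e by (cases e) simp
  then have "map len (both_ways Rs) = replicate (2 * (m + 1)) (2 * L + 2) @ replicate (2 * nv) 3 @
      replicate (2 * length Ls) 1"
    unfolding formula_routes_def both_ways_append map_append
    by (subst (1 2 3) map_len_both_ways_replicate) auto
  then have "consecutive 0 (map len (both_ways Rs)) = consecutive 0
      (replicate (2 * (m + 1)) (2 * L + 2) @ replicate (2 * nv) 3 @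
        replicate (2 * length Ls) 1 @ [])"
    by simp
  then show ?thesis
    unfolding consecutive_replicate
    by (simp add: all_trips_prog_def Let_def emitted_seqs emitted_trips_prog
      encode_trips_def[of "[]"] del: upt_Suc)
qed

lemma emitted_reduction_prog:
  "emitted x reduction_prog 0 (\<lambda>_. 0) =
    encode_mrtt (formula_input (clauses x fams) nv L) (formula_bound m nv L)"
proof -
  have "ceval x (gadget_code var_count 0) = n" by (simp add: node_count_def)
  then show ?thesis
    by (simp add: reduction_prog_def Let_def emitted_seqs formula_input_def encode_route_input
        encode_arcs_both_ways[OF wf_formula_route] emitted_arcs_prog emitted_all_trips_prog
        formula_bound_def del: eval_codes)
qed

lemma blocks_dominate: "n * n + 1 \<le> L * L + ((m + 1) * (2 * L)) * ((m + 1) * (2 * L))"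
proof -
  define others lines where "others = 2 * (m + 1) + 2 + 4 * nv" and "lines = m + 1"
  have L: "L = others * (4 * lines + 1) + 1" unfolding L_eq others_def lines_def ..
  then have "others * others + 1 \<le> others * L + L" by (intro add_mono mult_le_mono2) auto
  moreover have "L * L = (others * (4 * lines + 1) + 1) * L" using L by simp
  moreover have "n = lines * (2 * L) + others" by (simp add: node_count_def others_def lines_def)
  ultimately show ?thesis unfolding lines_def[symmetric] by (simp add: algebra_simps)
qed

lemma reduction_prog_correct:
  "emitted x reduction_prog 0 (\<lambda>_. 0) \<in> symmetric_strongly_connected_inputs"
  "emitted x reduction_prog 0 (\<lambda>_. 0) \<in> MRTT \<longleftrightarrow> satisfiable (clauses x fams)"
  unfolding emitted_reduction_prog symmetric_strongly_connected_inputs_def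
  using formula_input_correct[OF blocks_dominate] by (blast, simp add: encode_mrtt_in_MRTT_iff)

end

theorem theorem8:
  shows "NP_hard_on symmetric_strongly_connected_inputs MRTT"
  unfolding NP_hard_on_def
proof (intro allI impI)
  fix A assume "in_NP A"
  then obtain fams var_count where families: "cnf_families fams var_count"
    and A: "x \<in> A \<longleftrightarrow> satisfiable (clauses x fams)" for x
    using cook_levin by metis
  interpret cnf_families fams var_count by (rule families)
  let ?f = "\<lambda>x. emitted x reduction_prog 0 (\<lambda>_. 0)"
  have "?f x \<in> symmetric_strongly_connected_inputs" "x \<in> A \<longleftrightarrow> ?f x \<in> MRTT" for x
  proof -
    interpret written_formula fams var_count x by unfold_locales
    show "?f x \<in> symmetric_strongly_connected_inputs" "x \<in> A \<longleftrightarrow> ?f x \<in> MRTT"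
      using reduction_prog_correct A by simp_all
  qed
  then show "\<exists>f. polytime f \<and> (\<forall>x. f x \<in> symmetric_strongly_connected_inputs \<and>
      (x \<in> A \<longleftrightarrow> f x \<in> MRTT))"
    using polytime_prog[OF well_scoped_reduction_prog] by blast
qed

end
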